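(* Let $\mathcal{P}$ be a binary quadratic nonsymmetric operad. There is an isomorphism of nonsymmetric operads $$\mathrm{BSu}(\mathcal{P})\;\cong\;\mathit{Dend}\ \blacksquare\ \mathcal{P},$$ where $\mathrm{BSu}(\mathcal P)$ is the bisuccessor of $\mathcal P$ and $\blacksquare$ is the black square product.
   Context: Fix a field $\mathbf{k}$. For a vector space $V$ in arity 2, $\mathcal{T}_{ns}(V)$ is the free nonsymmetric (ns) operad on $V$: in arity $n$, it is spanned by planar binary rooted trees with $n$ leaves (numbered $1,\dots,n$ from left to right) with vertices labeled by elements of $V$, multilinearly. A binary quadratic ns operad is $\mathcal{P}=\mathcal{T}_{ns}(V)/(R)$ with $R$ a subspace of $\mathcal{T}_{ns}(V)_3=(V\circ_1V)\oplus(V\circ_2V)$, where $\omega\circ_1\nu=\omega(\nu(x,y),z)$ and $\omega\circ_2\nu=\omega(x,\nu(y,z))$. **Bisuccessor.** $\widetilde V=V\otimes(\mathbf{k}\prec\oplus\,\mathbf{k}\succ)$, $\omega_\prec=\omega\otimes\prec$, $\omega_\succ=\omega\otimes\succ$, $\omega_\star=\omega_\prec+\omega_\succ$. For a labeled tree $\tau$ and leaf $x$, $\mathrm{BSu}_x(\tau)$ is obtained by relabeling: a vertex labeled $\omega$ on the path from the root to $x$ gets $\omega_\prec$ if the path turns left there and $\omega_\succ$ if it turns right there; a vertex labeled $\omega$ off the path gets $\omega_\star$. Extend linearly. $\mathrm{BSu}(\mathcal{P})=\mathcal{T}_{ns}(\widetilde V)/(\mathrm{BSu}_x(r):r\in R,\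 x\in\{1,2,3\})$. **Dend.** $\mathit{Dend}$ is the ns operad of dendriform algebras: operations $\prec,\succ$ with $(x\prec y)\prec z=x\prec(y\prec z+y\succ z)$, $(x\succ y)\prec z=x\succ(y\prec z)$, $(x\prec y+x\succ y)\succ z=x\succ(y\succ z)$. **Black square product.** For binary quadratic ns operads, $\mathcal{T}_{ns}(V)/(R)\ \blacksquare\ \mathcal{T}_{ns}(W)/(S)=\mathcal{T}_{ns}(V\otimes W)/(\Psi(R\otimes S))$ with $\Psi((\omega\circ_1\nu)\otimes(\omega'\circ_1\nu'))=(\omega\otimes\omega')\circ_1(\nu\otimes\nu')$, $\Psi((\omega\circ_2\nu)\otimes(\omega'\circ_2\nu'))=-(\omega\otimes\omega')\circ_2(\nu\otimes\nu')$, and $\Psi((\omega\circ_a\nu)\otimes(\omega'\circ_b\nu'))=0$ for $a\neq b$. *)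

theory Defs
  imports "HOL-Algebra.Module" "HOL-Algebra.AbelCoset" "HOL-Library.Tree"
begin

text \<open>Vector spaces over a field \<open>K\<close> are modules over \<open>K\<close> in the sense of HOL-Algebra.
  The record type of modules extends that of rings; the multiplicative fields are
  irrelevant for modules and left undefined.\<close>

section \<open>Linear algebra\<close>

definition linear_span ::
  "('a, 'k) ring_scheme \<Rightarrow> ('a, 'b) module \<Rightarrow> 'b set \<Rightarrow> 'b set" where
  "linear_span K M S = \<Inter>{N. submodule N K M \<and> S \<subseteq> N}"

definition linear_map ::
  "('a, 'k) ring_scheme \<Rightarrow> ('a, 'b) module \<Rightarrow> ('a, 'c) module \<Rightarrow> ('b \<Rightarrow> 'c) \<Rightarrow> bool" where
  "linear_map K M N f \<longleftrightarrow>
     f \<in> carrier M \<rightarrow> carrier N \<and>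
     (\<forall>x\<in>carrier M. \<forall>y\<in>carrier M. f (x \<oplus>\<^bsub>M\<^esub> y) = f x \<oplus>\<^bsub>N\<^esub> f y) \<and>
     (\<forall>c\<in>carrier K. \<forall>x\<in>carrier M. f (c \<odot>\<^bsub>M\<^esub> x) = c \<odot>\<^bsub>N\<^esub> f x)"

definition quot_module ::
  "('a, 'b) module \<Rightarrow> 'b set \<Rightarrow> ('a, 'b set) module" where
  "quot_module M N =
     \<lparr> carrier = a_rcosets\<^bsub>M\<^esub> N, mult = undefined, one = undefined,
       zero = N, add = (\<lambda>A B. A <+>\<^bsub>M\<^esub> B),
       smult = (\<lambda>c A. \<Union>a\<in>A. N +>\<^bsub>M\<^esub> (c \<odot>\<^bsub>M\<^esub> a)) \<rparr>"

text \<open>The vector space with basis \<open>X\<close>, as finitely supported functions.\<close>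

definition free_module ::
  "('a, 'k) ring_scheme \<Rightarrow> 'x set \<Rightarrow> ('a, 'x \<Rightarrow> 'a) module" where
  "free_module K X =
     \<lparr> carrier = {f. range f \<subseteq> carrier K \<and> finite {x. f x \<noteq> \<zero>\<^bsub>K\<^esub>} \<and> {x. f x \<noteq> \<zero>\<^bsub>K\<^esub>} \<subseteq> X},
       mult = undefined, one = undefined,
       zero = (\<lambda>_. \<zero>\<^bsub>K\<^esub>), add = (\<lambda>f g x. f x \<oplus>\<^bsub>K\<^esub> g x),
       smult = (\<lambda>c f x. c \<otimes>\<^bsub>K\<^esub> f x) \<rparr>"

definition basis_vec :: "('a, 'k) ring_scheme \<Rightarrow> 'x \<Rightarrow> 'x \<Rightarrow> 'a" where
  "basis_vec K x = (\<lambda>y. if y = x then \<one>\<^bsub>K\<^esub> else \<zero>\<^bsub>K\<^esub>)"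

definition lin_ext ::
  "('a, 'k) ring_scheme \<Rightarrow> ('a, 'b) module \<Rightarrow> ('x \<Rightarrow> 'b) \<Rightarrow> ('x \<Rightarrow> 'a) \<Rightarrow> 'b" where
  "lin_ext K M \<phi> f = (\<Oplus>\<^bsub>M\<^esub>x\<in>{x. f x \<noteq> \<zero>\<^bsub>K\<^esub>}. f x \<odot>\<^bsub>M\<^esub> \<phi> x)"

text \<open>The linear map from a quotient of a free module to \<open>M\<close> that sends the class of each
  basis element \<open>x\<close> to \<open>\<phi> x\<close>. It is meaningful when the linear extension of \<open>\<phi>\<close> is constant
  on cosets.\<close>

definition quot_lift ::
  "('a, 'k) ring_scheme \<Rightarrow> ('a, 'b) module \<Rightarrow> ('x \<Rightarrow> 'b) \<Rightarrow> ('x \<Rightarrow> 'a) set \<Rightarrow> 'b" where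
  "quot_lift K M \<phi> C = the_elem (lin_ext K M \<phi> ` C)"

definition bilinear_rels ::
  "('a, 'k) ring_scheme \<Rightarrow> ('a, 'v) module \<Rightarrow> ('a, 'w) module \<Rightarrow> ('v \<times> 'w \<Rightarrow> 'a) set" where
  "bilinear_rels K V W =
     (let F = free_module K (carrier V \<times> carrier W); e = (\<lambda>v w. basis_vec K (v, w)) in
       {e (v \<oplus>\<^bsub>V\<^esub> v') w \<ominus>\<^bsub>F\<^esub> e v w \<ominus>\<^bsub>F\<^esub> e v' w | v v' w.
          v \<in> carrier V \<and> v' \<in> carrier V \<and> w \<in> carrier W} \<union>
       {e v (w \<oplus>\<^bsub>W\<^esub> w') \<ominus>\<^bsub>F\<^esub> e v w \<ominus>\<^bsub>F\<^esub> e v w' | v w w'.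
          v \<in> carrier V \<and> w \<in> carrier W \<and> w' \<in> carrier W} \<union>
       {e (c \<odot>\<^bsub>V\<^esub> v) w \<ominus>\<^bsub>F\<^esub> c \<odot>\<^bsub>F\<^esub> e v w | c v w.
          c \<in> carrier K \<and> v \<in> carrier V \<and> w \<in> carrier W} \<union>
       {e v (c \<odot>\<^bsub>W\<^esub> w) \<ominus>\<^bsub>F\<^esub> c \<odot>\<^bsub>F\<^esub> e v w | c v w.
          c \<in> carrier K \<and> v \<in> carrier V \<and> w \<in> carrier W})"

definition tensor_null ::
  "('a, 'k) ring_scheme \<Rightarrow> ('a, 'v) module \<Rightarrow> ('a, 'w) module \<Rightarrow> ('v \<times> 'w \<Rightarrow> 'a) set" where
  "tensor_null K V W =
     linear_span K (free_module K (carrier V \<times> carrier W)) (bilinear_rels K V W)"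

definition tensor_module ::
  "('a, 'k) ring_scheme \<Rightarrow> ('a, 'v) module \<Rightarrow> ('a, 'w) module \<Rightarrow>
   ('a, ('v \<times> 'w \<Rightarrow> 'a) set) module" where
  "tensor_module K V W =
     quot_module (free_module K (carrier V \<times> carrier W)) (tensor_null K V W)"

definition pure_tensor ::
  "('a, 'k) ring_scheme \<Rightarrow> ('a, 'v) module \<Rightarrow> ('a, 'w) module \<Rightarrow> 'v \<Rightarrow> 'w \<Rightarrow>
   ('v \<times> 'w \<Rightarrow> 'a) set" where
  "pure_tensor K V W v w =
     tensor_null K V W +>\<^bsub>free_module K (carrier V \<times> carrier W)\<^esub> basis_vec K (v, w)"


section \<open>Nonsymmetric operads\<close>

text \<open>\<open>circ P m i n x y\<close> is the partial composition of \<open>x\<close> of arity \<open>m\<close> with \<open>y\<close> of arity \<open>n\<close>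
  at the input \<open>i\<close> of \<open>x\<close>, where \<open>1 \<le> i \<le> m\<close>; it has arity \<open>m + n - 1\<close>.\<close>

record ('a, 'p) operad_struct =
  arity :: "nat \<Rightarrow> ('a, 'p) module"
  circ :: "nat \<Rightarrow> nat \<Rightarrow> nat \<Rightarrow> 'p \<Rightarrow> 'p \<Rightarrow> 'p"
  ident :: 'p

locale ns_operad =
  fixes K :: "('a, 'k) ring_scheme" and P :: "('a, 'p) operad_struct"
  assumes field_K: "field K"
    and arity_module: "module K (arity P n)"
    and ident_closed: "ident P \<in> carrier (arity P 1)"
    and circ_linear_left:
      "\<lbrakk>1 \<le> i; i \<le> m; y \<in> carrier (arity P n)\<rbrakk> \<Longrightarrow>
       linear_map K (arity P m) (arity P (m + n - 1)) (\<lambda>x. circ P m i n x y)"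
    and circ_linear_right:
      "\<lbrakk>1 \<le> i; i \<le> m; x \<in> carrier (arity P m)\<rbrakk> \<Longrightarrow>
       linear_map K (arity P n) (arity P (m + n - 1)) (\<lambda>y. circ P m i n x y)"
    and circ_ident_left:
      "x \<in> carrier (arity P n) \<Longrightarrow> circ P 1 1 n (ident P) x = x"
    and circ_ident_right:
      "\<lbrakk>1 \<le> i; i \<le> n; x \<in> carrier (arity P n)\<rbrakk> \<Longrightarrow> circ P n i 1 x (ident P) = x"
    and circ_sequential:
      "\<lbrakk>1 \<le> i; i \<le> l; 1 \<le> j; j \<le> m;
        x \<in> carrier (arity P l); y \<in> carrier (arity P m); z \<in> carrier (arity P n)\<rbrakk> \<Longrightarrow>
       circ P (l + m - 1) (i + j - 1) n (circ P l i m x y) z =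
       circ P l i (m + n - 1) x (circ P m j n y z)"
    and circ_parallel:
      "\<lbrakk>1 \<le> i; i < k; k \<le> l;
        x \<in> carrier (arity P l); y \<in> carrier (arity P m); z \<in> carrier (arity P n)\<rbrakk> \<Longrightarrow>
       circ P (l + m - 1) (k + m - 1) n (circ P l i m x y) z =
       circ P (l + n - 1) i m (circ P l k n x z) y"

definition ns_operad_iso ::
  "('a, 'k) ring_scheme \<Rightarrow> ('a, 'p) operad_struct \<Rightarrow> ('a, 'q) operad_struct \<Rightarrow>
   (nat \<Rightarrow> 'p \<Rightarrow> 'q) \<Rightarrow> bool" where
  "ns_operad_iso K P Q f \<longleftrightarrow>
     ns_operad K P \<and> ns_operad K Q \<and>
     (\<forall>n. linear_map K (arity P n) (arity Q n) (f n) \<and>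
          bij_betw (f n) (carrier (arity P n)) (carrier (arity Q n))) \<and>
     f 1 (ident P) = ident Q \<and>
     (\<forall>m n i. \<forall>x\<in>carrier (arity P m). \<forall>y\<in>carrier (arity P n). 1 \<le> i \<and> i \<le> m \<longrightarrow>
        f (m + n - 1) (circ P m i n x y) = circ Q m i n (f m x) (f n y))"

definition operad_isomorphic ::
  "('a, 'k) ring_scheme \<Rightarrow> ('a, 'p) operad_struct \<Rightarrow> ('a, 'q) operad_struct \<Rightarrow> bool" where
  "operad_isomorphic K P Q \<longleftrightarrow> (\<exists>f. ns_operad_iso K P Q f)"

definition operad_ideal ::
  "('a, 'k) ring_scheme \<Rightarrow> ('a, 'p) operad_struct \<Rightarrow> (nat \<Rightarrow> 'p set) \<Rightarrow> bool" where
  "operad_ideal K P I \<longleftrightarrow>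
     (\<forall>n. submodule (I n) K (arity P n)) \<and>
     (\<forall>m n i. \<forall>x\<in>carrier (arity P m). \<forall>y\<in>carrier (arity P n).
        1 \<le> i \<and> i \<le> m \<and> (x \<in> I m \<or> y \<in> I n) \<longrightarrow> circ P m i n x y \<in> I (m + n - 1))"

text \<open>The operadic ideal generated by a set \<open>G\<close> of elements of arity \<open>d\<close>.\<close>

definition generated_ideal ::
  "('a, 'k) ring_scheme \<Rightarrow> ('a, 'p) operad_struct \<Rightarrow> nat \<Rightarrow> 'p set \<Rightarrow> nat \<Rightarrow> 'p set" where
  "generated_ideal K P d G = (\<lambda>n. \<Inter>{I n | I. operad_ideal K P I \<and> G \<subseteq> I d})"

definition quot_operad ::
  "('a, 'p) operad_struct \<Rightarrow> (nat \<Rightarrow> 'p set) \<Rightarrow> ('a, 'p set) operad_struct" where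
  "quot_operad P I =
     \<lparr> arity = (\<lambda>n. quot_module (arity P n) (I n)),
       circ = (\<lambda>m i n A B. \<Union>a\<in>A. \<Union>b\<in>B. I (m + n - 1) +>\<^bsub>arity P (m + n - 1)\<^esub> circ P m i n a b),
       ident = I 1 +>\<^bsub>arity P 1\<^esub> ident P \<rparr>"


section \<open>The free nonsymmetric operad on binary operations\<close>

text \<open>A planar binary rooted tree with labelled vertices is a binary tree whose leaves
  \<open>\<langle>\<rangle>\<close> are the inputs. The number of leaves of \<open>t\<close> is \<open>size1 t\<close>, and leaves are numbered from left to right, starting from \<open>1\<close>.\<close>

definition ltrees :: "('a, 'v) module \<Rightarrow> nat \<Rightarrow> 'v tree set" where
  "ltrees V n = {t. set_tree t \<subseteq> carrier V \<and> size1 t = n}"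

text \<open>\<open>graft t i s\<close> replaces the leaf \<open>i\<close> of \<open>t\<close> by \<open>s\<close>.\<close>

fun graft :: "'v tree \<Rightarrow> nat \<Rightarrow> 'v tree \<Rightarrow> 'v tree" where
  "graft \<langle>\<rangle> i s = s"
| "graft \<langle>l, \<omega>, r\<rangle> i s =
     (if i \<le> size1 l then \<langle>graft l i s, \<omega>, r\<rangle> else \<langle>l, \<omega>, graft r (i - size1 l) s\<rangle>)"

definition tree_operad ::
  "('a, 'k) ring_scheme \<Rightarrow> ('a, 'v) module \<Rightarrow> ('a, 'v tree \<Rightarrow> 'a) operad_struct" where
  "tree_operad K V =
     \<lparr> arity = (\<lambda>n. free_module K (ltrees V n)),
       circ = (\<lambda>m i n f g.
         let F = free_module K (ltrees V (m + n - 1))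
         in lin_ext K F (\<lambda>s. lin_ext K F (\<lambda>t. basis_vec K (graft s i t)) g) f),
       ident = basis_vec K \<langle>\<rangle> \<rparr>"

text \<open>\<open>add_at V t t1 t2\<close>: the three trees agree except at one vertex, where the label of \<open>t\<close> is
  the sum of the labels of \<open>t1\<close> and \<open>t2\<close>. \<open>scale_at V c t t'\<close>: the two trees agree except at
  one vertex, where the label of \<open>t\<close> is \<open>c\<close> times that of \<open>t'\<close>.\<close>

inductive add_at :: "('a, 'v) module \<Rightarrow> 'v tree \<Rightarrow> 'v tree \<Rightarrow> 'v tree \<Rightarrow> bool" for V where
  "add_at V \<langle>l, v \<oplus>\<^bsub>V\<^esub> w, r\<rangle> \<langle>l, v, r\<rangle> \<langle>l, w, r\<rangle>"
| "add_at V l l1 l2 \<Longrightarrow> add_at V \<langle>l, v, r\<rangle> \<langle>l1, v, r\<rangle> \<langle>l2, v, r\<rangle>"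
| "add_at V r r1 r2 \<Longrightarrow> add_at V \<langle>l, v, r\<rangle> \<langle>l, v, r1\<rangle> \<langle>l, v, r2\<rangle>"

inductive scale_at :: "('a, 'v) module \<Rightarrow> 'a \<Rightarrow> 'v tree \<Rightarrow> 'v tree \<Rightarrow> bool" for V c where
  "scale_at V c \<langle>l, c \<odot>\<^bsub>V\<^esub> v, r\<rangle> \<langle>l, v, r\<rangle>"
| "scale_at V c l l' \<Longrightarrow> scale_at V c \<langle>l, v, r\<rangle> \<langle>l', v, r\<rangle>"
| "scale_at V c r r' \<Longrightarrow> scale_at V c \<langle>l, v, r\<rangle> \<langle>l, v, r'\<rangle>"

definition multilinear_rels ::
  "('a, 'k) ring_scheme \<Rightarrow> ('a, 'v) module \<Rightarrow> nat \<Rightarrow> ('v tree \<Rightarrow> 'a) set" where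
  "multilinear_rels K V n =
     (let F = free_module K (ltrees V n) in
       {basis_vec K t \<ominus>\<^bsub>F\<^esub> basis_vec K t1 \<ominus>\<^bsub>F\<^esub> basis_vec K t2 | t t1 t2.
          t1 \<in> ltrees V n \<and> t2 \<in> ltrees V n \<and> add_at V t t1 t2} \<union>
       {basis_vec K t \<ominus>\<^bsub>F\<^esub> c \<odot>\<^bsub>F\<^esub> basis_vec K t' | c t t'.
          c \<in> carrier K \<and> t' \<in> ltrees V n \<and> scale_at V c t t'})"

definition multilinear_null ::
  "('a, 'k) ring_scheme \<Rightarrow> ('a, 'v) module \<Rightarrow> nat \<Rightarrow> ('v tree \<Rightarrow> 'a) set" where
  "multilinear_null K V n =
     linear_span K (free_module K (ltrees V n)) (multilinear_rels K V n)"

definition free_operad ::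
  "('a, 'k) ring_scheme \<Rightarrow> ('a, 'v) module \<Rightarrow> ('a, ('v tree \<Rightarrow> 'a) set) operad_struct" where
  "free_operad K V = quot_operad (tree_operad K V) (multilinear_null K V)"

text \<open>The element of the free operad represented by a labelled tree.\<close>

definition tree_elem ::
  "('a, 'k) ring_scheme \<Rightarrow> ('a, 'v) module \<Rightarrow> 'v tree \<Rightarrow> ('v tree \<Rightarrow> 'a) set" where
  "tree_elem K V t =
     multilinear_null K V (size1 t) +>\<^bsub>free_module K (ltrees V (size1 t))\<^esub> basis_vec K t"

definition circ1_tree :: "'v \<Rightarrow> 'v \<Rightarrow> 'v tree" where
  "circ1_tree \<omega> \<nu> = \<langle>\<langle>\<langle>\<rangle>, \<nu>, \<langle>\<rangle>\<rangle>, \<omega>, \<langle>\<rangle>\<rangle>"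

definition circ2_tree :: "'v \<Rightarrow> 'v \<Rightarrow> 'v tree" where
  "circ2_tree \<omega> \<nu> = \<langle>\<langle>\<rangle>, \<omega>, \<langle>\<langle>\<rangle>, \<nu>, \<langle>\<rangle>\<rangle>\<rangle>"


section \<open>Binary quadratic operads\<close>

text \<open>The bisuccessor and the black square product depend on the presentation, so a binary
  quadratic operad is given by its generators and its relators.\<close>

record ('a, 'v) quad_pres =
  gens :: "('a, 'v) module"
  rels :: "('v tree \<Rightarrow> 'a) set set"

definition binary_quadratic :: "('a, 'k) ring_scheme \<Rightarrow> ('a, 'v) quad_pres \<Rightarrow> bool" where
  "binary_quadratic K P \<longleftrightarrow>
     module K (gens P) \<and> submodule (rels P) K (arity (free_operad K (gens P)) 3)"

definition presented_operad ::
  "('a, 'k) ring_scheme \<Rightarrow> ('a, 'v) quad_pres \<Rightarrow>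
   ('a, ('v tree \<Rightarrow> 'a) set set) operad_struct" where
  "presented_operad K P =
     (let T = free_operad K (gens P) in quot_operad T (generated_ideal K T 3 (rels P)))"

subsection \<open>The bisuccessor\<close>

text \<open>The basis of the two-dimensional space spanned by the symbols \<open>\<prec>\<close> and \<open>\<succ>\<close>.\<close>

datatype dir = Prec | Succ

definition dir_module :: "('a, 'k) ring_scheme \<Rightarrow> ('a, dir \<Rightarrow> 'a) module" where
  "dir_module K = free_module K UNIV"

definition bsu_module ::
  "('a, 'k) ring_scheme \<Rightarrow> ('a, 'v) module \<Rightarrow> ('a, ('v \<times> (dir \<Rightarrow> 'a) \<Rightarrow> 'a) set) module" where
  "bsu_module K V = tensor_module K V (dir_module K)"

definition lab ::
  "('a, 'k) ring_scheme \<Rightarrow> ('a, 'v) module \<Rightarrow> dir \<Rightarrow> 'v \<Rightarrow> ('v \<times> (dir \<Rightarrow> 'a) \<Rightarrow> 'a) set" where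
  "lab K V d \<omega> = pure_tensor K V (dir_module K) \<omega> (basis_vec K d)"

definition lab_star ::
  "('a, 'k) ring_scheme \<Rightarrow> ('a, 'v) module \<Rightarrow> 'v \<Rightarrow> ('v \<times> (dir \<Rightarrow> 'a) \<Rightarrow> 'a) set" where
  "lab_star K V \<omega> = lab K V Prec \<omega> \<oplus>\<^bsub>bsu_module K V\<^esub> lab K V Succ \<omega>"

fun bsu_tree ::
  "('a, 'k) ring_scheme \<Rightarrow> ('a, 'v) module \<Rightarrow> nat \<Rightarrow> 'v tree \<Rightarrow>
   ('v \<times> (dir \<Rightarrow> 'a) \<Rightarrow> 'a) set tree" where
  "bsu_tree K V x \<langle>\<rangle> = \<langle>\<rangle>"
| "bsu_tree K V x \<langle>l, \<omega>, r\<rangle> =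
     (if x \<le> size1 l
      then \<langle>bsu_tree K V x l, lab K V Prec \<omega>, map_tree (lab_star K V) r\<rangle>
      else \<langle>map_tree (lab_star K V) l, lab K V Succ \<omega>, bsu_tree K V (x - size1 l) r\<rangle>)"

definition bsu_map ::
  "('a, 'k) ring_scheme \<Rightarrow> ('a, 'v) module \<Rightarrow> nat \<Rightarrow> nat \<Rightarrow> ('v tree \<Rightarrow> 'a) set \<Rightarrow>
   (('v \<times> (dir \<Rightarrow> 'a) \<Rightarrow> 'a) set tree \<Rightarrow> 'a) set" where
  "bsu_map K V n x =
     quot_lift K (arity (free_operad K (bsu_module K V)) n)
       (\<lambda>\<tau>. tree_elem K (bsu_module K V) (bsu_tree K V x \<tau>))"

definition BSu ::
  "('a, 'k) ring_scheme \<Rightarrow> ('a, 'v) quad_pres \<Rightarrow>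
   ('a, ('v \<times> (dir \<Rightarrow> 'a) \<Rightarrow> 'a) set) quad_pres" where
  "BSu K P =
     \<lparr> gens = bsu_module K (gens P),
       rels = {bsu_map K (gens P) 3 x r | r x. r \<in> rels P \<and> x \<in> {1, 2, 3}} \<rparr>"

subsection \<open>The operad of dendriform algebras\<close>

definition Dend :: "('a, 'k) ring_scheme \<Rightarrow> ('a, dir \<Rightarrow> 'a) quad_pres" where
  "Dend K =
     (let D = dir_module K; T = arity (free_operad K D) 3;
          c1 = (\<lambda>a b. tree_elem K D (circ1_tree (basis_vec K a) (basis_vec K b)));
          c2 = (\<lambda>a b. tree_elem K D (circ2_tree (basis_vec K a) (basis_vec K b)))
      in \<lparr> gens = D,
           rels = linear_span K T
             {c1 Prec Prec \<ominus>\<^bsub>T\<^esub> (c2 Prec Prec \<oplus>\<^bsub>T\<^esub> c2 Prec Succ),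
              c1 Prec Succ \<ominus>\<^bsub>T\<^esub> c2 Succ Prec,
              (c1 Succ Prec \<oplus>\<^bsub>T\<^esub> c1 Succ Succ) \<ominus>\<^bsub>T\<^esub> c2 Succ Succ} \<rparr>)"

subsection \<open>The black square product\<close>

fun psi_tree ::
  "('a, 'k) ring_scheme \<Rightarrow> ('a, 'v) module \<Rightarrow> ('a, 'w) module \<Rightarrow> 'v tree \<Rightarrow> 'w tree \<Rightarrow>
   (('v \<times> 'w \<Rightarrow> 'a) set tree \<Rightarrow> 'a) set" where
  "psi_tree K V W \<langle>\<langle>\<langle>\<rangle>, \<nu>, \<langle>\<rangle>\<rangle>, \<omega>, \<langle>\<rangle>\<rangle> \<langle>\<langle>\<langle>\<rangle>, \<nu>', \<langle>\<rangle>\<rangle>, \<omega>', \<langle>\<rangle>\<rangle> =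
     tree_elem K (tensor_module K V W)
       (circ1_tree (pure_tensor K V W \<omega> \<omega>') (pure_tensor K V W \<nu> \<nu>'))"
| "psi_tree K V W \<langle>\<langle>\<rangle>, \<omega>, \<langle>\<langle>\<rangle>, \<nu>, \<langle>\<rangle>\<rangle>\<rangle> \<langle>\<langle>\<rangle>, \<omega>', \<langle>\<langle>\<rangle>, \<nu>', \<langle>\<rangle>\<rangle>\<rangle> =
     \<ominus>\<^bsub>arity (free_operad K (tensor_module K V W)) 3\<^esub>
       tree_elem K (tensor_module K V W)
         (circ2_tree (pure_tensor K V W \<omega> \<omega>') (pure_tensor K V W \<nu> \<nu>'))"
| "psi_tree K V W _ _ = \<zero>\<^bsub>arity (free_operad K (tensor_module K V W)) 3\<^esub>"

text \<open>The linear map on the tensor product of the arity 3 components; \<open>psi_tree\<close> gives its values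
  on tensor products of labelled trees.\<close>

definition Psi ::
  "('a, 'k) ring_scheme \<Rightarrow> ('a, 'v) module \<Rightarrow> ('a, 'w) module \<Rightarrow>
   (('v tree \<Rightarrow> 'a) set \<times> ('w tree \<Rightarrow> 'a) set \<Rightarrow> 'a) set \<Rightarrow>
   (('v \<times> 'w \<Rightarrow> 'a) set tree \<Rightarrow> 'a) set" where
  "Psi K V W =
     (let T = arity (free_operad K (tensor_module K V W)) 3
      in quot_lift K T (\<lambda>(a, b). quot_lift K T (\<lambda>\<sigma>. quot_lift K T (psi_tree K V W \<sigma>) b) a))"

definition tensor_subspace ::
  "('a, 'k) ring_scheme \<Rightarrow> ('a, 'v) module \<Rightarrow> ('a, 'w) module \<Rightarrow> 'v set \<Rightarrow> 'w set \<Rightarrow>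
   ('v \<times> 'w \<Rightarrow> 'a) set set" where
  "tensor_subspace K M N R S =
     linear_span K (tensor_module K M N) {pure_tensor K M N r s | r s. r \<in> R \<and> s \<in> S}"

definition black_square ::
  "('a, 'k) ring_scheme \<Rightarrow> ('a, 'v) quad_pres \<Rightarrow> ('a, 'w) quad_pres \<Rightarrow>
   ('a, ('v \<times> 'w \<Rightarrow> 'a) set) quad_pres" where
  "black_square K P Q =
     \<lparr> gens = tensor_module K (gens P) (gens Q),
       rels = Psi K (gens P) (gens Q) `
         tensor_subspace K
           (arity (free_operad K (gens P)) 3) (arity (free_operad K (gens Q)) 3)
           (rels P) (rels Q) \<rparr>"

end

theory Submission
  imports Defs
begin

text \<open>Swapping the two tensor factors identifies the generators of the bisuccessor with those of the
  black square product, and hence the two free operads. The three dendriform relators are indexed by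
  the leaves of a tree with three leaves: up to the sign of the right comb, which cancels the sign
  in \<open>\<Psi>\<close>, the \<open>x\<close>-th relator labels each of the two trees by the directions of the path from the
  root to the leaf \<open>x\<close>, and a vertex off that path by \<open>\<prec> + \<succ>\<close>. Therefore \<open>\<Psi>\<close> sends the tensor of
  the \<open>x\<close>-th relator with \<open>r\<close> to the image of \<open>BSu\<^sub>x(r)\<close>, and the relators on both sides generate
  the same ideal.\<close>

section \<open>Linear maps, submodules and quotients\<close>

text \<open>The two sets of relators cannot be matched one to one. Those of \<open>BSu K P\<close>
  form a union of three subspaces, one for each leaf, whereas those of the product are the image
  under \<open>Psi\<close> of an entire span of pure tensors. The images therefore agree only up to
  linear span. This suffices because every component of an operadic ideal is a submodule, so an
  ideal containing a set contains its span.

  What shapes the development is that every space is a quotient of a free module on a huge set, all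
  pairs of vectors or all labelled trees, with no chosen basis of the generators. Maps out of such
  quotients are given by \<open>quot_lift\<close>, which goes through \<open>the_elem\<close> and
  has a usable value only once the linear extension is shown to kill the relators. Hence each
  construction yields two facts, linearity and the value on generating classes, and each identity is
  proved by comparing two linear maps on generating classes. The isomorphisms act on cosets by
  direct image, which avoids choosing representatives, both when labelled trees are made multilinear
  and when the relators are divided out.\<close>

lemma linear_mapI:
  assumes "\<And>x. x \<in> carrier M \<Longrightarrow> f x \<in> carrier N"
    and "\<And>x y. x \<in> carrier M \<Longrightarrow> y \<in> carrier M \<Longrightarrow> f (x \<oplus>\<^bsub>M\<^esub> y) = f x \<oplus>\<^bsub>N\<^esub> f y"
    and "\<And>c x. c \<in> carrier K \<Longrightarrow> x \<in> carrier M \<Longrightarrow> f (c \<odot>\<^bsub>M\<^esub> x) = c \<odot>\<^bsub>N\<^esub> f x"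
  shows "linear_map K M N f"
  using assms by (auto simp: linear_map_def)

lemma linear_map_id: "linear_map K M M (\<lambda>x. x)"
  by (simp add: linear_map_def)

lemma linear_map_closed: "linear_map K M N f \<Longrightarrow> x \<in> carrier M \<Longrightarrow> f x \<in> carrier N"
  and linear_map_add: "linear_map K M N f \<Longrightarrow> x \<in> carrier M \<Longrightarrow> y \<in> carrier M \<Longrightarrow>
    f (x \<oplus>\<^bsub>M\<^esub> y) = f x \<oplus>\<^bsub>N\<^esub> f y"
  and linear_map_smult: "linear_map K M N f \<Longrightarrow> c \<in> carrier K \<Longrightarrow> x \<in> carrier M \<Longrightarrow>
    f (c \<odot>\<^bsub>M\<^esub> x) = c \<odot>\<^bsub>N\<^esub> f x"
  by (auto simp: linear_map_def)

text \<open>\<open>linear_map\<close> constrains values on the carrier only, and a map defined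
  through cosets agrees with its convenient formula only there. Linearity of most lifted maps is
  transferred in this way.\<close>

lemma linear_map_cong:
  assumes "linear_map K M N f" and "\<And>x. x \<in> carrier M \<Longrightarrow> f x = g x" and "module K M"
  shows "linear_map K M N g"
proof -
  interpret M: module K M by fact
  show ?thesis using assms(1,2) by (auto simp: linear_map_def Pi_iff)
qed

lemma linear_map_compose:
  assumes "linear_map K M N f" and "linear_map K N L g"
  shows "linear_map K M L (\<lambda>x. g (f x))"
  using assms by (auto simp: linear_map_def Pi_iff)

lemma linear_map_const_zero:
  assumes "module K N"
  shows "linear_map K M N (\<lambda>x. \<zero>\<^bsub>N\<^esub>)"
proof -
  interpret N: module K N by fact
  show ?thesis by (auto simp: linear_map_def)
qed

lemma linear_map_plus:
  assumes "module K N" and "linear_map K M N f" and "linear_map K M N g"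
  shows "linear_map K M N (\<lambda>x. f x \<oplus>\<^bsub>N\<^esub> g x)"
proof -
  interpret N: module K N by fact
  note [simp] = linear_map_closed[OF assms(2)] linear_map_closed[OF assms(3)]
    linear_map_add[OF assms(2)] linear_map_add[OF assms(3)]
    linear_map_smult[OF assms(2)] linear_map_smult[OF assms(3)]
  show ?thesis by (rule linear_mapI) (auto simp: N.a_ac N.smult_r_distr)
qed

lemma linear_map_scale:
  assumes "module K N" and "linear_map K M N f" and "c \<in> carrier K"
  shows "linear_map K M N (\<lambda>x. c \<odot>\<^bsub>N\<^esub> f x)"
proof -
  interpret N: module K N by fact
  note [simp] = linear_map_closed[OF assms(2)] linear_map_add[OF assms(2)]
    linear_map_smult[OF assms(2)]
  show ?thesis
    by (rule linear_mapI)
      (auto simp: N.smult_r_distr assms(3) N.smult_assoc1[symmetric] N.R.m_comm)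
qed

lemma linear_map_minus_fun:
  assumes "module K N" and "linear_map K M N f"
  shows "linear_map K M N (\<lambda>x. \<ominus>\<^bsub>N\<^esub> f x)"
proof -
  interpret N: module K N by fact
  note [simp] = linear_map_closed[OF assms(2)] linear_map_add[OF assms(2)] linear_map_smult[OF assms(2)]
  show ?thesis
    by (rule linear_mapI) (auto simp: N.minus_add N.smult_r_minus)
qed

lemma linear_map_zero:
  assumes "module K M" and "module K N" and "linear_map K M N f"
  shows "f \<zero>\<^bsub>M\<^esub> = \<zero>\<^bsub>N\<^esub>"
proof -
  interpret M: module K M by fact
  interpret N: module K N by fact
  have "f (\<zero>\<^bsub>K\<^esub> \<odot>\<^bsub>M\<^esub> \<zero>\<^bsub>M\<^esub>) = \<zero>\<^bsub>K\<^esub> \<odot>\<^bsub>N\<^esub> f \<zero>\<^bsub>M\<^esub>"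
    by (rule linear_map_smult[OF assms(3)]) auto
  then show ?thesis using linear_map_closed[OF assms(3)] by simp
qed

lemma linear_map_uminus:
  assumes "module K M" and "module K N" and "linear_map K M N f" and "x \<in> carrier M"
  shows "f (\<ominus>\<^bsub>M\<^esub> x) = \<ominus>\<^bsub>N\<^esub> f x"
proof -
  interpret M: module K M by fact
  interpret N: module K N by fact
  have "f (\<ominus>\<^bsub>M\<^esub> x) \<oplus>\<^bsub>N\<^esub> f x = f (\<ominus>\<^bsub>M\<^esub> x \<oplus>\<^bsub>M\<^esub> x)"
    using assms(4) by (simp add: linear_map_add[OF assms(3)])
  also have "\<dots> = \<zero>\<^bsub>N\<^esub>"
    using assms(4) by (simp add: M.l_neg linear_map_zero[OF assms(1-3)])
  finally show ?thesis
    using linear_map_closed[OF assms(3)] assms(4) by (simp add: N.minus_equality)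
qed

lemma linear_map_diff:
  assumes "module K M" and "module K N" and "linear_map K M N f"
    and "x \<in> carrier M" and "y \<in> carrier M"
  shows "f (x \<ominus>\<^bsub>M\<^esub> y) = f x \<ominus>\<^bsub>N\<^esub> f y"
proof -
  interpret M: module K M by fact
  show ?thesis
    using assms by (simp add: a_minus_def linear_map_add[OF assms(3)] linear_map_uminus)
qed

section \<open>Submodules, spans, and the sets where linear maps agree\<close>

lemma submodule_subset: "submodule N K M \<Longrightarrow> N \<subseteq> carrier M"
  using submodule.axioms(1) subgroup.subset by fastforce

lemma submodule_zero: "submodule N K M \<Longrightarrow> \<zero>\<^bsub>M\<^esub> \<in> N"
  using submodule.axioms(1) subgroup.one_closed by fastforce

lemma submodule_add: "submodule N K M \<Longrightarrow> x \<in> N \<Longrightarrow> y \<in> N \<Longrightarrow> x \<oplus>\<^bsub>M\<^esub> y \<in> N"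
  using submodule.axioms(1) subgroup.m_closed by fastforce

lemma submodule_smult: "submodule N K M \<Longrightarrow> c \<in> carrier K \<Longrightarrow> x \<in> N \<Longrightarrow> c \<odot>\<^bsub>M\<^esub> x \<in> N"
  by (rule submodule.smult_closed)

lemma submodule_uminus: "submodule N K M \<Longrightarrow> x \<in> N \<Longrightarrow> \<ominus>\<^bsub>M\<^esub> x \<in> N"
  unfolding a_inv_def using submodule.axioms(1) subgroup.m_inv_closed by fastforce

text \<open>Closure under additive inverses comes for free, the inverse of a vector being its
  multiple by minus one.\<close>

lemma submoduleI':
  assumes "module K M" and "N \<subseteq> carrier M" and "\<zero>\<^bsub>M\<^esub> \<in> N"
    and "\<And>x y. x \<in> N \<Longrightarrow> y \<in> N \<Longrightarrow> x \<oplus>\<^bsub>M\<^esub> y \<in> N"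
    and "\<And>c x. c \<in> carrier K \<Longrightarrow> x \<in> N \<Longrightarrow> c \<odot>\<^bsub>M\<^esub> x \<in> N"
  shows "submodule N K M"
proof -
  interpret M: module K M by fact
  show ?thesis
  proof (rule M.submoduleI)
    fix a assume a: "a \<in> N"
    then have "\<ominus>\<^bsub>M\<^esub> a = (\<ominus>\<^bsub>K\<^esub> \<one>\<^bsub>K\<^esub>) \<odot>\<^bsub>M\<^esub> a"
      using assms(2) by (auto simp: M.smult_l_minus)
    then show "\<ominus>\<^bsub>M\<^esub> a \<in> N" using a assms(5) by simp
  qed (use assms in auto)
qed

lemma submodule_preimage:
  assumes "module K M" and "module K N" and "linear_map K M N f" and "submodule S K N"
  shows "submodule {x \<in> carrier M. f x \<in> S} K M"
proof -
  interpret M: module K M by fact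
  show ?thesis
    by (rule submoduleI')
      (auto simp: submodule_zero[OF assms(4)] submodule_add[OF assms(4)]
        submodule_smult[OF assms(4)] linear_map_zero[OF assms(1-3)] linear_map_add[OF assms(3)]
        linear_map_smult[OF assms(3)] intro: M.module_axioms)
qed

lemma submodule_image:
  assumes "module K M" and "module K N" and "linear_map K M N f" and "submodule S K M"
  shows "submodule (f ` S) K N"
proof (rule submoduleI')
  note S = subsetD[OF submodule_subset[OF assms(4)]]
  show "f ` S \<subseteq> carrier N" using S linear_map_closed[OF assms(3)] by blast
  show "\<zero>\<^bsub>N\<^esub> \<in> f ` S"
    by (metis imageI assms submodule_zero linear_map_zero)
  show "x \<oplus>\<^bsub>N\<^esub> y \<in> f ` S" if "x \<in> f ` S" "y \<in> f ` S" for x y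
    using that S by (auto simp: linear_map_add[OF assms(3), symmetric] submodule_add[OF assms(4)])
  show "c \<odot>\<^bsub>N\<^esub> x \<in> f ` S" if "c \<in> carrier K" "x \<in> f ` S" for c x
    using that S
    by (auto simp: linear_map_smult[OF assms(3), symmetric] submodule_smult[OF assms(4)])
qed fact

text \<open>The source of every uniqueness argument below: since the set of agreement is a
  submodule, agreement on generators spreads to everything they span.\<close>

lemma submodule_equalizer:
  assumes "module K M" and "module K N" and "linear_map K M N f" and "linear_map K M N g"
  shows "submodule {x \<in> carrier M. f x = g x} K M"
proof -
  interpret M: module K M by fact
  show ?thesis
    by (rule submoduleI')
      (auto intro: M.module_axioms simp: linear_map_zero[OF assms(1,2,3)] linear_map_zero[OF assms(1,2,4)]
        linear_map_add[OF assms(3)] linear_map_smult[OF assms(3)]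
        linear_map_add[OF assms(4)] linear_map_smult[OF assms(4)])
qed

text \<open>The family must be nonempty because the intersection of no sets is \<open>UNIV\<close>,
  which need not lie in the carrier.\<close>

lemma submodule_Inter:
  assumes "module K M" and "\<N> \<noteq> {}" and "\<And>N. N \<in> \<N> \<Longrightarrow> submodule N K M"
  shows "submodule (\<Inter>\<N>) K M"
  using assms
  by (intro submoduleI')
    (auto intro: submodule_zero submodule_add submodule_smult dest: submodule_subset)

lemma linear_span_submodule:
  assumes "module K M" and "S \<subseteq> carrier M"
  shows "submodule (linear_span K M S) K M"
  unfolding linear_span_def
  using assms module.carrier_is_submodule[OF assms(1)] by (intro submodule_Inter) auto

lemma linear_span_superset: "S \<subseteq> linear_span K M S"
  by (auto simp: linear_span_def)

lemma linear_span_minimal: "submodule N K M \<Longrightarrow> S \<subseteq> N \<Longrightarrow> linear_span K M S \<subseteq> N"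
  by (auto simp: linear_span_def)

section \<open>Cosets and quotient modules\<close>

lemma submodule_coset_mem:
  "x \<in> N +>\<^bsub>M\<^esub> y \<longleftrightarrow> (\<exists>n\<in>N. x = n \<oplus>\<^bsub>M\<^esub> y)"
  by (auto simp: a_r_coset_def')

lemma submodule_coset_eq:
  assumes "module K M" and "submodule N K M" and "x \<in> carrier M" and "y \<in> carrier M"
  shows "N +>\<^bsub>M\<^esub> x = N +>\<^bsub>M\<^esub> y \<longleftrightarrow> x \<ominus>\<^bsub>M\<^esub> y \<in> N"
proof -
  interpret M: module K M by fact
  note N = subsetD[OF submodule_subset[OF assms(2)]]
  show ?thesis
  proof
    assume *: "N +>\<^bsub>M\<^esub> x = N +>\<^bsub>M\<^esub> y"
    have "x \<in> N +>\<^bsub>M\<^esub> x"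
      using submodule_zero[OF assms(2)] assms(3) by (force simp: submodule_coset_mem)
    then obtain n where "n \<in> N" "x = n \<oplus>\<^bsub>M\<^esub> y" by (auto simp: * submodule_coset_mem)
    then show "x \<ominus>\<^bsub>M\<^esub> y \<in> N"
      using assms(3,4) N by (simp add: M.minus_eq M.a_assoc M.r_neg)
  next
    assume d: "x \<ominus>\<^bsub>M\<^esub> y \<in> N"
    have x: "x = (x \<ominus>\<^bsub>M\<^esub> y) \<oplus>\<^bsub>M\<^esub> y"
      using assms(3,4) by (simp add: M.minus_eq M.a_assoc M.l_neg)
    have y: "y = \<ominus>\<^bsub>M\<^esub> (x \<ominus>\<^bsub>M\<^esub> y) \<oplus>\<^bsub>M\<^esub> x"
      using assms(3,4) by (simp add: M.minus_eq M.minus_add M.a_assoc M.a_comm[of _ y] M.l_neg)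
    show "N +>\<^bsub>M\<^esub> x = N +>\<^bsub>M\<^esub> y"
    proof (intro equalityI subsetI)
      fix z assume "z \<in> N +>\<^bsub>M\<^esub> x"
      then obtain n where n: "n \<in> N" "z = n \<oplus>\<^bsub>M\<^esub> x" by (auto simp: submodule_coset_mem)
      then have "z = (n \<oplus>\<^bsub>M\<^esub> (x \<ominus>\<^bsub>M\<^esub> y)) \<oplus>\<^bsub>M\<^esub> y"
        using N[OF n(1)] N[OF d] assms(3,4) x by (metis M.a_assoc)
      then show "z \<in> N +>\<^bsub>M\<^esub> y"
        using submodule_add[OF assms(2) n(1) d] by (auto simp: submodule_coset_mem)
    next
      fix z assume "z \<in> N +>\<^bsub>M\<^esub> y"
      then obtain n where n: "n \<in> N" "z = n \<oplus>\<^bsub>M\<^esub> y" by (auto simp: submodule_coset_mem)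
      have d': "\<ominus>\<^bsub>M\<^esub> (x \<ominus>\<^bsub>M\<^esub> y) \<in> N" using submodule_uminus[OF assms(2) d] .
      have "z = (n \<oplus>\<^bsub>M\<^esub> \<ominus>\<^bsub>M\<^esub> (x \<ominus>\<^bsub>M\<^esub> y)) \<oplus>\<^bsub>M\<^esub> x"
        using n N[OF n(1)] N[OF d'] assms(3,4) y by (metis M.a_assoc)
      then show "z \<in> N +>\<^bsub>M\<^esub> x"
        using submodule_add[OF assms(2) n(1) d'] by (auto simp: submodule_coset_mem)
    qed
  qed
qed

lemma submodule_coset_self:
  assumes "module K M" and "submodule N K M" and "x \<in> carrier M"
  shows "x \<in> N +>\<^bsub>M\<^esub> x"
proof -
  interpret M: module K M by fact
  show ?thesis
    using submodule_zero[OF assms(2)] assms(3) by (force simp: submodule_coset_mem)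
qed

lemma submodule_coset_subset:
  assumes "module K M" and "submodule N K M" and "x \<in> carrier M"
  shows "N +>\<^bsub>M\<^esub> x \<subseteq> carrier M"
proof -
  interpret M: module K M by fact
  show ?thesis
    using subsetD[OF submodule_subset[OF assms(2)]] assms(3) by (auto simp: submodule_coset_mem)
qed

lemma submodule_coset_memD:
  assumes "module K M" and "submodule N K M" and "x \<in> carrier M" and "y \<in> N +>\<^bsub>M\<^esub> x"
  shows "y \<in> carrier M" and "N +>\<^bsub>M\<^esub> y = N +>\<^bsub>M\<^esub> x"
proof -
  interpret M: module K M by fact
  show y: "y \<in> carrier M" using submodule_coset_subset[OF assms(1-3)] assms(4) by blast
  obtain n where n: "n \<in> N" "y = n \<oplus>\<^bsub>M\<^esub> x" using assms(4) by (auto simp: submodule_coset_mem)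
  have "n \<in> carrier M" using n submodule_subset[OF assms(2)] by auto
  then have "y \<ominus>\<^bsub>M\<^esub> x = n"
    using n assms(3) by (simp add: M.minus_eq M.a_assoc M.r_neg)
  then show "N +>\<^bsub>M\<^esub> y = N +>\<^bsub>M\<^esub> x"
    using submodule_coset_eq[OF assms(1,2) y assms(3)] n by simp
qed

lemma quot_carrier: "carrier (quot_module M N) = (\<lambda>x. N +>\<^bsub>M\<^esub> x) ` carrier M"
  by (auto simp: quot_module_def A_RCOSETS_def' a_r_coset_def')

lemma quot_zero: "\<zero>\<^bsub>quot_module M N\<^esub> = N"
  by (simp add: quot_module_def)

lemma quot_add:
  assumes "module K M" and "submodule N K M" and "x \<in> carrier M" and "y \<in> carrier M"
  shows "(N +>\<^bsub>M\<^esub> x) \<oplus>\<^bsub>quot_module M N\<^esub> (N +>\<^bsub>M\<^esub> y) = N +>\<^bsub>M\<^esub> (x \<oplus>\<^bsub>M\<^esub> y)"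
proof -
  interpret M: module K M by fact
  note N = subsetD[OF submodule_subset[OF assms(2)]]
  have "(N +>\<^bsub>M\<^esub> x) <+>\<^bsub>M\<^esub> (N +>\<^bsub>M\<^esub> y) = N +>\<^bsub>M\<^esub> (x \<oplus>\<^bsub>M\<^esub> y)"
  proof (intro equalityI subsetI)
    fix z assume "z \<in> (N +>\<^bsub>M\<^esub> x) <+>\<^bsub>M\<^esub> (N +>\<^bsub>M\<^esub> y)"
    then obtain n n' where n: "n \<in> N" "n' \<in> N" "z = (n \<oplus>\<^bsub>M\<^esub> x) \<oplus>\<^bsub>M\<^esub> (n' \<oplus>\<^bsub>M\<^esub> y)"
      by (auto simp: set_add_def' submodule_coset_mem)
    then have "z = (n \<oplus>\<^bsub>M\<^esub> n') \<oplus>\<^bsub>M\<^esub> (x \<oplus>\<^bsub>M\<^esub> y)"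
      using N assms(3,4) by (simp add: M.a_ac)
    then show "z \<in> N +>\<^bsub>M\<^esub> (x \<oplus>\<^bsub>M\<^esub> y)"
      using submodule_add[OF assms(2) n(1,2)] by (auto simp: submodule_coset_mem)
  next
    fix z assume "z \<in> N +>\<^bsub>M\<^esub> (x \<oplus>\<^bsub>M\<^esub> y)"
    then obtain n where n: "n \<in> N" "z = n \<oplus>\<^bsub>M\<^esub> (x \<oplus>\<^bsub>M\<^esub> y)"
      by (auto simp: submodule_coset_mem)
    then have "z = (n \<oplus>\<^bsub>M\<^esub> x) \<oplus>\<^bsub>M\<^esub> (\<zero>\<^bsub>M\<^esub> \<oplus>\<^bsub>M\<^esub> y)"
      using N assms(3,4) by (simp add: M.a_ac)
    moreover have "n \<oplus>\<^bsub>M\<^esub> x \<in> N +>\<^bsub>M\<^esub> x" and "\<zero>\<^bsub>M\<^esub> \<oplus>\<^bsub>M\<^esub> y \<in> N +>\<^bsub>M\<^esub> y"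
      using n(1) submodule_zero[OF assms(2)] by (auto simp only: submodule_coset_mem)
    ultimately show "z \<in> (N +>\<^bsub>M\<^esub> x) <+>\<^bsub>M\<^esub> (N +>\<^bsub>M\<^esub> y)"
      by (auto simp: set_add_def')
  qed
  then show ?thesis by (simp add: quot_module_def)
qed

text \<open>The scalar action on a coset is a union over all its representatives. Two
  representatives differ by an element of \<open>N\<close>, and so do their multiples, so all
  members of the union are the same coset and the union collapses.\<close>

lemma quot_smult:
  assumes "module K M" and "submodule N K M" and "c \<in> carrier K" and "x \<in> carrier M"
  shows "c \<odot>\<^bsub>quot_module M N\<^esub> (N +>\<^bsub>M\<^esub> x) = N +>\<^bsub>M\<^esub> (c \<odot>\<^bsub>M\<^esub> x)"
proof -
  interpret M: module K M by fact
  have "N +>\<^bsub>M\<^esub> (c \<odot>\<^bsub>M\<^esub> a) = N +>\<^bsub>M\<^esub> (c \<odot>\<^bsub>M\<^esub> x)" if "a \<in> N +>\<^bsub>M\<^esub> x" for a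
  proof -
    note a = submodule_coset_memD[OF assms(1,2,4) that]
    have "a \<ominus>\<^bsub>M\<^esub> x \<in> N" using a submodule_coset_eq[OF assms(1,2) a(1) assms(4)] by simp
    then have "c \<odot>\<^bsub>M\<^esub> (a \<ominus>\<^bsub>M\<^esub> x) \<in> N" using submodule_smult[OF assms(2,3)] by blast
    also have "c \<odot>\<^bsub>M\<^esub> (a \<ominus>\<^bsub>M\<^esub> x) = c \<odot>\<^bsub>M\<^esub> a \<ominus>\<^bsub>M\<^esub> c \<odot>\<^bsub>M\<^esub> x"
      using a(1) assms(3,4) by (simp add: M.minus_eq M.smult_r_distr M.smult_r_minus)
    finally show ?thesis using submodule_coset_eq[OF assms(1,2)] a(1) assms(3,4) by simp
  qed
  then have "(\<Union>a\<in>N +>\<^bsub>M\<^esub> x. N +>\<^bsub>M\<^esub> (c \<odot>\<^bsub>M\<^esub> a)) = N +>\<^bsub>M\<^esub> (c \<odot>\<^bsub>M\<^esub> x)"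
    using submodule_coset_self[OF assms(1,2,4)] by (intro UN_constant_eq ballI)
  then show ?thesis by (simp add: quot_module_def)
qed

text \<open>Shaped after the additive relators of tensor products and of labelled trees: membership
  of such a relator in \<open>N\<close> becomes additivity of the class.\<close>

lemma quot_add_eqI:
  assumes "module K M" and "submodule N K M" and "x \<ominus>\<^bsub>M\<^esub> y \<ominus>\<^bsub>M\<^esub> z \<in> N"
    and "x \<in> carrier M" and "y \<in> carrier M" and "z \<in> carrier M"
  shows "N +>\<^bsub>M\<^esub> x = (N +>\<^bsub>M\<^esub> y) \<oplus>\<^bsub>quot_module M N\<^esub> (N +>\<^bsub>M\<^esub> z)"
proof -
  interpret M: module K M by fact
  have "x \<ominus>\<^bsub>M\<^esub> (y \<oplus>\<^bsub>M\<^esub> z) = x \<ominus>\<^bsub>M\<^esub> y \<ominus>\<^bsub>M\<^esub> z"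
    using assms(4-6) by (simp add: M.minus_eq M.minus_add M.a_assoc)
  then show ?thesis
    using assms(3-6) by (simp add: quot_add[OF assms(1,2)] submodule_coset_eq[OF assms(1,2)])
qed

lemma quot_smult_eqI:
  assumes "module K M" and "submodule N K M" and "x \<ominus>\<^bsub>M\<^esub> c \<odot>\<^bsub>M\<^esub> y \<in> N"
    and "c \<in> carrier K" and "x \<in> carrier M" and "y \<in> carrier M"
  shows "N +>\<^bsub>M\<^esub> x = c \<odot>\<^bsub>quot_module M N\<^esub> (N +>\<^bsub>M\<^esub> y)"
proof -
  interpret M: module K M by fact
  show ?thesis
    using assms(3-6) by (simp add: quot_smult[OF assms(1,2)] submodule_coset_eq[OF assms(1,2)])
qed

lemma quot_module_module:
  assumes "module K M" and "submodule N K M"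
  shows "module K (quot_module M N)"
proof -
  interpret M: module K M by fact
  let ?Q = "quot_module M N"
  note [simp] = quot_add[OF assms] quot_smult[OF assms]
  have N: "N = N +>\<^bsub>M\<^esub> \<zero>\<^bsub>M\<^esub>"
    using submodule_subset[OF assms(2)] by simp
  \<comment> \<open>The axioms are verified on cosets written with an explicit representative. Zero
    is brought into that form too, and the rule \<open>a_coset_add_zero\<close>, which would fold it
    back into \<open>N\<close>, is switched off where it would interfere.\<close>
  have z: "\<zero>\<^bsub>?Q\<^esub> = N +>\<^bsub>M\<^esub> \<zero>\<^bsub>M\<^esub>" using N by (simp add: quot_zero)
  have rep: "\<exists>a\<in>carrier M. X = N +>\<^bsub>M\<^esub> a" if "X \<in> carrier ?Q" for X
    using that by (auto simp: quot_carrier)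
  have cl: "N +>\<^bsub>M\<^esub> a \<in> carrier ?Q" if "a \<in> carrier M" for a
    using that by (auto simp: quot_carrier)
  show ?thesis
  proof (rule moduleI)
    show "abelian_group ?Q"
    proof (rule abelian_groupI)
      fix X assume "X \<in> carrier ?Q"
      then obtain a where a: "a \<in> carrier M" "X = N +>\<^bsub>M\<^esub> a" using rep by blast
      show "\<zero>\<^bsub>?Q\<^esub> \<oplus>\<^bsub>?Q\<^esub> X = X" using a by (simp add: z del: M.a_coset_add_zero)
      have "(N +>\<^bsub>M\<^esub> (\<ominus>\<^bsub>M\<^esub> a)) \<oplus>\<^bsub>?Q\<^esub> X = \<zero>\<^bsub>?Q\<^esub>"
        using a by (simp add: z M.l_neg del: M.a_coset_add_zero)
      then show "\<exists>Y\<in>carrier ?Q. Y \<oplus>\<^bsub>?Q\<^esub> X = \<zero>\<^bsub>?Q\<^esub>"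
        using cl[of "\<ominus>\<^bsub>M\<^esub> a"] a by blast
      fix Y assume "Y \<in> carrier ?Q"
      then obtain b where b: "b \<in> carrier M" "Y = N +>\<^bsub>M\<^esub> b" using rep by blast
      show "X \<oplus>\<^bsub>?Q\<^esub> Y \<in> carrier ?Q" using a b by (simp add: cl)
      show "X \<oplus>\<^bsub>?Q\<^esub> Y = Y \<oplus>\<^bsub>?Q\<^esub> X" using a b by (simp add: M.a_comm)
      fix Z assume "Z \<in> carrier ?Q"
      then obtain c where "c \<in> carrier M" "Z = N +>\<^bsub>M\<^esub> c" using rep by blast
      then show "X \<oplus>\<^bsub>?Q\<^esub> Y \<oplus>\<^bsub>?Q\<^esub> Z = X \<oplus>\<^bsub>?Q\<^esub> (Y \<oplus>\<^bsub>?Q\<^esub> Z)"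
        using a b by (simp add: M.a_assoc)
    qed (simp add: z cl del: M.a_coset_add_zero)
  next
    fix c d X assume cd: "c \<in> carrier K" "d \<in> carrier K" and "X \<in> carrier ?Q"
    then obtain a where a: "a \<in> carrier M" "X = N +>\<^bsub>M\<^esub> a" using rep by blast
    show "(c \<oplus>\<^bsub>K\<^esub> d) \<odot>\<^bsub>?Q\<^esub> X = c \<odot>\<^bsub>?Q\<^esub> X \<oplus>\<^bsub>?Q\<^esub> d \<odot>\<^bsub>?Q\<^esub> X"
      using a cd by (simp add: M.smult_l_distr)
    show "(c \<otimes>\<^bsub>K\<^esub> d) \<odot>\<^bsub>?Q\<^esub> X = c \<odot>\<^bsub>?Q\<^esub> (d \<odot>\<^bsub>?Q\<^esub> X)"
      using a cd by (simp add: M.smult_assoc1)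
  next
    fix c X Y assume c: "c \<in> carrier K" and "X \<in> carrier ?Q" "Y \<in> carrier ?Q"
    then obtain a b where "a \<in> carrier M" "X = N +>\<^bsub>M\<^esub> a" "b \<in> carrier M" "Y = N +>\<^bsub>M\<^esub> b"
      using rep by meson
    then show "c \<odot>\<^bsub>?Q\<^esub> (X \<oplus>\<^bsub>?Q\<^esub> Y) = c \<odot>\<^bsub>?Q\<^esub> X \<oplus>\<^bsub>?Q\<^esub> c \<odot>\<^bsub>?Q\<^esub> Y"
      using c by (simp add: M.smult_r_distr)
  next
    fix c X assume c: "c \<in> carrier K" and "X \<in> carrier ?Q"
    then obtain a where "a \<in> carrier M" "X = N +>\<^bsub>M\<^esub> a" using rep by blast
    then show "c \<odot>\<^bsub>?Q\<^esub> X \<in> carrier ?Q" using c by (simp add: cl)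
  next
    fix X assume "X \<in> carrier ?Q"
    then obtain a where "a \<in> carrier M" "X = N +>\<^bsub>M\<^esub> a" using rep by blast
    then show "\<one>\<^bsub>K\<^esub> \<odot>\<^bsub>?Q\<^esub> X = X" by simp
  qed (rule M.R.is_cring)
qed

lemma quot_proj_linear:
  assumes "module K M" and "submodule N K M"
  shows "linear_map K M (quot_module M N) (\<lambda>x. N +>\<^bsub>M\<^esub> x)"
proof -
  interpret M: module K M by fact
  show ?thesis
  proof (rule linear_mapI)
    show "N +>\<^bsub>M\<^esub> x \<in> carrier (quot_module M N)" if "x \<in> carrier M" for x
      unfolding quot_carrier using that by (rule imageI)
  qed (rule quot_add[OF assms, symmetric] quot_smult[OF assms, symmetric]; assumption)+
qed

lemma quot_carrierI: "x \<in> carrier M \<Longrightarrow> N +>\<^bsub>M\<^esub> x \<in> carrier (quot_module M N)"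
  by (simp add: quot_carrier)

lemma quot_carrierE:
  assumes "C \<in> carrier (quot_module M N)"
  obtains x where "x \<in> carrier M" and "C = N +>\<^bsub>M\<^esub> x"
  using assms by (auto simp: quot_carrier)

text \<open>Every element of the quotient is the class of some vector, and the operations are
  computed on representatives. Well-definedness is no issue because \<open>f\<close> is already a
  function of cosets.\<close>

lemma quot_linear_mapI:
  assumes "module K M" and "submodule N K M" and "linear_map K M L (\<lambda>x. f (N +>\<^bsub>M\<^esub> x))"
  shows "linear_map K (quot_module M N) L f"
proof (rule linear_mapI)
  note f = linear_map_closed[OF assms(3)] linear_map_add[OF assms(3)] linear_map_smult[OF assms(3)]
  fix x assume "x \<in> carrier (quot_module M N)"
  then obtain a where a: "a \<in> carrier M" "x = N +>\<^bsub>M\<^esub> a" by (auto simp: quot_carrier)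
  show "f x \<in> carrier L" using a f by simp
  show "f (c \<odot>\<^bsub>quot_module M N\<^esub> x) = c \<odot>\<^bsub>L\<^esub> f x" if "c \<in> carrier K" for c
    using a f that by (simp add: quot_smult[OF assms(1,2)])
  fix y assume "y \<in> carrier (quot_module M N)"
  then obtain b where b: "b \<in> carrier M" "y = N +>\<^bsub>M\<^esub> b" by (auto simp: quot_carrier)
  show "f (x \<oplus>\<^bsub>quot_module M N\<^esub> y) = f x \<oplus>\<^bsub>L\<^esub> f y"
    using a b f by (simp add: quot_add[OF assms(1,2)])
qed

section \<open>Free modules\<close>

lemma free_carrier:
  "f \<in> carrier (free_module K X) \<longleftrightarrow>
   (\<forall>x. f x \<in> carrier K) \<and> finite {x. f x \<noteq> \<zero>\<^bsub>K\<^esub>} \<and> {x. f x \<noteq> \<zero>\<^bsub>K\<^esub>} \<subseteq> X"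
  by (auto simp: free_module_def)

lemma free_simps:
  "\<zero>\<^bsub>free_module K X\<^esub> = (\<lambda>_. \<zero>\<^bsub>K\<^esub>)"
  "f \<oplus>\<^bsub>free_module K X\<^esub> g = (\<lambda>x. f x \<oplus>\<^bsub>K\<^esub> g x)"
  "c \<odot>\<^bsub>free_module K X\<^esub> f = (\<lambda>x. c \<otimes>\<^bsub>K\<^esub> f x)"
  by (simp_all add: free_module_def)

lemma free_module_module:
  assumes "cring K"
  shows "module K (free_module K X)"
proof -
  interpret K: cring K by fact
  let ?F = "free_module K X"
  have add: "f \<oplus>\<^bsub>?F\<^esub> g \<in> carrier ?F" if "f \<in> carrier ?F" "g \<in> carrier ?F" for f g
  proof -
    have "{x. f x \<oplus>\<^bsub>K\<^esub> g x \<noteq> \<zero>\<^bsub>K\<^esub>} \<subseteq> {x. f x \<noteq> \<zero>\<^bsub>K\<^esub>} \<union> {x. g x \<noteq> \<zero>\<^bsub>K\<^esub>}" by auto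
    moreover have "finite ({x. f x \<noteq> \<zero>\<^bsub>K\<^esub>} \<union> {x. g x \<noteq> \<zero>\<^bsub>K\<^esub>})"
      using that by (simp add: free_carrier)
    ultimately show ?thesis
      using that by (auto simp: free_carrier free_simps intro: finite_subset)
  qed
  have sm: "c \<odot>\<^bsub>?F\<^esub> f \<in> carrier ?F" if "c \<in> carrier K" "f \<in> carrier ?F" for c f
  proof -
    have "{x. c \<otimes>\<^bsub>K\<^esub> f x \<noteq> \<zero>\<^bsub>K\<^esub>} \<subseteq> {x. f x \<noteq> \<zero>\<^bsub>K\<^esub>}" using that by auto
    then show ?thesis
      using that by (auto simp: free_carrier free_simps intro: finite_subset)
  qed
  show ?thesis
  proof (rule moduleI)
    show "abelian_group ?F"
    proof (rule abelian_groupI)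
      fix f assume f: "f \<in> carrier ?F"
      have "(\<ominus>\<^bsub>K\<^esub> \<one>\<^bsub>K\<^esub>) \<odot>\<^bsub>?F\<^esub> f \<oplus>\<^bsub>?F\<^esub> f = \<zero>\<^bsub>?F\<^esub>"
        using f by (auto simp: free_carrier free_simps K.l_minus K.l_neg)
      then show "\<exists>g\<in>carrier ?F. g \<oplus>\<^bsub>?F\<^esub> f = \<zero>\<^bsub>?F\<^esub>"
        using sm[OF _ f, of "\<ominus>\<^bsub>K\<^esub> \<one>\<^bsub>K\<^esub>"] by auto
    qed (auto simp: add, auto simp: free_carrier free_simps K.a_ac)
  qed (auto simp: assms sm, auto simp: free_carrier free_simps K.l_distr K.r_distr K.m_ac)
qed

lemma basis_vec_closed:
  assumes "cring K" and "x \<in> X"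
  shows "basis_vec K x \<in> carrier (free_module K X)"
proof -
  interpret K: cring K by fact
  have "{y. basis_vec K x y \<noteq> \<zero>\<^bsub>K\<^esub>} \<subseteq> {x}" by (auto simp: basis_vec_def)
  then show ?thesis using assms(2)
    by (auto simp: free_carrier basis_vec_def intro: finite_subset)
qed

text \<open>\<open>lin_ext\<close> sums over the support of its argument, and the supports of
  \<open>f\<close>, \<open>g\<close> and their sum differ. Padding with zero terms gives a common
  index set on which the sums can be compared.\<close>

lemma lin_ext_eq_sum:
  assumes "module K M" and "\<And>x. x \<in> X \<Longrightarrow> \<phi> x \<in> carrier M" and "f \<in> carrier (free_module K X)"
    and "finite A" and "A \<subseteq> X" and "{x. f x \<noteq> \<zero>\<^bsub>K\<^esub>} \<subseteq> A"
  shows "lin_ext K M \<phi> f = (\<Oplus>\<^bsub>M\<^esub>x\<in>A. f x \<odot>\<^bsub>M\<^esub> \<phi> x)"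
proof -
  interpret M: module K M by fact
  show ?thesis unfolding lin_ext_def
    using assms by (intro M.add.finprod_mono_neutral_cong_left) (auto simp: free_carrier)
qed

lemma lin_ext_linear:
  assumes "module K M" and "\<And>x. x \<in> X \<Longrightarrow> \<phi> x \<in> carrier M"
  shows "linear_map K (free_module K X) M (lin_ext K M \<phi>)"
proof -
  interpret M: module K M by fact
  interpret F: module K "free_module K X" by (rule free_module_module) (rule M.R.is_cring)
  let ?F = "free_module K X"
  note sum = lin_ext_eq_sum[OF assms]
  show ?thesis
  proof (rule linear_mapI)
    fix f assume f: "f \<in> carrier ?F"
    let ?A = "{x. f x \<noteq> \<zero>\<^bsub>K\<^esub>}"
    have A: "finite ?A" "?A \<subseteq> X" "\<And>x. f x \<in> carrier K" using f by (auto simp: free_carrier)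
    show "lin_ext K M \<phi> f \<in> carrier M"
      unfolding lin_ext_def using A assms(2) by (intro M.finsum_closed) auto
    show "lin_ext K M \<phi> (c \<odot>\<^bsub>?F\<^esub> f) = c \<odot>\<^bsub>M\<^esub> lin_ext K M \<phi> f" if c: "c \<in> carrier K" for c
    proof -
      have "c \<odot>\<^bsub>?F\<^esub> f \<in> carrier ?F" using c f by (rule F.smult_closed)
      then have "lin_ext K M \<phi> (c \<odot>\<^bsub>?F\<^esub> f) = (\<Oplus>\<^bsub>M\<^esub>x\<in>?A. (c \<otimes>\<^bsub>K\<^esub> f x) \<odot>\<^bsub>M\<^esub> \<phi> x)"
        using A c by (subst sum[where A = ?A]) (auto simp: free_simps)
      also have "\<dots> = (\<Oplus>\<^bsub>M\<^esub>x\<in>?A. c \<odot>\<^bsub>M\<^esub> (f x \<odot>\<^bsub>M\<^esub> \<phi> x))"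
        using A c assms(2) by (intro M.finsum_cong') (auto simp: M.smult_assoc1)
      also have "\<dots> = c \<odot>\<^bsub>M\<^esub> (\<Oplus>\<^bsub>M\<^esub>x\<in>?A. f x \<odot>\<^bsub>M\<^esub> \<phi> x)"
        using A c assms(2) by (intro M.finsum_smult_ldistr[symmetric]) auto
      finally show ?thesis by (simp add: lin_ext_def)
    qed
    fix g assume g: "g \<in> carrier ?F"
    let ?B = "?A \<union> {x. g x \<noteq> \<zero>\<^bsub>K\<^esub>}"
    have B: "finite ?B" "?B \<subseteq> X" "\<And>x. g x \<in> carrier K" using f g by (auto simp: free_carrier)
    have "f \<oplus>\<^bsub>?F\<^esub> g \<in> carrier ?F" using f g by (rule F.a_closed)
    then have "lin_ext K M \<phi> (f \<oplus>\<^bsub>?F\<^esub> g) = (\<Oplus>\<^bsub>M\<^esub>x\<in>?B. (f x \<oplus>\<^bsub>K\<^esub> g x) \<odot>\<^bsub>M\<^esub> \<phi> x)"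
      using A B by (subst sum[where A = ?B]) (auto simp: free_simps)
    also have "\<dots> = (\<Oplus>\<^bsub>M\<^esub>x\<in>?B. f x \<odot>\<^bsub>M\<^esub> \<phi> x \<oplus>\<^bsub>M\<^esub> g x \<odot>\<^bsub>M\<^esub> \<phi> x)"
      using A B assms(2) by (intro M.finsum_cong') (auto simp: M.smult_l_distr)
    also have "\<dots> = (\<Oplus>\<^bsub>M\<^esub>x\<in>?B. f x \<odot>\<^bsub>M\<^esub> \<phi> x) \<oplus>\<^bsub>M\<^esub> (\<Oplus>\<^bsub>M\<^esub>x\<in>?B. g x \<odot>\<^bsub>M\<^esub> \<phi> x)"
      using A B assms(2) by (intro M.finsum_addf) auto
    also have "\<dots> = lin_ext K M \<phi> f \<oplus>\<^bsub>M\<^esub> lin_ext K M \<phi> g"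
      using A B f g by (subst (1 2) sum[where A = ?B]) auto
    finally show "lin_ext K M \<phi> (f \<oplus>\<^bsub>?F\<^esub> g) = lin_ext K M \<phi> f \<oplus>\<^bsub>M\<^esub> lin_ext K M \<phi> g" .
  qed
qed

lemma lin_ext_basis:
  assumes "module K M" and "\<phi> x \<in> carrier M"
  shows "lin_ext K M \<phi> (basis_vec K x) = \<phi> x"
proof -
  interpret M: module K M by fact
  have "lin_ext K M \<phi> (basis_vec K x) = (\<Oplus>\<^bsub>M\<^esub>y\<in>{x}. basis_vec K x y \<odot>\<^bsub>M\<^esub> \<phi> y)"
    using assms(2) basis_vec_closed[OF M.R.is_cring, of x "{x}"]
    by (intro lin_ext_eq_sum[where X = "{x}"] assms) (auto simp: basis_vec_def)
  also have "\<dots> = \<phi> x" using assms(2) by (simp add: basis_vec_def)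
  finally show ?thesis .
qed

text \<open>The induction principle for free modules. A vector is split as \<open>f a\<close> times
  the basis vector at \<open>a\<close> plus the vector with its value at \<open>a\<close> erased,
  which shrinks a finite set containing the support.\<close>

lemma free_module_subset:
  assumes "cring K" and "submodule N K (free_module K X)"
    and "\<And>x. x \<in> X \<Longrightarrow> basis_vec K x \<in> N"
  shows "carrier (free_module K X) \<subseteq> N"
proof
  interpret K: cring K by fact
  let ?F = "free_module K X"
  have *: "\<forall>f. f \<in> carrier ?F \<and> {x. f x \<noteq> \<zero>\<^bsub>K\<^esub>} \<subseteq> A \<longrightarrow> f \<in> N" if "finite A" for A
    using that
  proof induct
    case empty
    show ?case
    proof (intro allI impI)
      fix f assume "f \<in> carrier ?F \<and> {x. f x \<noteq> \<zero>\<^bsub>K\<^esub>} \<subseteq> {}"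
      then have "f = \<zero>\<^bsub>?F\<^esub>" by (auto simp: free_simps)
      then show "f \<in> N" using submodule_zero[OF assms(2)] by simp
    qed
  next
    case (insert a A)
    show ?case
    proof (intro allI impI)
      fix f assume f: "f \<in> carrier ?F \<and> {x. f x \<noteq> \<zero>\<^bsub>K\<^esub>} \<subseteq> insert a A"
      then have K: "\<And>x. f x \<in> carrier K" by (simp add: free_carrier)
      let ?g = "f(a := \<zero>\<^bsub>K\<^esub>)"
      have "{x. ?g x \<noteq> \<zero>\<^bsub>K\<^esub>} \<subseteq> {x. f x \<noteq> \<zero>\<^bsub>K\<^esub>}" by auto
      then have "?g \<in> carrier ?F" using f by (auto simp: free_carrier intro: finite_subset)
      moreover have "{x. ?g x \<noteq> \<zero>\<^bsub>K\<^esub>} \<subseteq> A" using f by auto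
      ultimately have g: "?g \<in> N" using insert by blast
      \<comment> \<open>The set \<open>A\<close> bounding the support is an arbitrary finite set, so
        \<open>a\<close> is known to lie in \<open>X\<close> only when \<open>f a\<close> is
        nonzero. Otherwise erasing the value at \<open>a\<close> changes nothing.\<close>
      show "f \<in> N"
      proof (cases "f a = \<zero>\<^bsub>K\<^esub>")
        case True
        then have "?g = f" by auto
        then show ?thesis using g by simp
      next
        case False
        then have "a \<in> X" using f by (auto simp: free_carrier)
        have "f = f a \<odot>\<^bsub>?F\<^esub> basis_vec K a \<oplus>\<^bsub>?F\<^esub> ?g"
          using K by (auto simp: free_simps basis_vec_def)
        moreover have "f a \<odot>\<^bsub>?F\<^esub> basis_vec K a \<oplus>\<^bsub>?F\<^esub> ?g \<in> N"
          using g assms(3)[OF \<open>a \<in> X\<close>] K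
          by (intro submodule_add[OF assms(2)] submodule_smult[OF assms(2)])
        ultimately show ?thesis by simp
      qed
    qed
  qed
  fix f assume "f \<in> carrier ?F"
  then show "f \<in> N" using *[of "{x. f x \<noteq> \<zero>\<^bsub>K\<^esub>}"] by (auto simp: free_carrier)
qed

lemma free_linear_map_eqI:
  assumes "module K M" and "linear_map K (free_module K X) M f" and "linear_map K (free_module K X) M g"
    and "\<And>x. x \<in> X \<Longrightarrow> f (basis_vec K x) = g (basis_vec K x)"
    and "h \<in> carrier (free_module K X)"
  shows "f h = g h"
proof -
  interpret M: module K M by fact
  have F: "module K (free_module K X)" by (rule free_module_module) (rule M.R.is_cring)
  have "carrier (free_module K X) \<subseteq> {h \<in> carrier (free_module K X). f h = g h}"
    using assms basis_vec_closed[OF M.R.is_cring]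
    by (intro free_module_subset submodule_equalizer F M.R.is_cring) auto
  then show ?thesis using assms(5) by auto
qed

text \<open>For a fixed vector \<open>f\<close>, linearity in the parameter is a property preserved
  by sums and multiples of \<open>f\<close>, so basis vectors suffice. It provides linearity of tree
  composition in the second argument, which sits inside the inner of two nested extensions.\<close>

lemma lin_ext_linear_param:
  assumes "module K M" and "module K L" and "\<And>x. x \<in> X \<Longrightarrow> linear_map K L M (\<lambda>y. \<phi> y x)"
    and "f \<in> carrier (free_module K X)"
  shows "linear_map K L M (\<lambda>y. lin_ext K M (\<phi> y) f)"
proof -
  interpret M: module K M by fact
  interpret L: module K L by fact
  let ?F = "free_module K X"
  interpret F: module K ?F by (rule free_module_module) (rule M.R.is_cring)
  have lin: "linear_map K ?F M (lin_ext K M (\<phi> y))" if "y \<in> carrier L" for y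
    using that linear_map_closed[OF assms(3)] by (intro lin_ext_linear assms(1)) auto
  note 1 = linear_map_add[OF lin] linear_map_smult[OF lin] linear_map_zero[OF F.module_axioms assms(1) lin]
  let ?N = "{f \<in> carrier ?F. linear_map K L M (\<lambda>y. lin_ext K M (\<phi> y) f)}"
  have "carrier ?F \<subseteq> ?N"
  proof (rule free_module_subset[OF M.R.is_cring])
    show "submodule ?N K ?F"
    proof (rule submoduleI')
      show "\<zero>\<^bsub>?F\<^esub> \<in> ?N"
        by (auto intro: linear_map_cong[OF linear_map_const_zero[OF assms(1)] _ assms(2)] simp: 1)
      show "f \<oplus>\<^bsub>?F\<^esub> g \<in> ?N" if fg: "f \<in> ?N" "g \<in> ?N" for f g
      proof -
        have "linear_map K L M (\<lambda>y. lin_ext K M (\<phi> y) f \<oplus>\<^bsub>M\<^esub> lin_ext K M (\<phi> y) g)"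
          using fg by (intro linear_map_plus assms(1)) auto
        then have "linear_map K L M (\<lambda>y. lin_ext K M (\<phi> y) (f \<oplus>\<^bsub>?F\<^esub> g))"
          using fg by (rule_tac linear_map_cong[OF _ _ assms(2)]) (auto simp: 1)
        then show ?thesis using fg by simp
      qed
      show "c \<odot>\<^bsub>?F\<^esub> f \<in> ?N" if c: "c \<in> carrier K" and f: "f \<in> ?N" for c f
      proof -
        have "linear_map K L M (\<lambda>y. c \<odot>\<^bsub>M\<^esub> lin_ext K M (\<phi> y) f)"
          using c f by (intro linear_map_scale assms(1)) auto
        then have "linear_map K L M (\<lambda>y. lin_ext K M (\<phi> y) (c \<odot>\<^bsub>?F\<^esub> f))"
          using c f by (rule_tac linear_map_cong[OF _ _ assms(2)]) (auto simp: 1)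
        then show ?thesis using c f by simp
      qed
    qed (rule F.module_axioms, blast)
    fix x assume x: "x \<in> X"
    show "basis_vec K x \<in> ?N"
      using x linear_map_closed[OF assms(3)[OF x]] basis_vec_closed[OF M.R.is_cring x]
      by (auto intro: linear_map_cong[OF assms(3)[OF x] _ assms(2)] simp: lin_ext_basis[OF assms(1)])
  qed
  then show ?thesis using assms(4) by auto
qed

text \<open>A linear extension that kills the relators kills their span, hence is constant on each
  coset. Its image of a coset is then a singleton, the case in which \<open>the_elem\<close> has a
  known value.\<close>

lemma quot_lift_coset:
  assumes "module K M" and "\<And>x. x \<in> X \<Longrightarrow> \<phi> x \<in> carrier M"
    and "S \<subseteq> carrier (free_module K X)" and "\<And>s. s \<in> S \<Longrightarrow> lin_ext K M \<phi> s = \<zero>\<^bsub>M\<^esub>"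
    and "h \<in> carrier (free_module K X)"
  shows "quot_lift K M \<phi> (linear_span K (free_module K X) S +>\<^bsub>free_module K X\<^esub> h) = lin_ext K M \<phi> h"
proof -
  interpret M: module K M by fact
  let ?F = "free_module K X"
  interpret F: module K ?F by (rule free_module_module) (rule M.R.is_cring)
  let ?I = "linear_span K ?F S"
  note lin = lin_ext_linear[OF assms(1,2)]
  have sub: "submodule ?I K ?F" by (rule linear_span_submodule[OF F.module_axioms assms(3)])
  have "submodule {f \<in> carrier ?F. lin_ext K M \<phi> f = \<zero>\<^bsub>M\<^esub>} K ?F"
    by (intro submodule_equalizer[OF F.module_axioms assms(1) lin] linear_map_const_zero assms(1))
  then have I: "?I \<subseteq> {f \<in> carrier ?F. lin_ext K M \<phi> f = \<zero>\<^bsub>M\<^esub>}"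
    using assms(3,4) by (intro linear_span_minimal) auto
  have "lin_ext K M \<phi> z = lin_ext K M \<phi> h" if z: "z \<in> ?I +>\<^bsub>?F\<^esub> h" for z
  proof -
    obtain n where n: "n \<in> ?I" "z = n \<oplus>\<^bsub>?F\<^esub> h" using z by (auto simp: submodule_coset_mem)
    then show ?thesis
      using I assms(5) linear_map_closed[OF lin assms(5)] by (auto simp: linear_map_add[OF lin])
  qed
  moreover have "h \<in> ?I +>\<^bsub>?F\<^esub> h"
    by (rule submodule_coset_self[OF F.module_axioms sub assms(5)])
  ultimately have "lin_ext K M \<phi> ` (?I +>\<^bsub>?F\<^esub> h) = {lin_ext K M \<phi> h}" by blast
  then show ?thesis by (simp add: quot_lift_def)
qed

lemma quot_lift_linear:
  assumes "module K M" and "\<And>x. x \<in> X \<Longrightarrow> \<phi> x \<in> carrier M"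
    and "S \<subseteq> carrier (free_module K X)" and "\<And>s. s \<in> S \<Longrightarrow> lin_ext K M \<phi> s = \<zero>\<^bsub>M\<^esub>"
  shows "linear_map K (quot_module (free_module K X) (linear_span K (free_module K X) S)) M (quot_lift K M \<phi>)"
proof -
  interpret M: module K M by fact
  have F: "module K (free_module K X)" by (rule free_module_module) (rule M.R.is_cring)
  show ?thesis
  proof (rule quot_linear_mapI[OF F])
    show "linear_map K (free_module K X) M
      (\<lambda>x. quot_lift K M \<phi> (linear_span K (free_module K X) S +>\<^bsub>free_module K X\<^esub> x))"
      by (rule linear_map_cong[OF lin_ext_linear[OF assms(1,2)] _ F])
        (auto simp: quot_lift_coset[OF assms])
  qed (intro linear_span_submodule F assms(3))
qed

lemma quot_free_subset:
  assumes "cring K" and "submodule I K (free_module K X)"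
    and "submodule N K (quot_module (free_module K X) I)"
    and "\<And>x. x \<in> X \<Longrightarrow> I +>\<^bsub>free_module K X\<^esub> basis_vec K x \<in> N"
  shows "carrier (quot_module (free_module K X) I) \<subseteq> N"
proof -
  let ?F = "free_module K X"
  have F: "module K ?F" by (rule free_module_module) fact
  have "carrier ?F \<subseteq> {f \<in> carrier ?F. I +>\<^bsub>?F\<^esub> f \<in> N}"
    using assms(4) basis_vec_closed[OF assms(1)]
    by (intro free_module_subset[OF assms(1)]
        submodule_preimage[OF F quot_module_module[OF F assms(2)]] quot_proj_linear F assms(2,3)) auto
  then show ?thesis by (auto simp: quot_carrier)
qed

lemma quot_free_linear_map_eqI:
  assumes "module K M" and "submodule I K (free_module K X)"
    and "linear_map K (quot_module (free_module K X) I) M f"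
    and "linear_map K (quot_module (free_module K X) I) M g"
    and "\<And>x. x \<in> X \<Longrightarrow> f (I +>\<^bsub>free_module K X\<^esub> basis_vec K x) = g (I +>\<^bsub>free_module K X\<^esub> basis_vec K x)"
    and "h \<in> carrier (quot_module (free_module K X) I)"
  shows "f h = g h"
proof -
  interpret M: module K M by fact
  let ?F = "free_module K X"
  let ?Q = "quot_module ?F I"
  have F: "module K ?F" by (rule free_module_module) (rule M.R.is_cring)
  have Q: "module K ?Q" by (rule quot_module_module[OF F assms(2)])
  have "carrier ?Q \<subseteq> {h \<in> carrier ?Q. f h = g h}"
    using assms(5) basis_vec_closed[OF M.R.is_cring]
    by (intro quot_free_subset[OF M.R.is_cring assms(2)] submodule_equalizer[OF Q assms(1,3,4)])
      (auto intro!: quot_carrierI)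
  then show ?thesis using assms(6) by auto
qed

section \<open>Equality of multilinear maps on free modules\<close>

lemma free_bilinear_eqI:
  assumes "module K M"
    and "\<And>y. y \<in> carrier (free_module K Y) \<Longrightarrow> linear_map K (free_module K X) M (\<lambda>x. f x y)"
    and "\<And>x. x \<in> carrier (free_module K X) \<Longrightarrow> linear_map K (free_module K Y) M (\<lambda>y. f x y)"
    and "\<And>y. y \<in> carrier (free_module K Y) \<Longrightarrow> linear_map K (free_module K X) M (\<lambda>x. g x y)"
    and "\<And>x. x \<in> carrier (free_module K X) \<Longrightarrow> linear_map K (free_module K Y) M (\<lambda>y. g x y)"
    and "\<And>s t. s \<in> X \<Longrightarrow> t \<in> Y \<Longrightarrow> f (basis_vec K s) (basis_vec K t) = g (basis_vec K s) (basis_vec K t)"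
    and "x \<in> carrier (free_module K X)" and "y \<in> carrier (free_module K Y)"
  shows "f x y = g x y"
proof (rule free_linear_map_eqI[OF assms(1) assms(2,4)[OF assms(8)] _ assms(7)])
  fix s assume s: "s \<in> X"
  interpret M: module K M by fact
  have "basis_vec K s \<in> carrier (free_module K X)" by (rule basis_vec_closed[OF M.R.is_cring s])
  then show "f (basis_vec K s) y = g (basis_vec K s) y"
    by (intro free_linear_map_eqI[OF assms(1) assms(3,5) _ assms(8)] assms(6) s)
qed

text \<open>Made for the sequential and parallel axioms of an operad, whose two sides are linear in
  each of three arguments.\<close>

lemma free_trilinear_eqI:
  assumes "module K M"
    and "\<And>y z. y \<in> carrier (free_module K Y) \<Longrightarrow> z \<in> carrier (free_module K Z) \<Longrightarrow> linear_map K (free_module K X) M (\<lambda>x. f x y z)"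
    and "\<And>x z. x \<in> carrier (free_module K X) \<Longrightarrow> z \<in> carrier (free_module K Z) \<Longrightarrow> linear_map K (free_module K Y) M (\<lambda>y. f x y z)"
    and "\<And>x y. x \<in> carrier (free_module K X) \<Longrightarrow> y \<in> carrier (free_module K Y) \<Longrightarrow> linear_map K (free_module K Z) M (\<lambda>z. f x y z)"
    and "\<And>y z. y \<in> carrier (free_module K Y) \<Longrightarrow> z \<in> carrier (free_module K Z) \<Longrightarrow> linear_map K (free_module K X) M (\<lambda>x. g x y z)"
    and "\<And>x z. x \<in> carrier (free_module K X) \<Longrightarrow> z \<in> carrier (free_module K Z) \<Longrightarrow> linear_map K (free_module K Y) M (\<lambda>y. g x y z)"
    and "\<And>x y. x \<in> carrier (free_module K X) \<Longrightarrow> y \<in> carrier (free_module K Y) \<Longrightarrow> linear_map K (free_module K Z) M (\<lambda>z. g x y z)"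
    and "\<And>s t u. s \<in> X \<Longrightarrow> t \<in> Y \<Longrightarrow> u \<in> Z \<Longrightarrow>
      f (basis_vec K s) (basis_vec K t) (basis_vec K u)
          = g (basis_vec K s) (basis_vec K t) (basis_vec K u)"
    and "x \<in> carrier (free_module K X)" and "y \<in> carrier (free_module K Y)"
        and "z \<in> carrier (free_module K Z)"
  shows "f x y z = g x y z"
proof -
  note * = assms
  interpret M: module K M by fact
  show ?thesis
  proof (rule free_linear_map_eqI[OF *(1) *(2)[OF *(10,11)] *(5)[OF *(10,11)] _ *(9)])
    fix s assume s: "s \<in> X"
    have b: "basis_vec K s \<in> carrier (free_module K X)" by (rule basis_vec_closed[OF M.R.is_cring s])
    show "f (basis_vec K s) y z = g (basis_vec K s) y z"
      by (rule free_bilinear_eqI[where f = "f (basis_vec K s)" and g = "g (basis_vec K s)",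
            OF *(1) *(3)[OF b] *(4)[OF b] *(6)[OF b] *(7)[OF b] *(8)[OF s] *(10,11)])
  qed
qed

section \<open>Ideals and quotients of operads\<close>

lemma quot_operad_simps:
  "arity (quot_operad P I) n = quot_module (arity P n) (I n)"
  "ident (quot_operad P I) = I 1 +>\<^bsub>arity P 1\<^esub> ident P"
  by (simp_all add: quot_operad_def)

lemma operad_ideal_submodule: "operad_ideal K P I \<Longrightarrow> submodule (I n) K (arity P n)"
  by (simp add: operad_ideal_def)

lemma operad_ideal_circ:
  assumes "operad_ideal K P I" and "x \<in> carrier (arity P m)" and "y \<in> carrier (arity P n)"
    and "1 \<le> i" and "i \<le> m" and "x \<in> I m \<or> y \<in> I n"
  shows "circ P m i n x y \<in> I (m + n - 1)"
  using assms unfolding operad_ideal_def by blast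

text \<open>Composition in the quotient is a union over all pairs of representatives. Changing them
  one at a time, the composite changes first by a composite with \<open>a' - a\<close> and then by
  one with \<open>b' - b\<close>. Both lie in the ideal, so all pairs give the same coset.\<close>

lemma quot_operad_circ:
  assumes "ns_operad K P" and "operad_ideal K P I" and "1 \<le> i" and "i \<le> m"
    and "a \<in> carrier (arity P m)" and "b \<in> carrier (arity P n)"
  shows "circ (quot_operad P I) m i n (I m +>\<^bsub>arity P m\<^esub> a) (I n +>\<^bsub>arity P n\<^esub> b) =
    I (m + n - 1) +>\<^bsub>arity P (m + n - 1)\<^esub> circ P m i n a b"
proof -
  interpret P: ns_operad K P by fact
  note sub = operad_ideal_submodule[OF assms(2)]
  let ?k = "m + n - 1"
  note left = P.circ_linear_left[OF assms(3,4)] and right = P.circ_linear_right[OF assms(3,4)]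
  note circ_closed = linear_map_closed[OF left]
  have "I ?k +>\<^bsub>arity P ?k\<^esub> circ P m i n a' b' = I ?k +>\<^bsub>arity P ?k\<^esub> circ P m i n a b"
    if a': "a' \<in> I m +>\<^bsub>arity P m\<^esub> a" and b': "b' \<in> I n +>\<^bsub>arity P n\<^esub> b" for a' b'
  proof -
    note a'' = submodule_coset_memD[OF P.arity_module sub assms(5) a']
    note b'' = submodule_coset_memD[OF P.arity_module sub assms(6) b']
    have da: "a' \<ominus>\<^bsub>arity P m\<^esub> a \<in> I m"
      using a'' assms(5) by (simp add: submodule_coset_eq[OF P.arity_module sub])
    have db: "b' \<ominus>\<^bsub>arity P n\<^esub> b \<in> I n"
      using b'' assms(6) by (simp add: submodule_coset_eq[OF P.arity_module sub])
    have dac: "a' \<ominus>\<^bsub>arity P m\<^esub> a \<in> carrier (arity P m)" "b' \<ominus>\<^bsub>arity P n\<^esub> b \<in> carrier (arity P n)"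
      using da db submodule_subset[OF sub] by blast+
    have "circ P m i n a' b' \<ominus>\<^bsub>arity P ?k\<^esub> circ P m i n a b' \<in> I ?k"
      using operad_ideal_circ[OF assms(2) dac(1) b''(1) assms(3,4)] da
      by (simp add: linear_map_diff[OF P.arity_module P.arity_module left[OF b''(1)] a''(1) assms(5)])
    moreover have "circ P m i n a b' \<ominus>\<^bsub>arity P ?k\<^esub> circ P m i n a b \<in> I ?k"
      using operad_ideal_circ[OF assms(2,5) dac(2) assms(3,4)] db
      by (simp add: linear_map_diff[OF P.arity_module P.arity_module right[OF assms(5)] b''(1) assms(6)])
    ultimately show ?thesis
      using a'' b'' assms(5,6) circ_closed by (simp add: submodule_coset_eq[OF P.arity_module sub, symmetric])
  qed
  note * = this
  have "(\<Union>a'\<in>I m +>\<^bsub>arity P m\<^esub> a. \<Union>b'\<in>I n +>\<^bsub>arity P n\<^esub> b.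
      I ?k +>\<^bsub>arity P ?k\<^esub> circ P m i n a' b') = I ?k +>\<^bsub>arity P ?k\<^esub> circ P m i n a b"
    using submodule_coset_self[OF P.arity_module sub assms(5)]
      submodule_coset_self[OF P.arity_module sub assms(6)]
    by (intro UN_constant_eq ballI *)
  then show ?thesis by (simp add: quot_operad_def)
qed

lemma ns_operad_circ_closed:
  assumes "ns_operad K P" and "1 \<le> i" and "i \<le> m"
    and "a \<in> carrier (arity P m)" and "b \<in> carrier (arity P n)"
  shows "circ P m i n a b \<in> carrier (arity P (m + n - 1))"
  using ns_operad.circ_linear_left[OF assms(1-3,5)] assms(4) by (rule linear_map_closed)

lemma quot_operad_ns_operad:
  assumes "ns_operad K P" and "operad_ideal K P I"
  shows "ns_operad K (quot_operad P I)"
proof -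
  interpret P: ns_operad K P by fact
  note sub = operad_ideal_submodule[OF assms(2)]
  note mod = P.arity_module
  note circ = quot_operad_circ[OF assms] and closed = ns_operad_circ_closed[OF assms(1)]
  let ?Q = "quot_operad P I"
  note [simp] = quot_operad_simps
  show ?thesis
  proof (rule ns_operad.intro)
    show "field K" by (rule P.field_K)
    show "module K (arity ?Q n)" for n by (simp add: quot_module_module mod sub)
    show "ident ?Q \<in> carrier (arity ?Q 1)" using P.ident_closed by (simp add: quot_carrierI)
    show "linear_map K (arity ?Q m) (arity ?Q (m + n - 1)) (\<lambda>x. circ ?Q m i n x y)"
      if i: "1 \<le> i" "i \<le> m" and y: "y \<in> carrier (arity ?Q n)" for i m y n
    proof -
      obtain b where b: "b \<in> carrier (arity P n)" "y = I n +>\<^bsub>arity P n\<^esub> b"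
        using y by (auto elim: quot_carrierE)
      show ?thesis unfolding quot_operad_simps
      proof (rule quot_linear_mapI[OF mod sub])
        show "linear_map K (arity P m) (quot_module (arity P (m + n - 1)) (I (m + n - 1)))
          (\<lambda>x. circ ?Q m i n (I m +>\<^bsub>arity P m\<^esub> x) y)"
          by (rule linear_map_cong[OF linear_map_compose[OF P.circ_linear_left[OF i b(1)]
                quot_proj_linear[OF mod sub]] _ mod]) (simp add: b(2) circ[OF i _ b(1)])
      qed
    qed
    show "linear_map K (arity ?Q n) (arity ?Q (m + n - 1)) (\<lambda>y. circ ?Q m i n x y)"
      if i: "1 \<le> i" "i \<le> m" and x: "x \<in> carrier (arity ?Q m)" for i m x n
    proof -
      obtain a where a: "a \<in> carrier (arity P m)" "x = I m +>\<^bsub>arity P m\<^esub> a"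
        using x by (auto elim: quot_carrierE)
      show ?thesis unfolding quot_operad_simps
      proof (rule quot_linear_mapI[OF mod sub])
        show "linear_map K (arity P n) (quot_module (arity P (m + n - 1)) (I (m + n - 1)))
          (\<lambda>y. circ ?Q m i n x (I n +>\<^bsub>arity P n\<^esub> y))"
          by (rule linear_map_cong[OF linear_map_compose[OF P.circ_linear_right[OF i a(1)]
                quot_proj_linear[OF mod sub]] _ mod]) (simp add: a(2) circ[OF i a(1)])
      qed
    qed
    show "circ ?Q 1 1 n (ident ?Q) x = x" if x: "x \<in> carrier (arity ?Q n)" for x n
    proof -
      obtain a where a: "a \<in> carrier (arity P n)" "x = I n +>\<^bsub>arity P n\<^esub> a"
        using x by (auto elim: quot_carrierE)
      have "circ ?Q 1 1 n (I 1 +>\<^bsub>arity P 1\<^esub> ident P) (I n +>\<^bsub>arity P n\<^esub> a) =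
          I (1 + n - 1) +>\<^bsub>arity P (1 + n - 1)\<^esub> circ P 1 1 n (ident P) a"
        by (rule circ) (use a P.ident_closed in auto)
      then show ?thesis using a P.circ_ident_left[OF a(1)] by simp
    qed
    show "circ ?Q n i 1 x (ident ?Q) = x" if i: "1 \<le> i" "i \<le> n"
        and x: "x \<in> carrier (arity ?Q n)" for i n x
    proof -
      obtain a where a: "a \<in> carrier (arity P n)" "x = I n +>\<^bsub>arity P n\<^esub> a"
        using x by (auto elim: quot_carrierE)
      have "circ ?Q n i 1 (I n +>\<^bsub>arity P n\<^esub> a) (I 1 +>\<^bsub>arity P 1\<^esub> ident P) =
          I (n + 1 - 1) +>\<^bsub>arity P (n + 1 - 1)\<^esub> circ P n i 1 a (ident P)"
        by (rule circ) (use a i P.ident_closed in auto)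
      then show ?thesis using a i P.circ_ident_right[OF i a(1)] by simp
    qed
    fix i j k l m n x y z
    assume "x \<in> carrier (arity ?Q l)" and "y \<in> carrier (arity ?Q m)" and "z \<in> carrier (arity ?Q n)"
    then obtain a b c where
      a: "a \<in> carrier (arity P l)" "x = I l +>\<^bsub>arity P l\<^esub> a" and
      b: "b \<in> carrier (arity P m)" "y = I m +>\<^bsub>arity P m\<^esub> b" and
      c: "c \<in> carrier (arity P n)" "z = I n +>\<^bsub>arity P n\<^esub> c"
      by (auto elim!: quot_carrierE)
    show "circ ?Q (l + m - 1) (i + j - 1) n (circ ?Q l i m x y) z =
        circ ?Q l i (m + n - 1) x (circ ?Q m j n y z)"
      if ij: "1 \<le> i" "i \<le> l" "1 \<le> j" "j \<le> m"
    proof -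
      \<comment> \<open>The two sides carry differently written arities with truncated subtraction.
        They agree because \<open>l\<close> and \<open>m\<close> are positive, by the bounds on
        \<open>i\<close> and \<open>j\<close>.\<close>
      have 1: "1 \<le> i + j - 1" "i + j - 1 \<le> l + m - 1" and 2: "l + m - 1 + n - 1 = l + (m + n - 1) - 1"
        using ij by auto
      have "circ ?Q (l + m - 1) (i + j - 1) n (circ ?Q l i m x y) z =
          I (l + m - 1 + n - 1) +>\<^bsub>arity P (l + m - 1 + n - 1)\<^esub>
            circ P (l + m - 1) (i + j - 1) n (circ P l i m a b) c"
        unfolding a(2) b(2) c(2)
        by (simp only: circ[OF ij(1,2) a(1) b(1)] circ[OF 1 closed[OF ij(1,2) a(1) b(1)] c(1)])
      also have "\<dots> = I (l + (m + n - 1) - 1) +>\<^bsub>arity P (l + (m + n - 1) - 1)\<^esub>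
            circ P l i (m + n - 1) a (circ P m j n b c)"
        by (simp only: 2 P.circ_sequential[OF ij a(1) b(1) c(1)])
      also have "\<dots> = circ ?Q l i (m + n - 1) x (circ ?Q m j n y z)"
        unfolding a(2) b(2) c(2)
        by (simp only: circ[OF ij(3,4) b(1) c(1)] circ[OF ij(1,2) a(1) closed[OF ij(3,4) b(1) c(1)]])
      finally show ?thesis .
    qed
    show "circ ?Q (l + m - 1) (k + m - 1) n (circ ?Q l i m x y) z =
        circ ?Q (l + n - 1) i m (circ ?Q l k n x z) y"
      if ik: "1 \<le> i" "i < k" "k \<le> l"
    proof -
      \<comment> \<open>Here \<open>m\<close> and \<open>n\<close> may be zero. The subtractions are
        exact because \<open>i < k\<close> and \<open>k \<le> l\<close> force \<open>l\<close> to be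
        at least 2, and \<open>i\<close> remains a legal input of the composite even if filling
        input \<open>k\<close> removes an input.\<close>
      have 1: "1 \<le> k + m - 1" "k + m - 1 \<le> l + m - 1" "i \<le> l" "1 \<le> k" "i \<le> l + n - 1"
        and 2: "l + m - 1 + n - 1 = l + n - 1 + m - 1"
        using ik by auto
      have "circ ?Q (l + m - 1) (k + m - 1) n (circ ?Q l i m x y) z =
          I (l + m - 1 + n - 1) +>\<^bsub>arity P (l + m - 1 + n - 1)\<^esub>
            circ P (l + m - 1) (k + m - 1) n (circ P l i m a b) c"
        unfolding a(2) b(2) c(2)
        by (simp only: circ[OF ik(1) 1(3) a(1) b(1)] circ[OF 1(1,2) closed[OF ik(1) 1(3) a(1) b(1)] c(1)])
      also have "\<dots> = I (l + n - 1 + m - 1) +>\<^bsub>arity P (l + n - 1 + m - 1)\<^esub>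
            circ P (l + n - 1) i m (circ P l k n a c) b"
        by (simp only: 2 P.circ_parallel[OF ik a(1) b(1) c(1)])
      also have "\<dots> = circ ?Q (l + n - 1) i m (circ ?Q l k n x z) y"
        unfolding a(2) b(2) c(2)
        by (simp only: circ[OF 1(4) ik(3) a(1) c(1)] circ[OF ik(1) 1(5) closed[OF 1(4) ik(3) a(1) c(1)] b(1)])
      finally show ?thesis .
    qed
  qed
qed

lemma linear_map_image_coset:
  assumes "module K M" and "linear_map K M N f" and "submodule I K M" and "x \<in> carrier M"
  shows "f ` (I +>\<^bsub>M\<^esub> x) = f ` I +>\<^bsub>N\<^esub> f x"
proof -
  have "f (n \<oplus>\<^bsub>M\<^esub> x) = f n \<oplus>\<^bsub>N\<^esub> f x" if "n \<in> I" for n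
    using that submodule_subset[OF assms(3)] assms(4) by (auto intro: linear_map_add[OF assms(2)])
  then show ?thesis by (auto simp: a_r_coset_def' image_iff)
qed

text \<open>Taking direct images of cosets as the induced map makes it independent of
  representatives by construction. The lemma serves twice: to pass from labelled trees to free
  operads, and from free operads to presented ones.\<close>

lemma ns_operad_iso_quot:
  assumes "ns_operad_iso K P Q f" and "operad_ideal K P I" and "operad_ideal K Q J"
    and "\<And>n. f n ` I n = J n"
  shows "ns_operad_iso K (quot_operad P I) (quot_operad Q J) (\<lambda>n A. f n ` A)"
proof -
  interpret P: ns_operad K P using assms(1) by (simp add: ns_operad_iso_def)
  interpret Q: ns_operad K Q using assms(1) by (simp add: ns_operad_iso_def)
  note subP = operad_ideal_submodule[OF assms(2)] and subQ = operad_ideal_submodule[OF assms(3)]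
  have lin: "linear_map K (arity P n) (arity Q n) (f n)"
    and bij: "bij_betw (f n) (carrier (arity P n)) (carrier (arity Q n))" for n
    using assms(1) by (auto simp: ns_operad_iso_def)
  have coset: "f n ` (I n +>\<^bsub>arity P n\<^esub> x) = J n +>\<^bsub>arity Q n\<^esub> f n x"
    if "x \<in> carrier (arity P n)" for n x
    using linear_map_image_coset[OF P.arity_module lin subP that] assms(4) by simp
  note closed = linear_map_closed[OF lin]
  show ?thesis
    unfolding ns_operad_iso_def quot_operad_simps
  proof (intro conjI allI ballI impI)
    show "ns_operad K (quot_operad P I)" "ns_operad K (quot_operad Q J)"
      by (intro quot_operad_ns_operad P.ns_operad_axioms Q.ns_operad_axioms assms(2,3))+
    show "linear_map K (quot_module (arity P n) (I n)) (quot_module (arity Q n) (J n)) ((`) (f n))" for n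
    proof (rule quot_linear_mapI[OF P.arity_module subP])
      show "linear_map K (arity P n) (quot_module (arity Q n) (J n)) (\<lambda>x. f n ` (I n +>\<^bsub>arity P n\<^esub> x))"
        by (rule linear_map_cong[OF linear_map_compose[OF lin quot_proj_linear[OF Q.arity_module subQ]]
              _ P.arity_module]) (simp add: coset)
    qed
    show "bij_betw ((`) (f n)) (carrier (quot_module (arity P n) (I n)))
        (carrier (quot_module (arity Q n) (J n)))" for n
    proof (rule bij_betw_imageI)
      show "inj_on ((`) (f n)) (carrier (quot_module (arity P n) (I n)))"
      proof (rule inj_onI)
        fix A B
        assume A: "A \<in> carrier (quot_module (arity P n) (I n))"
          and B: "B \<in> carrier (quot_module (arity P n) (I n))" and eq: "f n ` A = f n ` B"
        obtain a where a: "a \<in> carrier (arity P n)" "A = I n +>\<^bsub>arity P n\<^esub> a"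
          using A by (rule quot_carrierE)
        obtain b where b: "b \<in> carrier (arity P n)" "B = I n +>\<^bsub>arity P n\<^esub> b"
          using B by (rule quot_carrierE)
        interpret Pn: module K "arity P n" by (rule P.arity_module)
        have "f n a \<ominus>\<^bsub>arity Q n\<^esub> f n b \<in> J n"
          using eq a b closed by (simp add: coset submodule_coset_eq[OF Q.arity_module subQ])
        then have "f n (a \<ominus>\<^bsub>arity P n\<^esub> b) \<in> f n ` I n"
          using a b by (simp add: assms(4) linear_map_diff[OF P.arity_module Q.arity_module lin])
        \<comment> \<open>This uses that \<open>J n\<close> is exactly the image of
          \<open>I n\<close>. If the image were merely contained in \<open>J n\<close>, the induced
          map could have a kernel.\<close>
        then have "a \<ominus>\<^bsub>arity P n\<^esub> b \<in> I n"
          using bij_betw_imp_inj_on[OF bij] submodule_subset[OF subP] a(1) b(1)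
          by (meson Pn.minus_closed inj_on_image_mem_iff)
        then show "A = B" using a b by (simp add: submodule_coset_eq[OF P.arity_module subP])
      qed
      show "(`) (f n) ` carrier (quot_module (arity P n) (I n))
          = carrier (quot_module (arity Q n) (J n))"
        unfolding quot_carrier bij_betw_imp_surj_on[OF bij, symmetric] image_image
        by (intro image_cong refl coset)
    qed
    show "f 1 ` (I 1 +>\<^bsub>arity P 1\<^esub> ident P) = J 1 +>\<^bsub>arity Q 1\<^esub> ident Q"
      using assms(1) by (simp add: coset P.ident_closed ns_operad_iso_def del: One_nat_def)
    fix m n i x y
    assume x: "x \<in> carrier (quot_module (arity P m) (I m))"
      and y: "y \<in> carrier (quot_module (arity P n) (I n))" and i: "1 \<le> i \<and> i \<le> m"
    obtain a where a: "a \<in> carrier (arity P m)" "x = I m +>\<^bsub>arity P m\<^esub> a"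
      using x by (rule quot_carrierE)
    obtain b where b: "b \<in> carrier (arity P n)" "y = I n +>\<^bsub>arity P n\<^esub> b"
      using y by (rule quot_carrierE)
    have "f (m + n - 1) (circ P m i n a b) = circ Q m i n (f m a) (f n b)"
      using assms(1) a b i unfolding ns_operad_iso_def by blast
    then show "f (m + n - 1) ` circ (quot_operad P I) m i n x y =
        circ (quot_operad Q J) m i n (f m ` x) (f n ` y)"
      using i a b closed
      by (simp add: quot_operad_circ[OF P.ns_operad_axioms assms(2)] coset
          quot_operad_circ[OF Q.ns_operad_axioms assms(3)] ns_operad_circ_closed[OF P.ns_operad_axioms]
          del: One_nat_def)
  qed
qed

section \<open>Generated ideals and their transport along isomorphisms\<close>

lemma operad_ideal_carrier:
  assumes "ns_operad K P"
  shows "operad_ideal K P (\<lambda>n. carrier (arity P n))"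
  using assms unfolding operad_ideal_def
  by (auto intro: module.carrier_is_submodule ns_operad.arity_module ns_operad_circ_closed
      simp del: One_nat_def)

text \<open>The whole operad is an ideal containing \<open>G\<close>, so the intersection runs over
  a nonempty family, and the closure conditions hold member by member.\<close>

lemma operad_ideal_generated:
  assumes "ns_operad K P" and "G \<subseteq> carrier (arity P d)"
  shows "operad_ideal K P (generated_ideal K P d G)"
proof -
  interpret P: ns_operad K P by fact
  let ?S = "\<lambda>n. {I n | I. operad_ideal K P I \<and> G \<subseteq> I d}"
  show ?thesis
    unfolding operad_ideal_def unfolding generated_ideal_def
  proof (intro conjI allI ballI impI)
    show "submodule (\<Inter>(?S n)) K (arity P n)" for n
    proof (rule submodule_Inter[OF P.arity_module])
      show "?S n \<noteq> {}" using operad_ideal_carrier[OF assms(1)] assms(2) by blast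
    qed (auto intro: operad_ideal_submodule)
  next
    fix m n i x y
    assume "x \<in> carrier (arity P m)" "y \<in> carrier (arity P n)"
      and "1 \<le> i \<and> i \<le> m \<and> (x \<in> \<Inter>(?S m) \<or> y \<in> \<Inter>(?S n))"
    then show "circ P m i n x y \<in> \<Inter>(?S (m + n - 1))"
      by (auto intro!: operad_ideal_circ simp del: One_nat_def)
  qed
qed

lemma generated_ideal_superset: "G \<subseteq> generated_ideal K P d G d"
  by (auto simp: generated_ideal_def)

lemma generated_ideal_minimal: "operad_ideal K P I \<Longrightarrow> G \<subseteq> I d \<Longrightarrow> generated_ideal K P d G n \<subseteq> I n"
  by (auto simp: generated_ideal_def)

lemma operad_ideal_preimage:
  assumes "ns_operad_iso K P Q f" and "operad_ideal K Q J"
  shows "operad_ideal K P (\<lambda>n. {x \<in> carrier (arity P n). f n x \<in> J n})"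
proof -
  interpret P: ns_operad K P using assms(1) by (simp add: ns_operad_iso_def)
  interpret Q: ns_operad K Q using assms(1) by (simp add: ns_operad_iso_def)
  have lin: "linear_map K (arity P n) (arity Q n) (f n)" for n
    using assms(1) by (auto simp: ns_operad_iso_def)
  show ?thesis
    unfolding operad_ideal_def
  proof (intro conjI allI ballI impI)
    show "submodule {x \<in> carrier (arity P n). f n x \<in> J n} K (arity P n)" for n
      by (rule submodule_preimage[OF P.arity_module Q.arity_module lin operad_ideal_submodule[OF assms(2)]])
  next
    fix m n i x y
    assume x: "x \<in> carrier (arity P m)" and y: "y \<in> carrier (arity P n)"
      and i: "1 \<le> i \<and> i \<le> m \<and> (x \<in> {x \<in> carrier (arity P m). f m x \<in> J m} \<or>
        y \<in> {x \<in> carrier (arity P n). f n x \<in> J n})"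
    have "f (m + n - 1) (circ P m i n x y) = circ Q m i n (f m x) (f n y)"
      using assms(1) x y i unfolding ns_operad_iso_def by blast
    also have "\<dots> \<in> J (m + n - 1)"
      using i x y by (intro operad_ideal_circ[OF assms(2)] linear_map_closed[OF lin]) auto
    finally show "circ P m i n x y \<in> {x \<in> carrier (arity P (m + n - 1)). f (m + n - 1) x \<in> J (m + n - 1)}"
      using i x y ns_operad_circ_closed[OF P.ns_operad_axioms] by blast
  qed
qed

text \<open>Surjectivity is what makes an image an ideal: the factor outside the ideal is arbitrary
  in \<open>Q\<close> and has to be lifted to \<open>P\<close> before the two can be composed
  there.\<close>

lemma operad_ideal_image:
  assumes "ns_operad_iso K P Q f" and "operad_ideal K P I"
  shows "operad_ideal K Q (\<lambda>n. f n ` I n)"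
proof -
  interpret P: ns_operad K P using assms(1) by (simp add: ns_operad_iso_def)
  interpret Q: ns_operad K Q using assms(1) by (simp add: ns_operad_iso_def)
  have lin: "linear_map K (arity P n) (arity Q n) (f n)"
    and bij: "bij_betw (f n) (carrier (arity P n)) (carrier (arity Q n))" for n
    using assms(1) by (auto simp: ns_operad_iso_def)
  note sub = subsetD[OF submodule_subset[OF operad_ideal_submodule[OF assms(2)]]]
  show ?thesis
    unfolding operad_ideal_def
  proof (intro conjI allI ballI impI)
    show "submodule (f n ` I n) K (arity Q n)" for n
      by (rule submodule_image[OF P.arity_module Q.arity_module lin operad_ideal_submodule[OF assms(2)]])
  next
    fix m n i x y
    assume x: "x \<in> carrier (arity Q m)" and y: "y \<in> carrier (arity Q n)"
      and i: "1 \<le> i \<and> i \<le> m \<and> (x \<in> f m ` I m \<or> y \<in> f n ` I n)"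
    \<comment> \<open>The preimage is taken inside \<open>I m\<close> whenever that is possible. The
      single choice then serves whether it is \<open>x\<close> or \<open>y\<close> that belongs to
      the image of the ideal.\<close>
    obtain a where a: "a \<in> carrier (arity P m)" "x = f m a" "x \<in> f m ` I m \<longrightarrow> a \<in> I m"
      using x bij_betw_imp_surj_on[OF bij[of m]] sub[of _ m] by (metis imageE)
    obtain b where b: "b \<in> carrier (arity P n)" "y = f n b" "y \<in> f n ` I n \<longrightarrow> b \<in> I n"
      using y bij_betw_imp_surj_on[OF bij[of n]] sub[of _ n] by (metis imageE)
    have "f (m + n - 1) (circ P m i n a b) = circ Q m i n (f m a) (f n b)"
      using assms(1) a(1) b(1) i unfolding ns_operad_iso_def by blast
    then have "f (m + n - 1) (circ P m i n a b) = circ Q m i n x y" by (simp only: a(2) b(2))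
    moreover have "circ P m i n a b \<in> I (m + n - 1)"
      using a b i by (intro operad_ideal_circ[OF assms(2)]) auto
    ultimately show "circ Q m i n x y \<in> f (m + n - 1) ` I (m + n - 1)" by (metis imageI)
  qed
qed

text \<open>The last hypothesis says that \<open>H\<close> lies in the linear span of the image of
  \<open>G\<close>, phrased so that it applies directly to a component of an ideal. One inclusion
  pulls ideals of \<open>Q\<close> back along \<open>f\<close>. The other pushes the ideal generated
  by \<open>G\<close> forward and uses minimality.\<close>

lemma ns_operad_iso_generated_ideal:
  assumes "ns_operad_iso K P Q f" and "G \<subseteq> carrier (arity P d)" and "f d ` G \<subseteq> H"
    and "\<And>N. submodule N K (arity Q d) \<Longrightarrow> f d ` G \<subseteq> N \<Longrightarrow> H \<subseteq> N"
  shows "f n ` generated_ideal K P d G n = generated_ideal K Q d H n"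
proof
  have P: "ns_operad K P" using assms(1) by (simp add: ns_operad_iso_def)
  note genP = operad_ideal_generated[OF P assms(2)]
  show "f n ` generated_ideal K P d G n \<subseteq> generated_ideal K Q d H n"
  proof -
    have "f n ` generated_ideal K P d G n \<subseteq> J n" if J: "operad_ideal K Q J" "H \<subseteq> J d" for J
    proof -
      have "generated_ideal K P d G n \<subseteq> {x \<in> carrier (arity P n). f n x \<in> J n}"
        using assms(2,3) J(2)
        by (intro generated_ideal_minimal[OF operad_ideal_preimage[OF assms(1) J(1)]]) auto
      then show ?thesis by auto
    qed
    then show ?thesis unfolding generated_ideal_def[of K Q] by blast
  qed
  have ideal: "operad_ideal K Q (\<lambda>n. f n ` generated_ideal K P d G n)"
    by (rule operad_ideal_image[OF assms(1) genP])
  show "generated_ideal K Q d H n \<subseteq> f n ` generated_ideal K P d G n"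
    by (intro generated_ideal_minimal[OF ideal] assms(4) operad_ideal_submodule[OF ideal]
        image_mono generated_ideal_superset)
qed

lemma operad_isomorphic_quot_generated:
  assumes "ns_operad_iso K P Q f" and "G \<subseteq> carrier (arity P d)" and "H \<subseteq> carrier (arity Q d)"
    and "f d ` G \<subseteq> H"
    and "\<And>N. submodule N K (arity Q d) \<Longrightarrow> f d ` G \<subseteq> N \<Longrightarrow> H \<subseteq> N"
  shows "operad_isomorphic K (quot_operad P (generated_ideal K P d G))
    (quot_operad Q (generated_ideal K Q d H))"
proof -
  have "ns_operad K P" "ns_operad K Q" using assms(1) by (simp_all add: ns_operad_iso_def)
  then show ?thesis unfolding operad_isomorphic_def
    using ns_operad_iso_quot[OF assms(1) operad_ideal_generated operad_ideal_generated
        ns_operad_iso_generated_ideal[OF assms(1,2,4,5)]] assms(2,3) by blast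
qed

section \<open>The free nonsymmetric operad\<close>

lemma size1_pos: "0 < size1 t"
  by (cases t) auto

lemma size1_graft: "1 \<le> i \<Longrightarrow> i \<le> size1 s \<Longrightarrow> size1 (graft s i t) = size1 s + size1 t - 1"
proof (induction s arbitrary: i)
  case (Node l v r)
  show ?case using Node.prems Node.IH(1)[of i] Node.IH(2)[of "i - size1 l"] size1_pos[of t]
    by auto
qed simp

lemma set_tree_graft: "set_tree (graft s i t) \<subseteq> set_tree s \<union> set_tree t"
  by (induction s arbitrary: i) auto

lemma graft_ltrees:
  "s \<in> ltrees V m \<Longrightarrow> t \<in> ltrees V n \<Longrightarrow> 1 \<le> i \<Longrightarrow> i \<le> m \<Longrightarrow> graft s i t \<in> ltrees V (m + n - 1)"
  using set_tree_graft[of s i t] size1_graft[of i s t] by (auto simp: ltrees_def)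

lemma graft_leaf: "graft s i \<langle>\<rangle> = s"
  by (induction s arbitrary: i) auto

lemma graft_sequential:
  assumes "1 \<le> i" and "i \<le> size1 s" and "1 \<le> j" and "j \<le> size1 t"
  shows "graft (graft s i t) (i + j - 1) u = graft s i (graft t j u)"
  using assms
proof (induction s arbitrary: i)
  case (Node l v r)
  show ?case
  proof (cases "i \<le> size1 l")
    case True
    then have "i + j - 1 \<le> size1 (graft l i t)" using Node.prems by (simp add: size1_graft)
    then show ?thesis using True Node.prems Node.IH(1)[of i] by simp
  next
    case False
    then have "\<not> i + j - 1 \<le> size1 l" "i + j - 1 - size1 l = i - size1 l + j - 1"
      using Node.prems by auto
    then show ?thesis using False Node.prems Node.IH(2)[of "i - size1 l"] by simp
  qed
qed simp

lemma graft_parallel: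
  assumes "1 \<le> i" and "i < k" and "k \<le> size1 s"
  shows "graft (graft s i t) (k + size1 t - 1) u = graft (graft s k u) i t"
  using assms
proof (induction s arbitrary: i k)
  case (Node l v r)
  \<comment> \<open>Both leaves lie left of the root, the root separates them, or both lie right of
    it. In the separated case the graftings touch different subtrees, and the shift of
    \<open>k\<close> by \<open>size1 t - 1\<close> is the growth of the left one.\<close>
  consider "k \<le> size1 l" | "i \<le> size1 l" "size1 l < k" | "size1 l < i" by linarith
  then show ?case
  proof cases
    case 1
    then have "k + size1 t - 1 \<le> size1 (graft l i t)" "i \<le> size1 (graft l k u)"
      using Node.prems size1_pos[of u] by (auto simp: size1_graft)
    then show ?thesis using 1 Node.prems Node.IH(1)[of i k] by simp
  next
    case 2
    then have "\<not> k + size1 t - 1 \<le> size1 (graft l i t)"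
      "k + size1 t - 1 - size1 (graft l i t) = k - size1 l"
      using Node.prems size1_pos[of t] size1_pos[of l] by (auto simp: size1_graft)
    then show ?thesis using 2 by simp
  next
    case 3
    then have "\<not> k + size1 t - 1 \<le> size1 l"
      "k + size1 t - 1 - size1 l = (k - size1 l) + size1 t - 1"
      using Node.prems size1_pos[of t] by auto
    then show ?thesis using 3 Node.prems Node.IH(2)[of "i - size1 l" "k - size1 l"] by simp
  qed
qed simp

section \<open>The operad spanned by labelled trees\<close>

lemma tree_operad_simps:
  "arity (tree_operad K V) n = free_module K (ltrees V n)"
  "ident (tree_operad K V) = basis_vec K \<langle>\<rangle>"
  by (simp_all add: tree_operad_def)

lemma tree_circ_linear_left:
  assumes "cring K" and "1 \<le> i" and "i \<le> m" and "g \<in> carrier (free_module K (ltrees V n))"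
  shows "linear_map K (free_module K (ltrees V m)) (free_module K (ltrees V (m + n - 1)))
    (\<lambda>f. circ (tree_operad K V) m i n f g)"
  unfolding tree_operad_def Let_def operad_struct.simps
  by (intro lin_ext_linear free_module_module linear_map_closed[OF lin_ext_linear assms(4)]
      basis_vec_closed graft_ltrees assms(1-3))

lemma tree_circ_linear_right:
  assumes "cring K" and "1 \<le> i" and "i \<le> m" and "f \<in> carrier (free_module K (ltrees V m))"
  shows "linear_map K (free_module K (ltrees V n)) (free_module K (ltrees V (m + n - 1)))
    (\<lambda>g. circ (tree_operad K V) m i n f g)"
  unfolding tree_operad_def Let_def operad_struct.simps
  by (intro lin_ext_linear_param[OF _ _ _ assms(4)] lin_ext_linear free_module_module
      basis_vec_closed graft_ltrees assms(1-3))

lemma tree_circ_basis: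
  assumes "cring K" and "1 \<le> i" and "i \<le> m" and "s \<in> ltrees V m" and "t \<in> ltrees V n"
  shows "circ (tree_operad K V) m i n (basis_vec K s) (basis_vec K t) = basis_vec K (graft s i t)"
proof -
  have F: "module K (free_module K (ltrees V (m + n - 1)))"
    and b: "basis_vec K (graft s i t) \<in> carrier (free_module K (ltrees V (m + n - 1)))"
    using assms by (auto intro!: free_module_module basis_vec_closed graft_ltrees simp del: One_nat_def)
  show ?thesis
    using b by (simp add: tree_operad_def Let_def lin_ext_basis[OF F] del: One_nat_def)
qed

text \<open>Both sides of each equational axiom are linear in every argument, so the axioms reduce
  to basis trees. There they are the identities of \<open>graft\<close>: leaves as units, nested
  grafting, and grafting at two distinct leaves.\<close>

lemma tree_operad_ns_operad:
  fixes K (structure)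
  assumes "field K"
  shows "ns_operad K (tree_operad K V)"
proof -
  interpret field K by fact
  let ?T = "tree_operad K V"
  let ?F = "\<lambda>n. free_module K (ltrees V n)"
  note F = free_module_module[OF is_cring] and basis = basis_vec_closed[OF is_cring]
  note left = tree_circ_linear_left[OF is_cring] and right = tree_circ_linear_right[OF is_cring]
  note circ_basis = tree_circ_basis[OF is_cring]
  note closed = linear_map_closed[OF left]
  have id_tree: "\<langle>\<rangle> \<in> ltrees V 1" by (simp add: ltrees_def)
  have id: "basis_vec K \<langle>\<rangle> \<in> carrier (?F 1)" by (rule basis[OF id_tree])
  show ?thesis
    unfolding ns_operad_def tree_operad_simps
  proof (intro conjI allI impI)
    show "field K" by fact
    show "module K (?F n)" for n by (rule F)
    show "basis_vec K \<langle>\<rangle> \<in> carrier (?F 1)" by (rule id)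
    show "linear_map K (?F m) (?F (m + n - 1)) (\<lambda>x. circ ?T m i n x y)"
      if "1 \<le> i" "i \<le> m" "y \<in> carrier (?F n)" for i m n y
      using that by (rule left)
    show "linear_map K (?F n) (?F (m + n - 1)) (\<lambda>y. circ ?T m i n x y)"
      if "1 \<le> i" "i \<le> m" "x \<in> carrier (?F m)" for i m n x
      using that by (rule right)
    show "circ ?T 1 1 n (basis_vec K \<langle>\<rangle>) x = x" if x: "x \<in> carrier (?F n)" for n x
    proof (rule free_linear_map_eqI[OF F _ linear_map_id _ x])
      show "linear_map K (?F n) (?F n) (circ ?T 1 1 n (basis_vec K \<langle>\<rangle>))"
        using right[OF _ _ id, of 1 n] by simp
      show "circ ?T 1 1 n (basis_vec K \<langle>\<rangle>) (basis_vec K t) = basis_vec K t" if "t \<in> ltrees V n" for t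
        using circ_basis[OF _ _ id_tree that, of 1] by simp
    qed
    show "circ ?T n i 1 x (basis_vec K \<langle>\<rangle>)
        = x" if i: "1 \<le> i" "i \<le> n" and x: "x \<in> carrier (?F n)" for i n x
    proof (rule free_linear_map_eqI[OF F _ linear_map_id _ x])
      show "linear_map K (?F n) (?F n) (\<lambda>x. circ ?T n i 1 x (basis_vec K \<langle>\<rangle>))"
        using left[OF i id] by simp
      show "circ ?T n i 1 (basis_vec K t) (basis_vec K \<langle>\<rangle>) = basis_vec K t" if "t \<in> ltrees V n" for t
        using circ_basis[OF i that id_tree] by (simp add: graft_leaf)
    qed
    fix i j k l m n :: nat and x y z
    assume x: "x \<in> carrier (?F l)" and y: "y \<in> carrier (?F m)" and z: "z \<in> carrier (?F n)"
    show "circ ?T (l + m - 1) (i + j - 1) n (circ ?T l i m x y) z =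
        circ ?T l i (m + n - 1) x (circ ?T m j n y z)"
      if ij: "1 \<le> i" "i \<le> l" "1 \<le> j" "j \<le> m"
    proof (rule free_trilinear_eqI[where K = K and M = "?F (l + m - 1 + n - 1)" and X = "ltrees V l"
          and Y = "ltrees V m" and Z = "ltrees V n", OF F _ _ _ _ _ _ _ x y z])
      have 1: "1 \<le> i + j - 1" "i + j - 1 \<le> l + m - 1" and 2: "l + m - 1 + n - 1 = l + (m + n - 1) - 1"
        using ij by auto
      show "linear_map K (?F l) (?F (l + m - 1 + n - 1))
          (\<lambda>x. circ ?T (l + m - 1) (i + j - 1) n (circ ?T l i m x y) z)"
        if y: "y \<in> carrier (?F m)" and z: "z \<in> carrier (?F n)" for y z
        by (rule linear_map_compose[OF left[OF ij(1,2) y] left[OF 1 z]])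
      show "linear_map K (?F m) (?F (l + m - 1 + n - 1))
          (\<lambda>y. circ ?T (l + m - 1) (i + j - 1) n (circ ?T l i m x y) z)"
        if x: "x \<in> carrier (?F l)" and z: "z \<in> carrier (?F n)" for x z
        by (rule linear_map_compose[OF right[OF ij(1,2) x] left[OF 1 z]])
      show "linear_map K (?F n) (?F (l + m - 1 + n - 1))
          (\<lambda>z. circ ?T (l + m - 1) (i + j - 1) n (circ ?T l i m x y) z)"
        if x: "x \<in> carrier (?F l)" and y: "y \<in> carrier (?F m)" for x y
        by (rule right[OF 1 closed[OF ij(1,2) y x]])
      show "linear_map K (?F l) (?F (l + m - 1 + n - 1))
          (\<lambda>x. circ ?T l i (m + n - 1) x (circ ?T m j n y z))"
        if y: "y \<in> carrier (?F m)" and z: "z \<in> carrier (?F n)" for y z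
        unfolding 2 by (rule left[OF ij(1,2) closed[OF ij(3,4) z y]])
      show "linear_map K (?F m) (?F (l + m - 1 + n - 1))
          (\<lambda>y. circ ?T l i (m + n - 1) x (circ ?T m j n y z))"
        if x: "x \<in> carrier (?F l)" and z: "z \<in> carrier (?F n)" for x z
        unfolding 2 by (rule linear_map_compose[OF left[OF ij(3,4) z] right[OF ij(1,2) x]])
      show "linear_map K (?F n) (?F (l + m - 1 + n - 1))
          (\<lambda>z. circ ?T l i (m + n - 1) x (circ ?T m j n y z))"
        if x: "x \<in> carrier (?F l)" and y: "y \<in> carrier (?F m)" for x y
        unfolding 2 by (rule linear_map_compose[OF right[OF ij(3,4) y] right[OF ij(1,2) x]])
    next
      fix s t u assume s: "s \<in> ltrees V l" and t: "t \<in> ltrees V m" and u: "u \<in> ltrees V n"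
      have 1: "1 \<le> i + j - 1" "i + j - 1 \<le> l + m - 1" using ij by auto
      have "graft (graft s i t) (i + j - 1) u = graft s i (graft t j u)"
        using s t ij by (intro graft_sequential) (auto simp: ltrees_def)
      then show "circ ?T (l + m - 1) (i + j - 1) n (circ ?T l i m (basis_vec K s) (basis_vec K t)) (basis_vec K u) =
          circ ?T l i (m + n - 1) (basis_vec K s) (circ ?T m j n (basis_vec K t) (basis_vec K u))"
        by (simp only: circ_basis[OF ij(1,2) s t] circ_basis[OF 1 graft_ltrees[OF s t ij(1,2)] u]
            circ_basis[OF ij(3,4) t u] circ_basis[OF ij(1,2) s graft_ltrees[OF t u ij(3,4)]])
    qed
    show "circ ?T (l + m - 1) (k + m - 1) n (circ ?T l i m x y) z =
        circ ?T (l + n - 1) i m (circ ?T l k n x z) y"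
      if ik: "1 \<le> i" "i < k" "k \<le> l"
    proof (rule free_trilinear_eqI[where K = K and M = "?F (l + m - 1 + n - 1)" and X = "ltrees V l"
          and Y = "ltrees V m" and Z = "ltrees V n", OF F _ _ _ _ _ _ _ x y z])
      have 1: "1 \<le> k + m - 1" "k + m - 1 \<le> l + m - 1" and 2: "l + m - 1 + n - 1 = l + n - 1 + m - 1"
        and 3: "i \<le> l" "1 \<le> k" "i \<le> l + n - 1"
        using ik by auto
      show "linear_map K (?F l) (?F (l + m - 1 + n - 1))
          (\<lambda>x. circ ?T (l + m - 1) (k + m - 1) n (circ ?T l i m x y) z)"
        if y: "y \<in> carrier (?F m)" and z: "z \<in> carrier (?F n)" for y z
        by (rule linear_map_compose[OF left[OF ik(1) 3(1) y] left[OF 1 z]])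
      show "linear_map K (?F m) (?F (l + m - 1 + n - 1))
          (\<lambda>y. circ ?T (l + m - 1) (k + m - 1) n (circ ?T l i m x y) z)"
        if x: "x \<in> carrier (?F l)" and z: "z \<in> carrier (?F n)" for x z
        by (rule linear_map_compose[OF right[OF ik(1) 3(1) x] left[OF 1 z]])
      show "linear_map K (?F n) (?F (l + m - 1 + n - 1))
          (\<lambda>z. circ ?T (l + m - 1) (k + m - 1) n (circ ?T l i m x y) z)"
        if x: "x \<in> carrier (?F l)" and y: "y \<in> carrier (?F m)" for x y
        by (rule right[OF 1 closed[OF ik(1) 3(1) y x]])
      show "linear_map K (?F l) (?F (l + m - 1 + n - 1))
          (\<lambda>x. circ ?T (l + n - 1) i m (circ ?T l k n x z) y)"
        if y: "y \<in> carrier (?F m)" and z: "z \<in> carrier (?F n)" for y z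
        unfolding 2 by (rule linear_map_compose[OF left[OF 3(2) ik(3) z] left[OF ik(1) 3(3) y]])
      show "linear_map K (?F m) (?F (l + m - 1 + n - 1))
          (\<lambda>y. circ ?T (l + n - 1) i m (circ ?T l k n x z) y)"
        if x: "x \<in> carrier (?F l)" and z: "z \<in> carrier (?F n)" for x z
        unfolding 2 by (rule right[OF ik(1) 3(3) closed[OF 3(2) ik(3) z x]])
      show "linear_map K (?F n) (?F (l + m - 1 + n - 1))
          (\<lambda>z. circ ?T (l + n - 1) i m (circ ?T l k n x z) y)"
        if x: "x \<in> carrier (?F l)" and y: "y \<in> carrier (?F m)" for x y
        unfolding 2 by (rule linear_map_compose[OF right[OF 3(2) ik(3) x] left[OF ik(1) 3(3) y]])
    next
      fix s t u assume s: "s \<in> ltrees V l" and t: "t \<in> ltrees V m" and u: "u \<in> ltrees V n"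
      have 1: "1 \<le> k + m - 1" "k + m - 1 \<le> l + m - 1" and 3: "i \<le> l" "1 \<le> k" "i \<le> l + n - 1"
        using ik by auto
      have "graft (graft s i t) (k + m - 1) u = graft (graft s k u) i t"
        using graft_parallel[of i k s t u] s t ik by (simp add: ltrees_def)
      then show "circ ?T (l + m - 1) (k + m - 1) n (circ ?T l i m (basis_vec K s) (basis_vec K t)) (basis_vec K u) =
          circ ?T (l + n - 1) i m (circ ?T l k n (basis_vec K s) (basis_vec K u)) (basis_vec K t)"
        by (simp only: circ_basis[OF ik(1) 3(1) s t] circ_basis[OF 1 graft_ltrees[OF s t ik(1) 3(1)] u]
            circ_basis[OF 3(2) ik(3) s u] circ_basis[OF ik(1) 3(3) graft_ltrees[OF s u 3(2) ik(3)] t])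
    qed
  qed
qed

section \<open>Multilinearity in the labels\<close>

lemma add_at_size1: "add_at V t t1 t2 \<Longrightarrow> size1 t = size1 t1 \<and> size1 t = size1 t2"
  by (induction rule: add_at.induct) auto

lemma scale_at_size1: "scale_at V c t t' \<Longrightarrow> size1 t = size1 t'"
  by (induction rule: scale_at.induct) auto

text \<open>The relators require only the summand trees to have labels in \<open>V\<close>. The
  remaining tree has the same labels except for one, which is a sum.\<close>

lemma add_at_ltrees:
  assumes "module K V" and "add_at V t t1 t2" and "t1 \<in> ltrees V n" and "t2 \<in> ltrees V n"
  shows "t \<in> ltrees V n"
proof -
  interpret V: module K V by fact
  have "set_tree t \<subseteq> carrier V"
    using assms(2) assms(3,4)[unfolded ltrees_def mem_Collect_eq, THEN conjunct1]
    by (induction rule: add_at.induct) auto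
  then show ?thesis using add_at_size1[OF assms(2)] assms(3) by (auto simp: ltrees_def)
qed

lemma scale_at_ltrees:
  assumes "module K V" and "scale_at V c t t'" and "c \<in> carrier K" and "t' \<in> ltrees V n"
  shows "t \<in> ltrees V n"
proof -
  interpret V: module K V by fact
  have "set_tree t \<subseteq> carrier V"
    using assms(2) assms(4)[unfolded ltrees_def mem_Collect_eq, THEN conjunct1]
    by (induction rule: scale_at.induct) (auto simp: assms(3))
  then show ?thesis using scale_at_size1[OF assms(2)] assms(4) by (auto simp: ltrees_def)
qed

text \<open>The three trees have the same shape, so \<open>graft\<close> descends the same way in
  each. For a change inside the left subtree this rests on the equality of the sizes against which
  \<open>i\<close> is compared.\<close>

lemma add_at_graft_left:
  "add_at V t t1 t2 \<Longrightarrow> add_at V (graft t i s) (graft t1 i s) (graft t2 i s)"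
proof (induction arbitrary: i rule: add_at.induct)
  case (2 l l1 l2 v r)
  then show ?case using add_at_size1[OF 2(1)] by (auto intro: add_at.intros)
qed (auto intro: add_at.intros)

text \<open>A leaf is replaced by one copy of the grafted tree, so a single altered vertex remains a
  single altered vertex.\<close>

lemma add_at_graft_right:
  "add_at V s s1 s2 \<Longrightarrow> add_at V (graft t i s) (graft t i s1) (graft t i s2)"
  by (induction t arbitrary: i) (auto intro: add_at.intros)

lemma scale_at_graft_left:
  "scale_at V c t t' \<Longrightarrow> scale_at V c (graft t i s) (graft t' i s)"
proof (induction arbitrary: i rule: scale_at.induct)
  case (2 l l' v r)
  then show ?case using scale_at_size1[OF 2(1)] by (auto intro: scale_at.intros)
qed (auto intro: scale_at.intros)

lemma scale_at_graft_right:
  "scale_at V c s s' \<Longrightarrow> scale_at V c (graft t i s) (graft t i s')"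
  by (induction t arbitrary: i) (auto intro: scale_at.intros)

lemma add_at_map_tree:
  assumes "linear_map K V W f" and "add_at V t t1 t2"
    and "set_tree t1 \<subseteq> carrier V" and "set_tree t2 \<subseteq> carrier V"
  shows "add_at W (map_tree f t) (map_tree f t1) (map_tree f t2)"
  using assms(2-4)
proof (induction rule: add_at.induct)
  case (1 l v w r)
  then show ?case using add_at.intros(1)[of W] by (simp add: linear_map_add[OF assms(1)])
qed (auto intro: add_at.intros)

lemma scale_at_map_tree:
  assumes "linear_map K V W f" and "scale_at V c t t'" and "c \<in> carrier K"
    and "set_tree t' \<subseteq> carrier V"
  shows "scale_at W c (map_tree f t) (map_tree f t')"
  using assms(2,4)
proof (induction rule: scale_at.induct)
  case (1 l v r)
  then show ?case
    using scale_at.intros(1)[of W] by (simp add: linear_map_smult[OF assms(1,3)])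
qed (auto intro: scale_at.intros)

lemma multilinear_rels_cases:
  assumes "x \<in> multilinear_rels K V n"
  obtains (add) t t1 t2 where "t1 \<in> ltrees V n" "t2 \<in> ltrees V n" "add_at V t t1 t2"
      "x = basis_vec K t \<ominus>\<^bsub>free_module K (ltrees V n)\<^esub> basis_vec K t1
        \<ominus>\<^bsub>free_module K (ltrees V n)\<^esub> basis_vec K t2"
    | (scale) c t t' where "c \<in> carrier K" "t' \<in> ltrees V n" "scale_at V c t t'"
      "x = basis_vec K t \<ominus>\<^bsub>free_module K (ltrees V n)\<^esub> c \<odot>\<^bsub>free_module K (ltrees V n)\<^esub> basis_vec K t'"
  using assms unfolding multilinear_rels_def Let_def by blast

lemma multilinear_rels_subset:
  assumes "module K V"
  shows "multilinear_rels K V n \<subseteq> carrier (free_module K (ltrees V n))"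
proof
  interpret V: module K V by fact
  interpret F: module K "free_module K (ltrees V n)" by (rule free_module_module[OF V.R.is_cring])
  note [simp] = basis_vec_closed[OF V.R.is_cring]
  fix x assume "x \<in> multilinear_rels K V n"
  then show "x \<in> carrier (free_module K (ltrees V n))"
    by (cases rule: multilinear_rels_cases)
      (auto intro!: F.minus_closed dest: add_at_ltrees[OF assms] scale_at_ltrees[OF assms])
qed

lemma multilinear_null_submodule:
  assumes "module K V"
  shows "submodule (multilinear_null K V n) K (free_module K (ltrees V n))"
proof -
  interpret V: module K V by fact
  show ?thesis unfolding multilinear_null_def
    by (intro linear_span_submodule multilinear_rels_subset free_module_module V.R.is_cring assms)
qed

lemma multilinear_null_add_at:
  assumes "t1 \<in> ltrees V n" and "t2 \<in> ltrees V n" and "add_at V t t1 t2"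
  shows "basis_vec K t \<ominus>\<^bsub>free_module K (ltrees V n)\<^esub> basis_vec K t1
        \<ominus>\<^bsub>free_module K (ltrees V n)\<^esub> basis_vec K t2 \<in> multilinear_null K V n"
  unfolding multilinear_null_def
  by (rule subsetD[OF linear_span_superset]) (use assms in \<open>auto simp: multilinear_rels_def Let_def\<close>)

lemma multilinear_null_scale_at:
  assumes "c \<in> carrier K" and "t' \<in> ltrees V n" and "scale_at V c t t'"
  shows "basis_vec K t \<ominus>\<^bsub>free_module K (ltrees V n)\<^esub>
    c \<odot>\<^bsub>free_module K (ltrees V n)\<^esub> basis_vec K t' \<in> multilinear_null K V n"
  unfolding multilinear_null_def
  by (rule subsetD[OF linear_span_superset]) (use assms in \<open>auto simp: multilinear_rels_def Let_def\<close>)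

text \<open>Reduces an inclusion concerning the whole span of relators to statements about values of
  \<open>g\<close> on trees. The target \<open>N\<close> is left arbitrary because \<open>g\<close>
  is sometimes a composition and sometimes a relabelling.\<close>

lemma multilinear_null_map:
  assumes "module K V" and "module K M" and "linear_map K (free_module K (ltrees V n)) M g"
    and "submodule N K M"
    and "\<And>t t1 t2. t1 \<in> ltrees V n \<Longrightarrow> t2 \<in> ltrees V n \<Longrightarrow> add_at V t t1 t2 \<Longrightarrow>
      g (basis_vec K t) \<ominus>\<^bsub>M\<^esub> g (basis_vec K t1) \<ominus>\<^bsub>M\<^esub> g (basis_vec K t2) \<in> N"
    and "\<And>c t t'. c \<in> carrier K \<Longrightarrow> t' \<in> ltrees V n \<Longrightarrow> scale_at V c t t' \<Longrightarrow>
      g (basis_vec K t) \<ominus>\<^bsub>M\<^esub> c \<odot>\<^bsub>M\<^esub> g (basis_vec K t') \<in> N"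
    and "x \<in> multilinear_null K V n"
  shows "g x \<in> N"
proof -
  interpret V: module K V by fact
  let ?F = "free_module K (ltrees V n)"
  interpret F: module K ?F by (rule free_module_module[OF V.R.is_cring])
  note basis = basis_vec_closed[OF V.R.is_cring]
  note lin = linear_map_diff[OF F.module_axioms assms(2,3)] linear_map_smult[OF assms(3)]
  have "multilinear_rels K V n \<subseteq> {x \<in> carrier ?F. g x \<in> N}"
  proof
    fix x assume x: "x \<in> multilinear_rels K V n"
    then have "x \<in> carrier ?F" using multilinear_rels_subset[OF assms(1)] by blast
    moreover have "g x \<in> N" using x
    proof (cases rule: multilinear_rels_cases)
      case (add t t1 t2)
      then show ?thesis
        using assms(5)[OF add(1-3)] add_at_ltrees[OF assms(1) add(3,1,2)]
        by (simp add: lin basis F.minus_closed)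
    next
      case (scale c t t')
      then show ?thesis
        using assms(6)[OF scale(1-3)] scale_at_ltrees[OF assms(1) scale(3,1,2)]
        by (simp add: lin basis F.minus_closed)
    qed
    ultimately show "x \<in> {x \<in> carrier ?F. g x \<in> N}" by simp
  qed
  then have "multilinear_null K V n \<subseteq> {x \<in> carrier ?F. g x \<in> N}"
    unfolding multilinear_null_def
    by (intro linear_span_minimal submodule_preimage[OF F.module_axioms assms(2,3,4)])
  then show ?thesis using assms(7) by blast
qed

text \<open>Once the other factor has been reduced to a single tree by linearity, composing it with
  a relator grafts that tree onto, or into, every term. The result is again a relator, since
  grafting respects \<open>add_at\<close> and \<open>scale_at\<close>.\<close>

lemma multilinear_null_ideal:
  assumes "field K" and "module K V"
  shows "operad_ideal K (tree_operad K V) (multilinear_null K V)"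
proof -
  interpret V: module K V by fact
  note cr = V.R.is_cring
  let ?T = "tree_operad K V"
  let ?F = "\<lambda>n. free_module K (ltrees V n)"
  let ?N = "multilinear_null K V"
  note F = free_module_module[OF cr] and basis = basis_vec_closed[OF cr]
  note left = tree_circ_linear_left[OF cr] and right = tree_circ_linear_right[OF cr]
  note circ_basis = tree_circ_basis[OF cr]
  note sub = multilinear_null_submodule[OF assms(2)]
  note null = subsetD[OF submodule_subset[OF sub]]
  show ?thesis
    unfolding operad_ideal_def tree_operad_simps
  proof (intro conjI allI ballI impI)
    show "submodule (?N n) K (?F n)" for n by (rule sub)
    fix m n i x y
    assume x: "x \<in> carrier (?F m)" and y: "y \<in> carrier (?F n)"
      and "1 \<le> i \<and> i \<le> m \<and> (x \<in> ?N m \<or> y \<in> ?N n)"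
    then have i: "1 \<le> i" "i \<le> m" and xy: "x \<in> ?N m \<or> y \<in> ?N n" by auto
    let ?k = "m + n - 1"
    from xy show "circ ?T m i n x y \<in> ?N ?k"
    proof
      assume x': "x \<in> ?N m"
      have "circ ?T m i n x (basis_vec K s) \<in> ?N ?k" if s: "s \<in> ltrees V n" for s
      proof (rule multilinear_null_map[OF assms(2) F left[OF i basis[OF s]] sub _ _ x'])
        fix t t1 t2 assume t: "t1 \<in> ltrees V m" "t2 \<in> ltrees V m" "add_at V t t1 t2"
        show "circ ?T m i n (basis_vec K t) (basis_vec K s)
          \<ominus>\<^bsub>?F ?k\<^esub> circ ?T m i n (basis_vec K t1) (basis_vec K s)
          \<ominus>\<^bsub>?F ?k\<^esub> circ ?T m i n (basis_vec K t2) (basis_vec K s) \<in> ?N ?k"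
          unfolding circ_basis[OF i add_at_ltrees[OF assms(2) t(3,1,2)] s] circ_basis[OF i t(1) s]
            circ_basis[OF i t(2) s]
          by (intro multilinear_null_add_at graft_ltrees t s i add_at_graft_left)
      next
        fix c t t' assume t: "c \<in> carrier K" "t' \<in> ltrees V m" "scale_at V c t t'"
        show "circ ?T m i n (basis_vec K t) (basis_vec K s)
          \<ominus>\<^bsub>?F ?k\<^esub> c \<odot>\<^bsub>?F ?k\<^esub> circ ?T m i n (basis_vec K t') (basis_vec K s) \<in> ?N ?k"
          unfolding circ_basis[OF i scale_at_ltrees[OF assms(2) t(3,1,2)] s] circ_basis[OF i t(2) s]
          by (intro multilinear_null_scale_at graft_ltrees t s i scale_at_graft_left)
      qed
      then have "carrier (?F n) \<subseteq> {y \<in> carrier (?F n). circ ?T m i n x y \<in> ?N ?k}"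
        by (intro free_module_subset[OF cr submodule_preimage[OF F F right[OF i x] sub]]) (simp add: basis)
      then show ?thesis using y by blast
    next
      assume y': "y \<in> ?N n"
      have "circ ?T m i n (basis_vec K s) y \<in> ?N ?k" if s: "s \<in> ltrees V m" for s
      proof (rule multilinear_null_map[OF assms(2) F right[OF i basis[OF s]] sub _ _ y'])
        fix t t1 t2 assume t: "t1 \<in> ltrees V n" "t2 \<in> ltrees V n" "add_at V t t1 t2"
        show "circ ?T m i n (basis_vec K s) (basis_vec K t)
          \<ominus>\<^bsub>?F ?k\<^esub> circ ?T m i n (basis_vec K s) (basis_vec K t1)
          \<ominus>\<^bsub>?F ?k\<^esub> circ ?T m i n (basis_vec K s) (basis_vec K t2) \<in> ?N ?k"
          unfolding circ_basis[OF i s add_at_ltrees[OF assms(2) t(3,1,2)]] circ_basis[OF i s t(1)]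
            circ_basis[OF i s t(2)]
          by (intro multilinear_null_add_at graft_ltrees t s i add_at_graft_right)
      next
        fix c t t' assume t: "c \<in> carrier K" "t' \<in> ltrees V n" "scale_at V c t t'"
        show "circ ?T m i n (basis_vec K s) (basis_vec K t)
          \<ominus>\<^bsub>?F ?k\<^esub> c \<odot>\<^bsub>?F ?k\<^esub> circ ?T m i n (basis_vec K s) (basis_vec K t') \<in> ?N ?k"
          unfolding circ_basis[OF i s scale_at_ltrees[OF assms(2) t(3,1,2)]] circ_basis[OF i s t(2)]
          by (intro multilinear_null_scale_at graft_ltrees t s i scale_at_graft_right)
      qed
      then have "carrier (?F m) \<subseteq> {x \<in> carrier (?F m). circ ?T m i n x y \<in> ?N ?k}"
        by (intro free_module_subset[OF cr submodule_preimage[OF F F left[OF i y] sub]]) (simp add: basis)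
      then show ?thesis using x by blast
    qed
  qed
qed

section \<open>The free operad and its universal property in a fixed arity\<close>

lemma free_operad_arity:
  "arity (free_operad K V) n = quot_module (free_module K (ltrees V n)) (multilinear_null K V n)"
  by (simp add: free_operad_def quot_operad_simps tree_operad_simps)

lemma free_operad_module: "module K V \<Longrightarrow> module K (arity (free_operad K V) n)"
  unfolding free_operad_arity
  by (intro quot_module_module free_module_module multilinear_null_submodule) (auto simp: module_def)

lemma tree_elem_coset:
  "t \<in> ltrees V n \<Longrightarrow> tree_elem K V t = multilinear_null K V n
      +>\<^bsub>free_module K (ltrees V n)\<^esub> basis_vec K t"
  by (auto simp: tree_elem_def ltrees_def)

lemma tree_elem_closed:
  "module K V \<Longrightarrow> t \<in> ltrees V n \<Longrightarrow> tree_elem K V t \<in> carrier (arity (free_operad K V) n)"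
  unfolding free_operad_arity tree_elem_coset
  by (intro quot_carrierI basis_vec_closed) (auto simp: module_def)

lemma tree_elem_add_at:
  assumes "module K V" and "t1 \<in> ltrees V n" and "t2 \<in> ltrees V n" and "add_at V t t1 t2"
  shows "tree_elem K V t = tree_elem K V t1 \<oplus>\<^bsub>arity (free_operad K V) n\<^esub> tree_elem K V t2"
proof -
  interpret V: module K V by fact
  have t: "t \<in> ltrees V n" by (rule add_at_ltrees[OF assms(1,4,2,3)])
  show ?thesis
    unfolding free_operad_arity tree_elem_coset[OF t] tree_elem_coset[OF assms(2)]
      tree_elem_coset[OF assms(3)]
    by (intro quot_add_eqI[OF free_module_module[OF V.R.is_cring] multilinear_null_submodule[OF assms(1)]]
        multilinear_null_add_at basis_vec_closed V.R.is_cring assms t)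
qed

lemma tree_elem_scale_at:
  assumes "module K V" and "c \<in> carrier K" and "t' \<in> ltrees V n" and "scale_at V c t t'"
  shows "tree_elem K V t = c \<odot>\<^bsub>arity (free_operad K V) n\<^esub> tree_elem K V t'"
proof -
  interpret V: module K V by fact
  have t: "t \<in> ltrees V n" by (rule scale_at_ltrees[OF assms(1,4,2,3)])
  show ?thesis
    unfolding free_operad_arity tree_elem_coset[OF t] tree_elem_coset[OF assms(3)]
    by (intro quot_smult_eqI[OF free_module_module[OF V.R.is_cring] multilinear_null_submodule[OF assms(1)]]
        multilinear_null_scale_at basis_vec_closed V.R.is_cring assms t)
qed

lemma free_operad_linear_map_eqI:
  assumes "module K V" and "module K M"
    and "linear_map K (arity (free_operad K V) n) M f" and "linear_map K (arity (free_operad K V) n) M g"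
    and "\<And>t. t \<in> ltrees V n \<Longrightarrow> f (tree_elem K V t) = g (tree_elem K V t)"
    and "h \<in> carrier (arity (free_operad K V) n)"
  shows "f h = g h"
  by (rule quot_free_linear_map_eqI[OF assms(2) multilinear_null_submodule[OF assms(1)]
        assms(3,4)[unfolded free_operad_arity] _ assms(6)[unfolded free_operad_arity]])
    (use assms(5) in \<open>simp add: tree_elem_coset\<close>)

text \<open>The condition under which a function on labelled trees descends to a component of the
  free operad. It mirrors the relators, so that their vanishing can be read off for every arity at
  once.\<close>

definition tree_multilinear ::
  "('a, 'k) ring_scheme \<Rightarrow> ('a, 'v) module \<Rightarrow> nat \<Rightarrow> ('a, 'b) module \<Rightarrow> ('v tree \<Rightarrow> 'b) \<Rightarrow> bool" where
  "tree_multilinear K V n M \<phi> \<longleftrightarrow>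
     (\<forall>t\<in>ltrees V n. \<phi> t \<in> carrier M) \<and>
     (\<forall>t. \<forall>t1\<in>ltrees V n. \<forall>t2\<in>ltrees V n. add_at V t t1 t2 \<longrightarrow> \<phi> t = \<phi> t1 \<oplus>\<^bsub>M\<^esub> \<phi> t2) \<and>
     (\<forall>c\<in>carrier K. \<forall>t. \<forall>t'\<in>ltrees V n. scale_at V c t t' \<longrightarrow> \<phi> t = c \<odot>\<^bsub>M\<^esub> \<phi> t')"

text \<open>The universal property of one component: multilinearity says precisely that the linear
  extension kills each relator, after which \<open>quot_lift\<close> takes its intended
  values.\<close>

lemma free_operad_lift:
  assumes "module K V" and "module K M" and "tree_multilinear K V n M \<phi>"
  shows free_operad_lift_linear: "linear_map K (arity (free_operad K V) n) M (quot_lift K M \<phi>)"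
    and free_operad_lift_tree: "\<And>t. t \<in> ltrees V n \<Longrightarrow> quot_lift K M \<phi> (tree_elem K V t) = \<phi> t"
proof -
  have \<phi>: "\<And>t. t \<in> ltrees V n \<Longrightarrow> \<phi> t \<in> carrier M"
    and \<phi>_add: "\<And>t t1 t2. t1 \<in> ltrees V n \<Longrightarrow> t2 \<in> ltrees V n \<Longrightarrow> add_at V t t1 t2 \<Longrightarrow>
      \<phi> t = \<phi> t1 \<oplus>\<^bsub>M\<^esub> \<phi> t2"
    and \<phi>_scale: "\<And>c t t'. c \<in> carrier K \<Longrightarrow> t' \<in> ltrees V n \<Longrightarrow> scale_at V c t t' \<Longrightarrow>
      \<phi> t = c \<odot>\<^bsub>M\<^esub> \<phi> t'"
    using assms(3) by (auto simp: tree_multilinear_def)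
  interpret V: module K V by fact
  interpret M: module K M by fact
  let ?F = "free_module K (ltrees V n)"
  interpret F: module K ?F by (rule free_module_module[OF V.R.is_cring])
  note basis = basis_vec_closed[OF V.R.is_cring]
  note lin = lin_ext_linear[OF assms(2) \<phi>]
  note lins = linear_map_diff[OF F.module_axioms assms(2) lin] linear_map_smult[OF lin]
  have ext: "lin_ext K M \<phi> (basis_vec K t) = \<phi> t" if "t \<in> ltrees V n" for t
    using lin_ext_basis[OF assms(2), of \<phi>] \<phi>[OF that] by blast
  note R = multilinear_rels_subset[OF assms(1), of n]
  have zero: "lin_ext K M \<phi> x = \<zero>\<^bsub>M\<^esub>" if "x \<in> multilinear_rels K V n" for x
    using that
  proof (cases rule: multilinear_rels_cases)
    case (add t t1 t2)
    note t = add_at_ltrees[OF assms(1) add(3,1,2)]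
    have "\<phi> t = \<phi> t1 \<oplus>\<^bsub>M\<^esub> \<phi> t2" by (rule \<phi>_add[OF add(1-3)])
    then have "\<phi> t \<ominus>\<^bsub>M\<^esub> \<phi> t1 \<ominus>\<^bsub>M\<^esub> \<phi> t2 = \<zero>\<^bsub>M\<^esub>"
      using \<phi>[OF add(1)] \<phi>[OF add(2)]
      by (simp add: M.minus_eq M.a_comm[of "\<phi> t1"] M.a_assoc M.r_neg)
    then show ?thesis using add t by (simp add: lins ext basis F.minus_closed)
  next
    case (scale c t t')
    note t = scale_at_ltrees[OF assms(1) scale(3,1,2)]
    have "\<phi> t = c \<odot>\<^bsub>M\<^esub> \<phi> t'" by (rule \<phi>_scale[OF scale(1-3)])
    then have "\<phi> t \<ominus>\<^bsub>M\<^esub> c \<odot>\<^bsub>M\<^esub> \<phi> t' = \<zero>\<^bsub>M\<^esub>"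
      using \<phi>[OF scale(2)] scale(1) by (simp add: M.minus_eq M.r_neg)
    then show ?thesis using scale t by (simp add: lins ext basis F.minus_closed)
  qed
  show "linear_map K (arity (free_operad K V) n) M (quot_lift K M \<phi>)"
    unfolding free_operad_arity multilinear_null_def
    by (rule quot_lift_linear[OF assms(2) \<phi> R zero])
  show "quot_lift K M \<phi> (tree_elem K V t) = \<phi> t" if t: "t \<in> ltrees V n" for t
    unfolding tree_elem_coset[OF t] multilinear_null_def
    using quot_lift_coset[OF assms(2) \<phi> R zero basis[OF t]] ext[OF t] by simp
qed

section \<open>Functoriality of the free operad in its generators\<close>

lemma linear_map_inv_into:
  assumes "module K V" and "linear_map K V W f" and "bij_betw f (carrier V) (carrier W)"
  shows "linear_map K W V (inv_into (carrier V) f)"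
proof -
  interpret V: module K V by fact
  let ?g = "inv_into (carrier V) f"
  have g: "?g y \<in> carrier V" "f (?g y) = y" if "y \<in> carrier W" for y
    using that assms(3) by (auto simp: bij_betw_def f_inv_into_f inv_into_into)
  have gf: "?g (f x) = x" if "x \<in> carrier V" for x
    using that assms(3) by (simp add: bij_betw_def inv_into_f_f)
  show ?thesis
  proof (rule linear_mapI)
    show "?g (x \<oplus>\<^bsub>W\<^esub> y) = ?g x \<oplus>\<^bsub>V\<^esub> ?g y" if "x \<in> carrier W" "y \<in> carrier W" for x y
      using gf[of "?g x \<oplus>\<^bsub>V\<^esub> ?g y"] that by (simp add: g linear_map_add[OF assms(2)])
    show "?g (c \<odot>\<^bsub>W\<^esub> x) = c \<odot>\<^bsub>V\<^esub> ?g x" if "c \<in> carrier K" "x \<in> carrier W" for c x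
      using gf[of "c \<odot>\<^bsub>V\<^esub> ?g x"] that by (simp add: g linear_map_smult[OF assms(2)])
  qed (rule g)
qed

text \<open>Relabelling of vertices along \<open>f\<close>, taken before multilinearity is imposed.
  On the free operad it acts by direct image of cosets.\<close>

definition tree_map ::
  "('a, 'k) ring_scheme \<Rightarrow> ('a, 'w) module \<Rightarrow> ('v \<Rightarrow> 'w) \<Rightarrow> nat \<Rightarrow> ('v tree \<Rightarrow> 'a) \<Rightarrow> 'w tree \<Rightarrow> 'a" where
  "tree_map K W f n = lin_ext K (free_module K (ltrees W n)) (\<lambda>t. basis_vec K (map_tree f t))"

lemma size1_map_tree: "size1 (map_tree f t) = size1 t"
  by (induction t) auto

lemma map_tree_ltrees:
  "f \<in> carrier V \<rightarrow> carrier W \<Longrightarrow> t \<in> ltrees V n \<Longrightarrow> map_tree f t \<in> ltrees W n"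
  by (auto simp: ltrees_def size1_map_tree tree.set_map)

lemma map_tree_graft: "map_tree f (graft s i t) = graft (map_tree f s) i (map_tree f t)"
  by (induction s arbitrary: i) (auto simp: size1_map_tree)

lemma tree_map_linear:
  assumes "cring K" and "f \<in> carrier V \<rightarrow> carrier W"
  shows "linear_map K (free_module K (ltrees V n)) (free_module K (ltrees W n)) (tree_map K W f n)"
  unfolding tree_map_def
  by (intro lin_ext_linear free_module_module basis_vec_closed map_tree_ltrees[OF assms(2)] assms(1))

lemma tree_map_basis:
  assumes "cring K" and "f \<in> carrier V \<rightarrow> carrier W" and "t \<in> ltrees V n"
  shows "tree_map K W f n (basis_vec K t) = basis_vec K (map_tree f t)"
  unfolding tree_map_def
  by (rule lin_ext_basis)
    (intro free_module_module basis_vec_closed map_tree_ltrees[OF assms(2,3)] assms(1))+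

lemma tree_map_inverse:
  assumes "cring K" and "f \<in> carrier V \<rightarrow> carrier W" and "g \<in> carrier W \<rightarrow> carrier V"
    and "\<And>x. x \<in> carrier V \<Longrightarrow> g (f x) = x" and "h \<in> carrier (free_module K (ltrees V n))"
  shows "tree_map K V g n (tree_map K W f n h) = h"
proof (rule free_linear_map_eqI[OF free_module_module[OF assms(1)] _ _ _ assms(5)])
  show "linear_map K (free_module K (ltrees V n)) (free_module K (ltrees V n))
      (\<lambda>h. tree_map K V g n (tree_map K W f n h))"
    by (rule linear_map_compose[OF tree_map_linear[OF assms(1,2)] tree_map_linear[OF assms(1,3)]])
  show "linear_map K (free_module K (ltrees V n)) (free_module K (ltrees V n)) (\<lambda>h. h)"
    by (rule linear_map_id)
  fix t assume t: "t \<in> ltrees V n"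
  have "map_tree g (map_tree f t) = map_tree id t"
    unfolding tree.map_comp using t assms(4) by (intro tree.map_cong) (auto simp: ltrees_def)
  then show "tree_map K V g n (tree_map K W f n (basis_vec K t)) = basis_vec K t"
    by (simp add: tree_map_basis[OF assms(1,2) t] tree.map_id
        tree_map_basis[OF assms(1,3) map_tree_ltrees[OF assms(2) t]])
qed

text \<open>Linearity of \<open>f\<close>, beyond its mapping carrier to carrier, enters here: a sum
  or multiple at a vertex must be relabelled by the corresponding sum or multiple.\<close>

lemma tree_map_null:
  assumes "module K V" and "module K W" and "linear_map K V W f" and "x \<in> multilinear_null K V n"
  shows "tree_map K W f n x \<in> multilinear_null K W n"
proof -
  interpret V: module K V by fact
  note cr = V.R.is_cring
  have f: "f \<in> carrier V \<rightarrow> carrier W" using assms(3) by (simp add: linear_map_def)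
  show ?thesis
  proof (rule multilinear_null_map[OF assms(1) free_module_module[OF cr] tree_map_linear[OF cr f]
        multilinear_null_submodule[OF assms(2)] _ _ assms(4)])
    let ?F = "free_module K (ltrees W n)"
    fix t t1 t2 assume t: "t1 \<in> ltrees V n" "t2 \<in> ltrees V n" "add_at V t t1 t2"
    show "tree_map K W f n (basis_vec K t) \<ominus>\<^bsub>?F\<^esub> tree_map K W f n (basis_vec K t1)
      \<ominus>\<^bsub>?F\<^esub> tree_map K W f n (basis_vec K t2) \<in> multilinear_null K W n"
      unfolding tree_map_basis[OF cr f add_at_ltrees[OF assms(1) t(3,1,2)]]
        tree_map_basis[OF cr f t(1)] tree_map_basis[OF cr f t(2)]
      using t by (intro multilinear_null_add_at map_tree_ltrees[OF f] add_at_map_tree[OF assms(3)])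
        (auto simp: ltrees_def)
  next
    let ?F = "free_module K (ltrees W n)"
    fix c t t' assume t: "c \<in> carrier K" "t' \<in> ltrees V n" "scale_at V c t t'"
    show "tree_map K W f n (basis_vec K t) \<ominus>\<^bsub>?F\<^esub> c \<odot>\<^bsub>?F\<^esub> tree_map K W f n (basis_vec K t')
      \<in> multilinear_null K W n"
      unfolding tree_map_basis[OF cr f scale_at_ltrees[OF assms(1) t(3,1,2)]]
        tree_map_basis[OF cr f t(2)]
      using t by (intro multilinear_null_scale_at map_tree_ltrees[OF f] scale_at_map_tree[OF assms(3)])
        (auto simp: ltrees_def)
  qed
qed

lemma free_operad_iso:
  assumes "field K" and "module K V" and "module K W" and "linear_map K V W f"
    and "bij_betw f (carrier V) (carrier W)"
  shows "ns_operad_iso K (free_operad K V) (free_operad K W) (\<lambda>n A. tree_map K W f n ` A)"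
    and "\<And>n t. t \<in> ltrees V n \<Longrightarrow> tree_map K W f n ` tree_elem K V t = tree_elem K W (map_tree f t)"
proof -
  interpret V: module K V by fact
  note cr = V.R.is_cring
  let ?g = "inv_into (carrier V) f"
  let ?F = "\<lambda>n. free_module K (ltrees V n)" and ?G = "\<lambda>n. free_module K (ltrees W n)"
  have lin_g: "linear_map K W V ?g" by (rule linear_map_inv_into[OF assms(2,4,5)])
  have f: "f \<in> carrier V \<rightarrow> carrier W" and g: "?g \<in> carrier W \<rightarrow> carrier V"
    using assms(4) lin_g by (simp_all add: linear_map_def)
  have gf: "?g (f x) = x" if "x \<in> carrier V" for x
    using that assms(5) by (simp add: bij_betw_def inv_into_f_f)
  have fg: "f (?g x) = x" if "x \<in> carrier W" for x
    using that assms(5) by (simp add: bij_betw_def f_inv_into_f)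
  note lin = tree_map_linear[OF cr f] and lin' = tree_map_linear[OF cr g]
  note inv = tree_map_inverse[OF cr f g gf] tree_map_inverse[OF cr g f fg]
  note left = tree_circ_linear_left[OF cr] and right = tree_circ_linear_right[OF cr]
  note basis = basis_vec_closed[OF cr]
  have iso: "ns_operad_iso K (tree_operad K V) (tree_operad K W) (tree_map K W f)"
    unfolding ns_operad_iso_def tree_operad_simps
  proof (intro conjI allI ballI impI)
    show "ns_operad K (tree_operad K V)" "ns_operad K (tree_operad K W)"
      by (rule tree_operad_ns_operad[OF assms(1)])+
    show "linear_map K (?F n) (?G n) (tree_map K W f n)" for n by (rule lin)
    show "bij_betw (tree_map K W f n) (carrier (?F n)) (carrier (?G n))" for n
      by (rule bij_betw_byWitness[where f' = "tree_map K V ?g n"])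
        (auto simp: inv linear_map_closed[OF lin] linear_map_closed[OF lin'])
    have "\<langle>\<rangle> \<in> ltrees V 1" by (simp add: ltrees_def)
    then show "tree_map K W f 1 (basis_vec K \<langle>\<rangle>) = basis_vec K \<langle>\<rangle>"
      using tree_map_basis[OF cr f] by fastforce
    fix m n i x y
    assume x: "x \<in> carrier (?F m)" and y: "y \<in> carrier (?F n)" and "1 \<le> i \<and> i \<le> m"
    then have i: "1 \<le> i" "i \<le> m" by auto
    show "tree_map K W f (m + n - 1) (circ (tree_operad K V) m i n x y) =
        circ (tree_operad K W) m i n (tree_map K W f m x) (tree_map K W f n y)"
    proof (rule free_bilinear_eqI[OF free_module_module[OF cr] _ _ _ _ _ x y])
      fix s t assume s: "s \<in> ltrees V m" and t: "t \<in> ltrees V n"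
      show "tree_map K W f (m + n - 1) (circ (tree_operad K V) m i n (basis_vec K s) (basis_vec K t)) =
          circ (tree_operad K W) m i n (tree_map K W f m (basis_vec K s)) (tree_map K W f n (basis_vec K t))"
        by (simp only: tree_circ_basis[OF cr i s t] tree_map_basis[OF cr f s] tree_map_basis[OF cr f t]
            tree_map_basis[OF cr f graft_ltrees[OF s t i]] map_tree_graft
            tree_circ_basis[OF cr i map_tree_ltrees[OF f s] map_tree_ltrees[OF f t]])
    next
      fix y assume y: "y \<in> carrier (?F n)"
      show "linear_map K (?F m) (?G (m + n - 1))
          (\<lambda>x. tree_map K W f (m + n - 1) (circ (tree_operad K V) m i n x y))"
        by (rule linear_map_compose[OF left[OF i y] lin])
      show "linear_map K (?F m) (?G (m + n - 1))
          (\<lambda>x. circ (tree_operad K W) m i n (tree_map K W f m x) (tree_map K W f n y))"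
        by (rule linear_map_compose[OF lin left[OF i linear_map_closed[OF lin y]]])
    next
      fix x assume x: "x \<in> carrier (?F m)"
      show "linear_map K (?F n) (?G (m + n - 1))
          (\<lambda>y. tree_map K W f (m + n - 1) (circ (tree_operad K V) m i n x y))"
        by (rule linear_map_compose[OF right[OF i x] lin])
      show "linear_map K (?F n) (?G (m + n - 1))
          (\<lambda>y. circ (tree_operad K W) m i n (tree_map K W f m x) (tree_map K W f n y))"
        by (rule linear_map_compose[OF lin right[OF i linear_map_closed[OF lin x]]])
    qed
  qed
  \<comment> \<open>Equality of the two null spaces is required for the passage to quotients. The
    reverse inclusion relabels along the inverse of \<open>f\<close>, which is linear as
    well.\<close>
  have null: "tree_map K W f n ` multilinear_null K V n = multilinear_null K W n" for n
  proof
    show "tree_map K W f n ` multilinear_null K V n \<subseteq> multilinear_null K W n"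
      using tree_map_null[OF assms(2,3,4)] by blast
    show "multilinear_null K W n \<subseteq> tree_map K W f n ` multilinear_null K V n"
    proof
      fix x assume x: "x \<in> multilinear_null K W n"
      then have "x \<in> carrier (?G n)" using submodule_subset[OF multilinear_null_submodule[OF assms(3)]] by blast
      then have "x = tree_map K W f n (tree_map K V ?g n x)" by (simp add: inv)
      then show "x \<in> tree_map K W f n ` multilinear_null K V n"
        using tree_map_null[OF assms(3,2) lin_g x] by blast
    qed
  qed
  show "ns_operad_iso K (free_operad K V) (free_operad K W) (\<lambda>n A. tree_map K W f n ` A)"
    unfolding free_operad_def
    by (intro ns_operad_iso_quot[OF iso] multilinear_null_ideal assms null)
  show "tree_map K W f n ` tree_elem K V t = tree_elem K W (map_tree f t)" if t: "t \<in> ltrees V n" for n t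
    unfolding tree_elem_coset[OF t] tree_elem_coset[OF map_tree_ltrees[OF f t]] null[symmetric]
      tree_map_basis[OF cr f t, symmetric]
    by (rule linear_map_image_coset[OF free_module_module[OF cr] lin
          multilinear_null_submodule[OF assms(2)] basis[OF t]])
qed

section \<open>Tensor products\<close>

lemma bilinear_rels_cases:
  assumes "x \<in> bilinear_rels K V W"
  obtains
    (add_left) v v' w where "v \<in> carrier V" "v' \<in> carrier V" "w \<in> carrier W"
      "x = basis_vec K (v \<oplus>\<^bsub>V\<^esub> v', w) \<ominus>\<^bsub>free_module K (carrier V \<times> carrier W)\<^esub> basis_vec K (v, w)
        \<ominus>\<^bsub>free_module K (carrier V \<times> carrier W)\<^esub> basis_vec K (v', w)"
  | (add_right) v w w' where "v \<in> carrier V" "w \<in> carrier W" "w' \<in> carrier W"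
      "x = basis_vec K (v, w \<oplus>\<^bsub>W\<^esub> w') \<ominus>\<^bsub>free_module K (carrier V \<times> carrier W)\<^esub> basis_vec K (v, w)
        \<ominus>\<^bsub>free_module K (carrier V \<times> carrier W)\<^esub> basis_vec K (v, w')"
  | (smult_left) c v w where "c \<in> carrier K" "v \<in> carrier V" "w \<in> carrier W"
      "x = basis_vec K (c \<odot>\<^bsub>V\<^esub> v, w) \<ominus>\<^bsub>free_module K (carrier V \<times> carrier W)\<^esub>
        c \<odot>\<^bsub>free_module K (carrier V \<times> carrier W)\<^esub> basis_vec K (v, w)"
  | (smult_right) c v w where "c \<in> carrier K" "v \<in> carrier V" "w \<in> carrier W"
      "x = basis_vec K (v, c \<odot>\<^bsub>W\<^esub> w) \<ominus>\<^bsub>free_module K (carrier V \<times> carrier W)\<^esub>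
        c \<odot>\<^bsub>free_module K (carrier V \<times> carrier W)\<^esub> basis_vec K (v, w)"
  using assms unfolding bilinear_rels_def Let_def by blast

lemma bilinear_rels_subset:
  assumes "module K V" and "module K W"
  shows "bilinear_rels K V W \<subseteq> carrier (free_module K (carrier V \<times> carrier W))"
proof
  interpret V: module K V by fact
  interpret W: module K W by fact
  interpret F: module K "free_module K (carrier V \<times> carrier W)" by (rule free_module_module[OF V.R.is_cring])
  fix x assume "x \<in> bilinear_rels K V W"
  then show "x \<in> carrier (free_module K (carrier V \<times> carrier W))"
    by (cases rule: bilinear_rels_cases)
      (simp_all add: F.minus_closed basis_vec_closed[OF V.R.is_cring])
qed

lemma tensor_null_submodule:
  assumes "module K V" and "module K W"
  shows "submodule (tensor_null K V W) K (free_module K (carrier V \<times> carrier W))"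
  unfolding tensor_null_def using assms
  by (intro linear_span_submodule bilinear_rels_subset free_module_module) (auto simp: module_def)

lemma tensor_module_module: "module K V \<Longrightarrow> module K W \<Longrightarrow> module K (tensor_module K V W)"
  unfolding tensor_module_def
  by (intro quot_module_module tensor_null_submodule free_module_module) (auto simp: module_def)

lemma pure_tensor_closed:
  assumes "module K V" and "v \<in> carrier V" and "w \<in> carrier W"
  shows "pure_tensor K V W v w \<in> carrier (tensor_module K V W)"
  unfolding tensor_module_def pure_tensor_def
  by (intro quot_carrierI basis_vec_closed) (use assms in \<open>auto simp: module_def\<close>)

lemma bilinear_rels_null: "x \<in> bilinear_rels K V W \<Longrightarrow> x \<in> tensor_null K V W"
  unfolding tensor_null_def by (rule subsetD[OF linear_span_superset])

lemma pure_tensor_linear_left: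
  assumes "module K V" and "module K W" and "w \<in> carrier W"
  shows "linear_map K V (tensor_module K V W) (\<lambda>v. pure_tensor K V W v w)"
proof (rule linear_mapI)
  interpret V: module K V by fact
  interpret W: module K W by fact
  note F = free_module_module[OF V.R.is_cring, of "carrier V \<times> carrier W"]
  note null = tensor_null_submodule[OF assms(1,2)]
  note basis = basis_vec_closed[OF V.R.is_cring]
  show "pure_tensor K V W v w \<in> carrier (tensor_module K V W)" if "v \<in> carrier V" for v
    using that assms(3) by (rule pure_tensor_closed[OF assms(1)])
  show "pure_tensor K V W (v \<oplus>\<^bsub>V\<^esub> v') w =
      pure_tensor K V W v w \<oplus>\<^bsub>tensor_module K V W\<^esub> pure_tensor K V W v' w"
    if "v \<in> carrier V" "v' \<in> carrier V" for v v'
    unfolding pure_tensor_def tensor_module_def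
    by (rule quot_add_eqI[OF F null bilinear_rels_null])
      (use that assms(3) in \<open>auto simp: bilinear_rels_def Let_def intro!: basis\<close>)
  show "pure_tensor K V W (c \<odot>\<^bsub>V\<^esub> v) w = c \<odot>\<^bsub>tensor_module K V W\<^esub> pure_tensor K V W v w"
    if "c \<in> carrier K" "v \<in> carrier V" for c v
    unfolding pure_tensor_def tensor_module_def
    by (rule quot_smult_eqI[OF F null bilinear_rels_null])
      (use that assms(3) in \<open>auto simp: bilinear_rels_def Let_def intro!: basis\<close>)
qed

lemma pure_tensor_linear_right:
  assumes "module K V" and "module K W" and "v \<in> carrier V"
  shows "linear_map K W (tensor_module K V W) (pure_tensor K V W v)"
proof (rule linear_mapI)
  interpret V: module K V by fact
  interpret W: module K W by fact
  note F = free_module_module[OF V.R.is_cring, of "carrier V \<times> carrier W"]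
  note null = tensor_null_submodule[OF assms(1,2)]
  note basis = basis_vec_closed[OF V.R.is_cring]
  show "pure_tensor K V W v w \<in> carrier (tensor_module K V W)" if "w \<in> carrier W" for w
    using assms(3) that by (rule pure_tensor_closed[OF assms(1)])
  show "pure_tensor K V W v (w \<oplus>\<^bsub>W\<^esub> w') =
      pure_tensor K V W v w \<oplus>\<^bsub>tensor_module K V W\<^esub> pure_tensor K V W v w'"
    if "w \<in> carrier W" "w' \<in> carrier W" for w w'
    unfolding pure_tensor_def tensor_module_def
    by (rule quot_add_eqI[OF F null bilinear_rels_null])
      (use that assms(3) in \<open>auto simp: bilinear_rels_def Let_def intro!: basis\<close>)
  show "pure_tensor K V W v (c \<odot>\<^bsub>W\<^esub> w) = c \<odot>\<^bsub>tensor_module K V W\<^esub> pure_tensor K V W v w"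
    if "c \<in> carrier K" "w \<in> carrier W" for c w
    unfolding pure_tensor_def tensor_module_def
    by (rule quot_smult_eqI[OF F null bilinear_rels_null])
      (use that assms(3) in \<open>auto simp: bilinear_rels_def Let_def intro!: basis\<close>)
qed

text \<open>The universal property of the tensor product. Linearity in the first and in the second
  variable disposes of two families of relators each.\<close>

lemma tensor_lift:
  assumes "module K V" and "module K W" and "module K M"
    and "\<And>w. w \<in> carrier W \<Longrightarrow> linear_map K V M (\<lambda>v. \<phi> (v, w))"
    and "\<And>v. v \<in> carrier V \<Longrightarrow> linear_map K W M (\<lambda>w. \<phi> (v, w))"
  shows tensor_lift_linear: "linear_map K (tensor_module K V W) M (quot_lift K M \<phi>)"
    and tensor_lift_pure: "\<And>v w. v \<in> carrier V \<Longrightarrow> w \<in> carrier W \<Longrightarrow>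
      quot_lift K M \<phi> (pure_tensor K V W v w) = \<phi> (v, w)"
proof -
  interpret V: module K V by fact
  interpret W: module K W by fact
  interpret M: module K M by fact
  let ?X = "carrier V \<times> carrier W"
  let ?F = "free_module K ?X"
  interpret F: module K ?F by (rule free_module_module[OF V.R.is_cring])
  note basis = basis_vec_closed[OF V.R.is_cring]
  have \<phi>: "\<phi> x \<in> carrier M" if "x \<in> ?X" for x
    using that linear_map_closed[OF assms(4)] by auto
  note lin = lin_ext_linear[OF assms(3) \<phi>]
  have ext: "lin_ext K M \<phi> (basis_vec K x) = \<phi> x" if "x \<in> ?X" for x
    using lin_ext_basis[OF assms(3), of \<phi>] \<phi>[OF that] by blast
  note lins = linear_map_diff[OF F.module_axioms assms(3) lin] linear_map_smult[OF lin]
  have cancel: "a \<oplus>\<^bsub>M\<^esub> b \<ominus>\<^bsub>M\<^esub> a \<ominus>\<^bsub>M\<^esub> b = \<zero>\<^bsub>M\<^esub>" if "a \<in> carrier M" "b \<in> carrier M" for a b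
    using that by (simp add: M.minus_eq M.a_comm[of a] M.a_assoc M.r_neg)
  have cancel': "a \<ominus>\<^bsub>M\<^esub> a = \<zero>\<^bsub>M\<^esub>" if "a \<in> carrier M" for a
    using that by (simp add: M.minus_eq M.r_neg)
  note R = bilinear_rels_subset[OF assms(1,2)]
  have zero: "lin_ext K M \<phi> x = \<zero>\<^bsub>M\<^esub>" if "x \<in> bilinear_rels K V W" for x
    using that
  proof (cases rule: bilinear_rels_cases)
    case (add_left v v' w)
    then show ?thesis
      by (simp add: lins ext basis F.minus_closed \<phi> cancel linear_map_add[OF assms(4)])
  next
    case (add_right v w w')
    then show ?thesis
      by (simp add: lins ext basis F.minus_closed \<phi> cancel linear_map_add[OF assms(5)])
  next
    case (smult_left c v w)
    then show ?thesis
      by (simp add: lins ext basis F.minus_closed \<phi> cancel' linear_map_smult[OF assms(4)])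
  next
    case (smult_right c v w)
    then show ?thesis
      by (simp add: lins ext basis F.minus_closed \<phi> cancel' linear_map_smult[OF assms(5)])
  qed
  show "linear_map K (tensor_module K V W) M (quot_lift K M \<phi>)"
    unfolding tensor_module_def tensor_null_def by (rule quot_lift_linear[OF assms(3) \<phi> R zero])
  show "quot_lift K M \<phi> (pure_tensor K V W v w) = \<phi> (v, w)" if "v \<in> carrier V" "w \<in> carrier W" for v w
    unfolding pure_tensor_def tensor_null_def
    using quot_lift_coset[OF assms(3) \<phi> R zero basis[of "(v, w)"]] ext[of "(v, w)"] that by simp
qed

lemma tensor_linear_map_eqI:
  assumes "module K V" and "module K W" and "module K M"
    and "linear_map K (tensor_module K V W) M f" and "linear_map K (tensor_module K V W) M g"
    and "\<And>v w. v \<in> carrier V \<Longrightarrow> w \<in> carrier W \<Longrightarrow> f (pure_tensor K V W v w) = g (pure_tensor K V W v w)"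
    and "h \<in> carrier (tensor_module K V W)"
  shows "f h = g h"
proof (rule quot_free_linear_map_eqI[OF assms(3) tensor_null_submodule[OF assms(1,2)]
        assms(4,5)[unfolded tensor_module_def] _ assms(7)[unfolded tensor_module_def]])
  fix x assume "x \<in> carrier V \<times> carrier W"
  then show "f (tensor_null K V W +>\<^bsub>free_module K (carrier V \<times> carrier W)\<^esub> basis_vec K x) =
      g (tensor_null K V W +>\<^bsub>free_module K (carrier V \<times> carrier W)\<^esub> basis_vec K x)"
    using assms(6)[unfolded pure_tensor_def] by (cases x) simp
qed

text \<open>The bisuccessor takes the span of \<prec> and \<succ> as the second tensor factor of its
  generators, while in the product of \<open>Dend\<close> with \<open>P\<close> it is the first.
  This exchange is the whole difference between the two spaces of generators.\<close>

definition tensor_swap ::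
  "('a, 'k) ring_scheme \<Rightarrow> ('a, 'v) module \<Rightarrow> ('a, 'w) module \<Rightarrow>
   ('v \<times> 'w \<Rightarrow> 'a) set \<Rightarrow> ('w \<times> 'v \<Rightarrow> 'a) set" where
  "tensor_swap K V W = quot_lift K (tensor_module K W V) (\<lambda>(v, w). pure_tensor K W V w v)"

lemma
  assumes "module K V" and "module K W"
  shows tensor_swap_linear: "linear_map K (tensor_module K V W) (tensor_module K W V) (tensor_swap K V W)"
    and tensor_swap_pure: "v \<in> carrier V \<Longrightarrow> w \<in> carrier W \<Longrightarrow>
      tensor_swap K V W (pure_tensor K V W v w) = pure_tensor K W V w v"
proof -
  have "linear_map K V (tensor_module K W V) (\<lambda>v. (\<lambda>(v, w). pure_tensor K W V w v) (v, w))"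
    if "w \<in> carrier W" for w
    using pure_tensor_linear_right[OF assms(2,1) that] by simp
  moreover have "linear_map K W (tensor_module K W V) (\<lambda>w. (\<lambda>(v, w). pure_tensor K W V w v) (v, w))"
    if "v \<in> carrier V" for v
    using pure_tensor_linear_left[OF assms(2,1) that] by simp
  ultimately have
    "linear_map K (tensor_module K V W) (tensor_module K W V) (tensor_swap K V W) \<and>
     (\<forall>v\<in>carrier V. \<forall>w\<in>carrier W. tensor_swap K V W (pure_tensor K V W v w) = pure_tensor K W V w v)"
    unfolding tensor_swap_def
    using tensor_lift[OF assms tensor_module_module[OF assms(2,1)], of "\<lambda>(v, w). pure_tensor K W V w v"]
    by simp
  then show "linear_map K (tensor_module K V W) (tensor_module K W V) (tensor_swap K V W)"
    and "v \<in> carrier V \<Longrightarrow> w \<in> carrier W \<Longrightarrow>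
      tensor_swap K V W (pure_tensor K V W v w) = pure_tensor K W V w v"
    by auto
qed

lemma tensor_swap_swap:
  assumes "module K V" and "module K W" and "h \<in> carrier (tensor_module K V W)"
  shows "tensor_swap K W V (tensor_swap K V W h) = h"
  by (rule tensor_linear_map_eqI[OF assms(1,2) tensor_module_module[OF assms(1,2)]
        linear_map_compose[OF tensor_swap_linear[OF assms(1,2)] tensor_swap_linear[OF assms(2,1)]]
        linear_map_id _ assms(3)])
    (simp add: tensor_swap_pure assms)

lemma tensor_swap_bij:
  assumes "module K V" and "module K W"
  shows "bij_betw (tensor_swap K V W) (carrier (tensor_module K V W)) (carrier (tensor_module K W V))"
  by (rule bij_betw_byWitness[where f' = "tensor_swap K W V"])
    (auto simp: tensor_swap_swap assms linear_map_closed[OF tensor_swap_linear[OF assms]]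
      linear_map_closed[OF tensor_swap_linear[OF assms(2,1)]])

section \<open>The bisuccessor and the black square product\<close>

lemma dir_module_module: "cring K \<Longrightarrow> module K (dir_module K)"
  unfolding dir_module_def by (rule free_module_module)

lemma dir_basis_closed: "cring K \<Longrightarrow> basis_vec K d \<in> carrier (dir_module K)"
  unfolding dir_module_def by (rule basis_vec_closed) auto

lemma bsu_module_module:
  assumes "module K V"
  shows "module K (bsu_module K V)"
  unfolding bsu_module_def using assms
  by (intro tensor_module_module dir_module_module) (auto simp: module_def)

lemma lab_linear:
  assumes "module K V"
  shows "linear_map K V (bsu_module K V) (lab K V d)"
  unfolding bsu_module_def lab_def using assms
  by (intro pure_tensor_linear_left dir_module_module dir_basis_closed) (auto simp: module_def)

lemma lab_star_linear:
  assumes "module K V"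
  shows "linear_map K V (bsu_module K V) (lab_star K V)"
  unfolding lab_star_def[abs_def]
  by (intro linear_map_plus bsu_module_module lab_linear assms)

lemma size1_bsu_tree: "size1 (bsu_tree K V x t) = size1 t"
  by (induction t arbitrary: x) (auto simp: size1_map_tree)

lemma bsu_tree_ltrees:
  assumes "module K V" and "t \<in> ltrees V n"
  shows "bsu_tree K V x t \<in> ltrees (bsu_module K V) n"
proof -
  note [simp] = linear_map_closed[OF lab_linear[OF assms(1)]] linear_map_closed[OF lab_star_linear[OF assms(1)]]
  have "set_tree t \<subseteq> carrier V \<Longrightarrow> set_tree (bsu_tree K V x t) \<subseteq> carrier (bsu_module K V)"
    by (induction t arbitrary: x) (auto simp: tree.set_map)
  then show ?thesis using assms(2) by (simp add: ltrees_def size1_bsu_tree)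
qed

text \<open>Each label is used once, through the linear \<open>lab\<close> or
  \<open>lab_star\<close>, and which of these applies depends only on the shape of the tree. When
  the altered vertex lies in the left subtree, the equality of sizes guarantees that the path turns
  the same way in all three trees.\<close>

lemma bsu_tree_add_at:
  assumes "module K V" and "add_at V t t1 t2" and "set_tree t1 \<subseteq> carrier V" and "set_tree t2 \<subseteq> carrier V"
  shows "add_at (bsu_module K V) (bsu_tree K V x t) (bsu_tree K V x t1) (bsu_tree K V x t2)"
  using assms(2-4)
proof (induction arbitrary: x rule: add_at.induct)
  case (1 l v w r)
  then show ?case
    using add_at.intros(1)[of "bsu_module K V"] by (simp add: linear_map_add[OF lab_linear[OF assms(1)]])
next
  case (2 l l1 l2 v r)
  then show ?case
    using add_at_size1[OF 2(1)] by (auto intro!: add_at.intros add_at_map_tree[OF lab_star_linear[OF assms(1)]])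
next
  case (3 r r1 r2 l v)
  then show ?case
    by (auto intro!: add_at.intros add_at_map_tree[OF lab_star_linear[OF assms(1)]])
qed

lemma bsu_tree_scale_at:
  assumes "module K V" and "scale_at V c t t'" and "c \<in> carrier K" and "set_tree t' \<subseteq> carrier V"
  shows "scale_at (bsu_module K V) c (bsu_tree K V x t) (bsu_tree K V x t')"
  using assms(2,4)
proof (induction arbitrary: x rule: scale_at.induct)
  case (1 l v r)
  then show ?case
    using scale_at.intros(1)[of "bsu_module K V"]
    by (simp add: linear_map_smult[OF lab_linear[OF assms(1)] assms(3)])
next
  case (2 l l' v r)
  then show ?case
    using scale_at_size1[OF 2(1)]
    by (auto intro!: scale_at.intros scale_at_map_tree[OF lab_star_linear[OF assms(1)]] assms(3))
next
  case (3 r r' l v)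
  then show ?case
    by (auto intro!: scale_at.intros scale_at_map_tree[OF lab_star_linear[OF assms(1)]] assms(3))
qed

text \<open>Because \<open>bsu_tree\<close> carries an altered vertex to an altered vertex, the
  assignment on trees is multilinear and the lift defining \<open>bsu_map\<close> takes its
  prescribed values.\<close>

lemma
  assumes "module K V"
  shows bsu_map_linear: "linear_map K (arity (free_operad K V) n)
      (arity (free_operad K (bsu_module K V)) n) (bsu_map K V n x)"
    and bsu_map_tree: "t \<in> ltrees V n \<Longrightarrow>
      bsu_map K V n x (tree_elem K V t) = tree_elem K (bsu_module K V) (bsu_tree K V x t)"
proof -
  note B = bsu_module_module[OF assms]
  have "tree_multilinear K V n (arity (free_operad K (bsu_module K V)) n)
      (\<lambda>\<tau>. tree_elem K (bsu_module K V) (bsu_tree K V x \<tau>))"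
    unfolding tree_multilinear_def
    by (intro conjI ballI allI impI tree_elem_closed[OF B] tree_elem_add_at[OF B]
        tree_elem_scale_at[OF B] bsu_tree_ltrees[OF assms] bsu_tree_add_at[OF assms]
        bsu_tree_scale_at[OF assms]) (auto simp: ltrees_def)
  note lift = free_operad_lift[OF assms free_operad_module[OF B] this, folded bsu_map_def]
  show "linear_map K (arity (free_operad K V) n)
      (arity (free_operad K (bsu_module K V)) n) (bsu_map K V n x)"
    by (rule lift)
  show "t \<in> ltrees V n \<Longrightarrow>
      bsu_map K V n x (tree_elem K V t) = tree_elem K (bsu_module K V) (bsu_tree K V x t)"
    by (rule lift)
qed

section \<open>Trees with three leaves\<close>

lemma circ_tree_ltrees:
  "\<omega> \<in> carrier V \<Longrightarrow> \<nu> \<in> carrier V \<Longrightarrow> circ1_tree \<omega> \<nu> \<in> ltrees V 3"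
  "\<omega> \<in> carrier V \<Longrightarrow> \<nu> \<in> carrier V \<Longrightarrow> circ2_tree \<omega> \<nu> \<in> ltrees V 3"
  by (auto simp: ltrees_def circ1_tree_def circ2_tree_def)

lemma size1_eq_1: "size1 t = Suc 0 \<longleftrightarrow> t = \<langle>\<rangle>"
  using size1_pos by (cases t) (auto simp: add_is_1)

lemma size1_eq_2: "size1 t = 2 \<longleftrightarrow> (\<exists>v. t = \<langle>\<langle>\<rangle>, v, \<langle>\<rangle>\<rangle>)"
proof (cases t)
  case (Node l v r)
  have "size1 l + size1 r = 2 \<longleftrightarrow> size1 l = Suc 0 \<and> size1 r = Suc 0"
    using size1_pos[of l] size1_pos[of r] by linarith
  then show ?thesis using Node by (auto simp: size1_eq_1)
qed simp

text \<open>The leaves are divided by the root as 2 + 1 or 1 + 2, which leaves only the left and the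
  right comb.\<close>

lemma ltrees_3_cases:
  assumes "t \<in> ltrees V 3"
  obtains (circ1) \<omega> \<nu> where "\<omega> \<in> carrier V" "\<nu> \<in> carrier V" "t = circ1_tree \<omega> \<nu>"
    | (circ2) \<omega> \<nu> where "\<omega> \<in> carrier V" "\<nu> \<in> carrier V" "t = circ2_tree \<omega> \<nu>"
proof (cases t)
  case Leaf
  then show ?thesis using assms by (simp add: ltrees_def)
next
  case (Node l \<omega> r)
  have "size1 l + size1 r = 3" using assms Node by (simp add: ltrees_def)
  then consider "size1 l = 2" "size1 r = Suc 0" | "size1 l = Suc 0" "size1 r = 2"
    using size1_pos[of l] size1_pos[of r] by linarith
  then show ?thesis
    using that Node assms
    by cases (auto simp: size1_eq_1 size1_eq_2 circ1_tree_def circ2_tree_def ltrees_def)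
qed

text \<open>With two shapes of two vertices each, multilinearity amounts to four linearity
  conditions. These can be met by composing linear maps, without handling \<open>add_at\<close> and
  \<open>scale_at\<close> again.\<close>

lemma tree_multilinear_3I:
  assumes "module K V"
    and "\<And>\<nu>. \<nu> \<in> carrier V \<Longrightarrow> linear_map K V M (\<lambda>\<omega>. \<phi> (circ1_tree \<omega> \<nu>))"
    and "\<And>\<omega>. \<omega> \<in> carrier V \<Longrightarrow> linear_map K V M (\<lambda>\<nu>. \<phi> (circ1_tree \<omega> \<nu>))"
    and "\<And>\<nu>. \<nu> \<in> carrier V \<Longrightarrow> linear_map K V M (\<lambda>\<omega>. \<phi> (circ2_tree \<omega> \<nu>))"
    and "\<And>\<omega>. \<omega> \<in> carrier V \<Longrightarrow> linear_map K V M (\<lambda>\<nu>. \<phi> (circ2_tree \<omega> \<nu>))"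
  shows "tree_multilinear K V 3 M \<phi>"
  unfolding tree_multilinear_def
proof (intro conjI ballI allI impI)
  note lin1 = assms(2,3)[unfolded circ1_tree_def] and lin2 = assms(4,5)[unfolded circ2_tree_def]
  show "\<phi> t \<in> carrier M" if "t \<in> ltrees V 3" for t
    using that linear_map_closed[OF assms(2)] linear_map_closed[OF assms(4)]
    by (cases rule: ltrees_3_cases) auto
  show "\<phi> t = \<phi> t1 \<oplus>\<^bsub>M\<^esub> \<phi> t2" if t: "t1 \<in> ltrees V 3" "t2 \<in> ltrees V 3" "add_at V t t1 t2" for t t1 t2
    using t(1)
  proof (cases rule: ltrees_3_cases)
    case (circ1 \<omega> \<nu>)
    with t(3,2) show ?thesis
      by (auto elim!: add_at.cases simp: circ1_tree_def ltrees_def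
          linear_map_add[OF lin1(1)] linear_map_add[OF lin1(2)])
  next
    case (circ2 \<omega> \<nu>)
    with t(3,2) show ?thesis
      by (auto elim!: add_at.cases simp: circ2_tree_def ltrees_def
          linear_map_add[OF lin2(1)] linear_map_add[OF lin2(2)])
  qed
  show "\<phi> t = c \<odot>\<^bsub>M\<^esub> \<phi> t'" if t: "c \<in> carrier K" "t' \<in> ltrees V 3" "scale_at V c t t'" for c t t'
    using t(2)
  proof (cases rule: ltrees_3_cases)
    case (circ1 \<omega> \<nu>)
    with t(3,1) show ?thesis
      by (auto elim!: scale_at.cases simp: circ1_tree_def
          linear_map_smult[OF lin1(1)] linear_map_smult[OF lin1(2)])
  next
    case (circ2 \<omega> \<nu>)
    with t(3,1) show ?thesis
      by (auto elim!: scale_at.cases simp: circ2_tree_def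
          linear_map_smult[OF lin2(1)] linear_map_smult[OF lin2(2)])
  qed
qed

lemma
  assumes "module K V"
  shows tree_elem_circ1_left: "\<nu> \<in> carrier V \<Longrightarrow>
      linear_map K V (arity (free_operad K V) 3) (\<lambda>\<omega>. tree_elem K V (circ1_tree \<omega> \<nu>))"
    and tree_elem_circ1_right: "\<omega> \<in> carrier V \<Longrightarrow>
      linear_map K V (arity (free_operad K V) 3) (\<lambda>\<nu>. tree_elem K V (circ1_tree \<omega> \<nu>))"
    and tree_elem_circ2_left: "\<nu> \<in> carrier V \<Longrightarrow>
      linear_map K V (arity (free_operad K V) 3) (\<lambda>\<omega>. tree_elem K V (circ2_tree \<omega> \<nu>))"
    and tree_elem_circ2_right: "\<omega> \<in> carrier V \<Longrightarrow>
      linear_map K V (arity (free_operad K V) 3) (\<lambda>\<nu>. tree_elem K V (circ2_tree \<omega> \<nu>))"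
  by (intro linear_mapI tree_elem_closed[OF assms] tree_elem_add_at[OF assms]
      tree_elem_scale_at[OF assms] circ_tree_ltrees; assumption?;
      simp add: circ1_tree_def circ2_tree_def add_at.intros scale_at.intros)+

section \<open>Well-definedness of \<open>Psi\<close> and its values on trees\<close>

lemma psi_tree_simps:
  "psi_tree K V W (circ1_tree \<omega> \<nu>) (circ1_tree \<omega>' \<nu>') = tree_elem K (tensor_module K V W)
     (circ1_tree (pure_tensor K V W \<omega> \<omega>') (pure_tensor K V W \<nu> \<nu>'))"
  "psi_tree K V W (circ2_tree \<omega> \<nu>) (circ2_tree \<omega>' \<nu>') =
     \<ominus>\<^bsub>arity (free_operad K (tensor_module K V W)) 3\<^esub> tree_elem K (tensor_module K V W)
       (circ2_tree (pure_tensor K V W \<omega> \<omega>') (pure_tensor K V W \<nu> \<nu>'))"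
  "psi_tree K V W (circ1_tree \<omega> \<nu>) (circ2_tree \<omega>' \<nu>') = \<zero>\<^bsub>arity (free_operad K (tensor_module K V W)) 3\<^esub>"
  "psi_tree K V W (circ2_tree \<omega> \<nu>) (circ1_tree \<omega>' \<nu>') = \<zero>\<^bsub>arity (free_operad K (tensor_module K V W)) 3\<^esub>"
  by (simp_all add: circ1_tree_def circ2_tree_def)

lemma psi_tree_multilinear_right:
  assumes "module K V" and "module K W" and "\<sigma> \<in> ltrees V 3"
  shows "tree_multilinear K W 3 (arity (free_operad K (tensor_module K V W)) 3) (psi_tree K V W \<sigma>)"
proof -
  note U = tensor_module_module[OF assms(1,2)]
  note T = free_operad_module[OF U, of 3]
  note right = pure_tensor_linear_right[OF assms(1,2)]
  note pure = pure_tensor_closed[OF assms(1)]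
  show ?thesis using assms(3)
  proof (cases rule: ltrees_3_cases)
    case (circ1 \<omega> \<nu>)
    show ?thesis unfolding circ1(3)
      by (intro tree_multilinear_3I[OF assms(2)]; simp only: psi_tree_simps)
        (intro linear_map_const_zero[OF T]
          linear_map_compose[OF right[OF circ1(1)] tree_elem_circ1_left[OF U pure[OF circ1(2)]]]
          linear_map_compose[OF right[OF circ1(2)] tree_elem_circ1_right[OF U pure[OF circ1(1)]]];
          assumption)+
  next
    case (circ2 \<omega> \<nu>)
    show ?thesis unfolding circ2(3)
      by (intro tree_multilinear_3I[OF assms(2)]; simp only: psi_tree_simps)
        (intro linear_map_const_zero[OF T] linear_map_minus_fun[OF T]
          linear_map_compose[OF right[OF circ2(1)] tree_elem_circ2_left[OF U pure[OF circ2(2)]]]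
          linear_map_compose[OF right[OF circ2(2)] tree_elem_circ2_right[OF U pure[OF circ2(1)]]];
          assumption)+
  qed
qed

lemma psi_tree_multilinear_left:
  assumes "module K V" and "module K W" and "\<tau> \<in> ltrees W 3"
  shows "tree_multilinear K V 3 (arity (free_operad K (tensor_module K V W)) 3) (\<lambda>\<sigma>. psi_tree K V W \<sigma> \<tau>)"
proof -
  note U = tensor_module_module[OF assms(1,2)]
  note T = free_operad_module[OF U, of 3]
  note left = pure_tensor_linear_left[OF assms(1,2)]
  note pure = pure_tensor_closed[OF assms(1)]
  show ?thesis using assms(3)
  proof (cases rule: ltrees_3_cases)
    case (circ1 \<omega> \<nu>)
    show ?thesis unfolding circ1(3)
      by (intro tree_multilinear_3I[OF assms(1)]; simp only: psi_tree_simps)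
        (intro linear_map_const_zero[OF T]
          linear_map_compose[OF left[OF circ1(1)] tree_elem_circ1_left[OF U pure[OF _ circ1(2)]]]
          linear_map_compose[OF left[OF circ1(2)] tree_elem_circ1_right[OF U pure[OF _ circ1(1)]]];
          assumption)+
  next
    case (circ2 \<omega> \<nu>)
    show ?thesis unfolding circ2(3)
      by (intro tree_multilinear_3I[OF assms(1)]; simp only: psi_tree_simps)
        (intro linear_map_const_zero[OF T] linear_map_minus_fun[OF T]
          linear_map_compose[OF left[OF circ2(1)] tree_elem_circ2_left[OF U pure[OF _ circ2(2)]]]
          linear_map_compose[OF left[OF circ2(2)] tree_elem_circ2_right[OF U pure[OF _ circ2(1)]]];
          assumption)+
  qed
qed

text \<open>For fixed parameters both sides of an additivity or homogeneity claim are linear in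
  \<open>x\<close>, so it is enough to know linearity in the parameter when \<open>x\<close> is a
  tree.\<close>

lemma free_operad_linear_param:
  assumes "module K V" and "module K M" and "module K L"
    and "\<And>y. y \<in> carrier L \<Longrightarrow> linear_map K (arity (free_operad K V) n) M (f y)"
    and "\<And>t. t \<in> ltrees V n \<Longrightarrow> linear_map K L M (\<lambda>y. f y (tree_elem K V t))"
    and "x \<in> carrier (arity (free_operad K V) n)"
  shows "linear_map K L M (\<lambda>y. f y x)"
proof (rule linear_mapI)
  interpret L: module K L by fact
  show "f y x \<in> carrier M" if "y \<in> carrier L" for y
    using linear_map_closed[OF assms(4)[OF that] assms(6)] .
  show "f (y \<oplus>\<^bsub>L\<^esub> z) x = f y x \<oplus>\<^bsub>M\<^esub> f z x" if "y \<in> carrier L" "z \<in> carrier L" for y z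
    by (rule free_operad_linear_map_eqI[OF assms(1,2) assms(4)
          linear_map_plus[OF assms(2) assms(4)[OF that(1)] assms(4)[OF that(2)]] _ assms(6)])
      (simp_all add: that linear_map_add[OF assms(5)])
  show "f (c \<odot>\<^bsub>L\<^esub> y) x = c \<odot>\<^bsub>M\<^esub> f y x" if "c \<in> carrier K" "y \<in> carrier L" for c y
    by (rule free_operad_linear_map_eqI[OF assms(1,2) assms(4)
          linear_map_scale[OF assms(2) assms(4)[OF that(2)] that(1)] _ assms(6)])
      (simp_all add: that linear_map_smult[OF assms(5)])
qed

text \<open>\<open>Psi\<close> nests three lifts: over trees of the second factor, over trees of the
  first, and over pairs. Each lift is meaningful only if the preceding one depends multilinearly,
  and at the last stage bilinearly, on the next variable, so the three are treated from the inside
  out.\<close>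

lemma
  assumes "module K V" and "module K W"
  shows Psi_linear: "linear_map K (tensor_module K (arity (free_operad K V) 3) (arity (free_operad K W) 3))
      (arity (free_operad K (tensor_module K V W)) 3) (Psi K V W)"
    and Psi_tree: "\<sigma> \<in> ltrees V 3 \<Longrightarrow> \<tau> \<in> ltrees W 3 \<Longrightarrow>
      Psi K V W (pure_tensor K (arity (free_operad K V) 3) (arity (free_operad K W) 3)
        (tree_elem K V \<sigma>) (tree_elem K W \<tau>)) = psi_tree K V W \<sigma> \<tau>"
proof -
  let ?A = "arity (free_operad K V) 3" and ?B = "arity (free_operad K W) 3"
  let ?T = "arity (free_operad K (tensor_module K V W)) 3"
  note A = free_operad_module[OF assms(1), of 3] and B = free_operad_module[OF assms(2), of 3]
  note T = free_operad_module[OF tensor_module_module[OF assms], of 3]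
  let ?f = "\<lambda>\<sigma>. quot_lift K ?T (psi_tree K V W \<sigma>)"
  let ?g = "\<lambda>b. quot_lift K ?T (\<lambda>\<sigma>. ?f \<sigma> b)"
  note f_linear = free_operad_lift_linear[OF assms(2) T psi_tree_multilinear_right[OF assms]]
  note f_tree = free_operad_lift_tree[OF assms(2) T psi_tree_multilinear_right[OF assms]]
  note left = psi_tree_multilinear_left[OF assms, unfolded tree_multilinear_def]
  \<comment> \<open>The inner lift was evaluated at an arbitrary \<open>b\<close>. Its
    multilinearity in the first tree is an equation between linear maps of \<open>b\<close>, so it
    may be tested when \<open>b\<close> is a tree, where \<open>psi_tree\<close> itself is
    multilinear.\<close>
  have f_multilinear: "tree_multilinear K V 3 ?T (\<lambda>\<sigma>. ?f \<sigma> b)" if b: "b \<in> carrier ?B" for b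
    unfolding tree_multilinear_def
  proof (intro conjI ballI allI impI)
    show "?f t b \<in> carrier ?T" if "t \<in> ltrees V 3" for t
      by (rule linear_map_closed[OF f_linear[OF that] b])
    show "?f t b = ?f t1 b \<oplus>\<^bsub>?T\<^esub> ?f t2 b"
      if t: "t1 \<in> ltrees V 3" "t2 \<in> ltrees V 3" "add_at V t t1 t2" for t t1 t2
    proof (rule free_operad_linear_map_eqI[OF assms(2) T f_linear
          linear_map_plus[OF T f_linear[OF t(1)] f_linear[OF t(2)]] _ b])
      show t': "t \<in> ltrees V 3" by (rule add_at_ltrees[OF assms(1) t(3,1,2)])
      show "?f t (tree_elem K W s) = ?f t1 (tree_elem K W s) \<oplus>\<^bsub>?T\<^esub> ?f t2 (tree_elem K W s)"
        if s: "s \<in> ltrees W 3" for s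
        using left[OF s] t by (simp add: f_tree[OF _ s] t')
    qed
    show "?f t b = c \<odot>\<^bsub>?T\<^esub> ?f t' b"
      if t: "c \<in> carrier K" "t' \<in> ltrees V 3" "scale_at V c t t'" for c t t'
    proof (rule free_operad_linear_map_eqI[OF assms(2) T f_linear
          linear_map_scale[OF T f_linear[OF t(2)] t(1)] _ b])
      show t': "t \<in> ltrees V 3" by (rule scale_at_ltrees[OF assms(1) t(3,1,2)])
      show "?f t (tree_elem K W s) = c \<odot>\<^bsub>?T\<^esub> ?f t' (tree_elem K W s)" if s: "s \<in> ltrees W 3" for s
        using left[OF s] t by (simp add: f_tree[OF _ s] t')
    qed
  qed
  note g_linear = free_operad_lift_linear[OF assms(1) T f_multilinear]
  note g_tree = free_operad_lift_tree[OF assms(1) T f_multilinear]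
  \<comment> \<open>The missing half of bilinearity: the middle lift is linear in \<open>a\<close>
    by construction, but linearity in \<open>b\<close> has to be recovered by taking
    \<open>a\<close> to be a tree, where it reduces to the inner lift.\<close>
  have g_linear': "linear_map K ?B ?T (\<lambda>b. ?g b a)" if a: "a \<in> carrier ?A" for a
  proof (rule free_operad_linear_param[OF assms(1) T B g_linear _ a])
    fix t assume t: "t \<in> ltrees V 3"
    show "linear_map K ?B ?T (\<lambda>b. ?g b (tree_elem K V t))"
      by (rule linear_map_cong[OF f_linear[OF t] _ B]) (simp add: g_tree t)
  qed
  have Psi: "Psi K V W = quot_lift K ?T (\<lambda>(a, b). ?g b a)" by (simp add: Psi_def Let_def)
  have *: "linear_map K ?A ?T (\<lambda>a. (\<lambda>(a, b). ?g b a) (a, b))" if "b \<in> carrier ?B" for b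
    using g_linear[OF that] by simp
  have **: "linear_map K ?B ?T (\<lambda>b. (\<lambda>(a, b). ?g b a) (a, b))" if "a \<in> carrier ?A" for a
    using g_linear'[OF that] by simp
  show "linear_map K (tensor_module K ?A ?B) ?T (Psi K V W)"
    unfolding Psi by (rule tensor_lift_linear[OF A B T * **])
  show "Psi K V W (pure_tensor K ?A ?B (tree_elem K V \<sigma>) (tree_elem K W \<tau>)) = psi_tree K V W \<sigma> \<tau>"
    if "\<sigma> \<in> ltrees V 3" "\<tau> \<in> ltrees W 3"
    unfolding Psi
    using tensor_lift_pure[OF A B T * ** tree_elem_closed[OF assms(1) that(1)]
        tree_elem_closed[OF assms(2) that(2)]]
      g_tree[OF tree_elem_closed[OF assms(2) that(2)] that(1)] f_tree[OF that] by simp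
qed

text \<open>The associator, left comb minus right comb, relabelled along the path to leaf
  \<open>x\<close>, with the starred label already expanded into two summands. Every
  \<open>x\<close> other than 1 and 2 falls under the case of leaf 3.\<close>

definition dend_relator :: "('a, 'k) ring_scheme \<Rightarrow> nat \<Rightarrow> ((dir \<Rightarrow> 'a) tree \<Rightarrow> 'a) set" where
  "dend_relator K x =
     (let D = dir_module K; T = arity (free_operad K D) 3;
          c1 = (\<lambda>a b. tree_elem K D (circ1_tree (basis_vec K a) (basis_vec K b)));
          c2 = (\<lambda>a b. tree_elem K D (circ2_tree (basis_vec K a) (basis_vec K b)))
      in if x = 1 then c1 Prec Prec \<ominus>\<^bsub>T\<^esub> (c2 Prec Prec \<oplus>\<^bsub>T\<^esub> c2 Prec Succ)
         else if x = 2 then c1 Prec Succ \<ominus>\<^bsub>T\<^esub> c2 Succ Prec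
         else (c1 Succ Prec \<oplus>\<^bsub>T\<^esub> c1 Succ Succ) \<ominus>\<^bsub>T\<^esub> c2 Succ Succ)"

lemma Dend_simps:
  "gens (Dend K) = dir_module K"
  "rels (Dend K) = linear_span K (arity (free_operad K (dir_module K)) 3) (dend_relator K ` {1, 2, 3})"
  by (simp_all add: Dend_def dend_relator_def Let_def insert_commute)

lemma dend_relator_closed:
  assumes "cring K"
  shows "dend_relator K x \<in> carrier (arity (free_operad K (dir_module K)) 3)"
proof -
  note D = dir_module_module[OF assms]
  interpret T: module K "arity (free_operad K (dir_module K)) 3" by (rule free_operad_module[OF D])
  show ?thesis
    unfolding dend_relator_def Let_def
    by (simp add: tree_elem_closed[OF D] circ_tree_ltrees dir_basis_closed[OF assms])
qed

section \<open>Dendriform relators against the bisuccessor\<close>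

lemma lab_swap:
  assumes "module K V" and "\<omega> \<in> carrier V"
  shows "tensor_swap K V (dir_module K) (lab K V d \<omega>) =
      pure_tensor K (dir_module K) V (basis_vec K d) \<omega>"
    and "tensor_swap K V (dir_module K) (lab_star K V \<omega>) =
      pure_tensor K (dir_module K) V (basis_vec K Prec) \<omega> \<oplus>\<^bsub>tensor_module K (dir_module K) V\<^esub>
      pure_tensor K (dir_module K) V (basis_vec K Succ) \<omega>"
proof -
  interpret V: module K V by fact
  note D = dir_module_module[OF V.R.is_cring] and e = dir_basis_closed[OF V.R.is_cring]
  show lab: "tensor_swap K V (dir_module K) (lab K V d \<omega>) =
      pure_tensor K (dir_module K) V (basis_vec K d) \<omega>" for d
    unfolding lab_def by (rule tensor_swap_pure[OF assms(1) D assms(2) e])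
  show "tensor_swap K V (dir_module K) (lab_star K V \<omega>) =
      pure_tensor K (dir_module K) V (basis_vec K Prec) \<omega> \<oplus>\<^bsub>tensor_module K (dir_module K) V\<^esub>
      pure_tensor K (dir_module K) V (basis_vec K Succ) \<omega>"
    unfolding lab_star_def bsu_module_def
    by (simp add: lab linear_map_add[OF tensor_swap_linear[OF assms(1) D]]
        linear_map_closed[OF lab_linear[OF assms(1)], unfolded bsu_module_def] assms(2))
qed

text \<open>Linearity in \<open>r\<close> lets \<open>r\<close> be a single tree. Then
  \<open>Psi\<close> annihilates the terms of the relator that have the other shape, and in the
  remaining ones each vertex label of \<open>r\<close> is tensored with the direction at the same
  vertex.\<close>

lemma Psi_dend_relator:
  assumes "field K" and "module K V" and "x \<in> {1, 2, 3}" and "r \<in> carrier (arity (free_operad K V) 3)"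
  shows "Psi K (dir_module K) V
      (pure_tensor K (arity (free_operad K (dir_module K)) 3) (arity (free_operad K V) 3) (dend_relator K x) r) =
    tree_map K (tensor_module K (dir_module K) V) (tensor_swap K V (dir_module K)) 3 ` bsu_map K V 3 x r"
    (is "?lhs r = ?rhs r")
proof -
  interpret V: module K V by fact
  note cr = V.R.is_cring
  let ?D = "dir_module K"
  let ?U = "tensor_module K ?D V" and ?W = "bsu_module K V"
  let ?A = "arity (free_operad K ?D) 3" and ?B = "arity (free_operad K V) 3"
  let ?T = "arity (free_operad K ?U) 3"
  let ?e = "basis_vec K :: dir \<Rightarrow> dir \<Rightarrow> 'a" and ?p = "pure_tensor K ?D V"
  let ?s = "tensor_swap K V ?D"
  note D = dir_module_module[OF cr] and e = dir_basis_closed[OF cr]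
  note U = tensor_module_module[OF D assms(2)]
  note A = free_operad_module[OF D, of 3] and B = free_operad_module[OF assms(2), of 3]
  interpret A: module K ?A by (rule A)
  interpret T: module K ?T by (rule free_operad_module[OF U])
  interpret U: module K ?U by (rule U)
  note p = pure_tensor_closed[OF D e]
  have s: "linear_map K ?W ?U ?s"
    unfolding bsu_module_def by (rule tensor_swap_linear[OF assms(2) D])
  have s_bij: "bij_betw ?s (carrier ?W) (carrier ?U)"
    unfolding bsu_module_def by (rule tensor_swap_bij[OF assms(2) D])
  have F: "ns_operad_iso K (free_operad K ?W) (free_operad K ?U) (\<lambda>n A. tree_map K ?U ?s n ` A)"
    and F_tree: "\<And>n t. t \<in> ltrees ?W n \<Longrightarrow>
      tree_map K ?U ?s n ` tree_elem K ?W t = tree_elem K ?U (map_tree ?s t)"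
    by (rule free_operad_iso[OF assms(1) bsu_module_module[OF assms(2)] U s s_bij]; assumption)+
  have F_linear: "linear_map K (arity (free_operad K ?W) 3) ?T (\<lambda>A. tree_map K ?U ?s 3 ` A)"
    using F by (simp add: ns_operad_iso_def)
  have lhs_linear: "linear_map K ?B ?T ?lhs"
    by (rule linear_map_compose[OF pure_tensor_linear_right[OF A B dend_relator_closed[OF cr]]
          Psi_linear[OF D assms(2)]])
  have rhs_linear: "linear_map K ?B ?T ?rhs"
    by (rule linear_map_compose[OF bsu_map_linear[OF assms(2)] F_linear])
  show ?thesis
  proof (rule free_operad_linear_map_eqI[OF assms(2) T.module_axioms lhs_linear rhs_linear _ assms(4)])
    fix t assume t: "t \<in> ltrees V 3"
    \<comment> \<open>With the tree \<open>t\<close> fixed, the left side is linear in its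
      dendriform argument and can be expanded over the terms of the relator.\<close>
    let ?L = "\<lambda>a. Psi K ?D V (pure_tensor K ?A ?B a (tree_elem K V t))"
    have L: "linear_map K ?A ?T ?L"
      by (rule linear_map_compose[OF pure_tensor_linear_left[OF A B tree_elem_closed[OF assms(2) t]]
            Psi_linear[OF D assms(2)]])
    note c = tree_elem_closed[OF D circ_tree_ltrees(1)[OF e e]]
      tree_elem_closed[OF D circ_tree_ltrees(2)[OF e e]]
    note L_simps = linear_map_add[OF L] linear_map_diff[OF A T.module_axioms L] c
      Psi_tree[OF D assms(2) circ_tree_ltrees(1)[OF e e] t]
      Psi_tree[OF D assms(2) circ_tree_ltrees(2)[OF e e] t]
    note u1 = tree_elem_closed[OF U circ_tree_ltrees(1)] and u2
        = tree_elem_closed[OF U circ_tree_ltrees(2)]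
    \<comment> \<open>A starred vertex is never the root, since the root lies on the path to every
      leaf. Additivity in the inner label is therefore what reassembles the expanded star.\<close>
    note U_simps = u1 u2 p linear_map_add[OF tree_elem_circ1_right[OF U]]
      linear_map_add[OF tree_elem_circ2_right[OF U]] T.minus_eq T.minus_add T.minus_minus
    have R: "?rhs (tree_elem K V t) = tree_elem K ?U (map_tree ?s (bsu_tree K V x t))"
      by (simp add: bsu_map_tree[OF assms(2) t] F_tree[OF bsu_tree_ltrees[OF assms(2) t]])
    let ?q1 = "\<lambda>a b. psi_tree K ?D V (circ1_tree (?e a) (?e b)) t"
      and ?q2 = "\<lambda>a b. psi_tree K ?D V (circ2_tree (?e a) (?e b)) t"
    have L_d: "?lhs (tree_elem K V t) =
        (if x = 1 then ?q1 Prec Prec \<ominus>\<^bsub>?T\<^esub> (?q2 Prec Prec \<oplus>\<^bsub>?T\<^esub> ?q2 Prec Succ)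
         else if x = 2 then ?q1 Prec Succ \<ominus>\<^bsub>?T\<^esub> ?q2 Succ Prec
         else (?q1 Succ Prec \<oplus>\<^bsub>?T\<^esub> ?q1 Succ Succ) \<ominus>\<^bsub>?T\<^esub> ?q2 Succ Succ)"
      by (simp add: dend_relator_def Let_def L_simps)
    show "?lhs (tree_elem K V t) = ?rhs (tree_elem K V t)"
      using t
    proof (cases rule: ltrees_3_cases)
      case (circ1 \<omega> \<nu>)
      \<comment> \<open>On a left comb the path to leaf 3 is the one that avoids the inner vertex,
        so the star appears there. On a right comb leaf 1 has this role.\<close>
      have M: "map_tree ?s (bsu_tree K V x t) =
          (if x = 1 then circ1_tree (?p (?e Prec) \<omega>) (?p (?e Prec) \<nu>)
           else if x = 2 then circ1_tree (?p (?e Prec) \<omega>) (?p (?e Succ) \<nu>)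
           else circ1_tree (?p (?e Succ) \<omega>) (?p (?e Prec) \<nu> \<oplus>\<^bsub>?U\<^esub> ?p (?e Succ) \<nu>))"
        using assms(3) circ1 by (auto simp: circ1_tree_def lab_swap[OF assms(2)])
      show ?thesis
        unfolding L_d R M unfolding circ1(3) using assms(3) circ1(1,2)
        by (elim insertE emptyE) (simp_all add: psi_tree_simps U_simps)
    next
      case (circ2 \<omega> \<nu>)
      have M: "map_tree ?s (bsu_tree K V x t) =
          (if x = 1 then circ2_tree (?p (?e Prec) \<omega>) (?p (?e Prec) \<nu> \<oplus>\<^bsub>?U\<^esub> ?p (?e Succ) \<nu>)
           else if x = 2 then circ2_tree (?p (?e Succ) \<omega>) (?p (?e Prec) \<nu>)
           else circ2_tree (?p (?e Succ) \<omega>) (?p (?e Succ) \<nu>))"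
        using assms(3) circ2 by (auto simp: circ2_tree_def lab_swap[OF assms(2)])
      show ?thesis
        unfolding L_d R M unfolding circ2(3) using assms(3) circ2(1,2)
        by (elim insertE emptyE) (simp_all add: psi_tree_simps U_simps)
    qed
  qed
qed

section \<open>Comparison of the two presentations\<close>

theorem theorem3p3:
  fixes K :: "('a, 'k) ring_scheme" and P :: "('a, 'v) quad_pres"
  assumes "field K" and "binary_quadratic K P"
  shows "operad_isomorphic K
    (presented_operad K (BSu K P)) (presented_operad K (black_square K (Dend K) P))"
proof -
  let ?V = "gens P" and ?D = "dir_module K"
  have V: "module K ?V" and R: "submodule (rels P) K (arity (free_operad K ?V) 3)"
    using assms(2) by (auto simp: binary_quadratic_def)
  interpret V: module K ?V by (rule V)
  note cr = V.R.is_cring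
  note D = dir_module_module[OF cr]
  let ?U = "tensor_module K ?D ?V" and ?W = "bsu_module K ?V"
  let ?A = "arity (free_operad K ?D) 3" and ?B = "arity (free_operad K ?V) 3"
  let ?T = "arity (free_operad K ?U) 3"
  let ?F = "\<lambda>n A. tree_map K ?U (tensor_swap K ?V ?D) n ` A"
  note A = free_operad_module[OF D, of 3] and B = free_operad_module[OF V, of 3]
  note U = tensor_module_module[OF D V] and W = bsu_module_module[OF V]
  note T = free_operad_module[OF U, of 3]
  note AB = tensor_module_module[OF A B]
  note R_sub = subsetD[OF submodule_subset[OF R]]
  note Psi = Psi_linear[OF D V] and d = dend_relator_closed[OF cr]
  let ?G = "rels (BSu K P)" and ?H = "rels (black_square K (Dend K) P)"
  have G: "?G = {bsu_map K ?V 3 x r | r x. r \<in> rels P \<and> x \<in> {1, 2, 3}}"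
    by (simp add: BSu_def)
  let ?S = "tensor_subspace K ?A ?B (rels (Dend K)) (rels P)"
  have H: "?H = Psi K ?D ?V ` ?S"
    by (simp add: black_square_def Dend_simps)
  have d_rels: "dend_relator K x \<in> rels (Dend K)" if "x \<in> {1, 2, 3}" for x
    unfolding Dend_simps using that by (intro subsetD[OF linear_span_superset] imageI)
  have Dend_sub: "submodule (rels (Dend K)) K ?A"
    unfolding Dend_simps using d by (intro linear_span_submodule A) auto
  have gen: "{pure_tensor K ?A ?B s r | s r. s \<in> rels (Dend K) \<and> r \<in> rels P}
      \<subseteq> carrier (tensor_module K ?A ?B)"
    by (auto intro!: pure_tensor_closed[OF A] R_sub subsetD[OF submodule_subset[OF Dend_sub]])
  have S: "?S \<subseteq> carrier (tensor_module K ?A ?B)"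
    unfolding tensor_subspace_def by (rule submodule_subset[OF linear_span_submodule[OF AB gen]])
  \<comment> \<open>An isomorphism of the free operads, before any relator of \<open>P\<close> is
    imposed. It comes from the generators alone.\<close>
  have iso: "ns_operad_iso K (free_operad K ?W) (free_operad K ?U) ?F"
    unfolding bsu_module_def
    by (rule free_operad_iso[OF assms(1) tensor_module_module[OF V D] U tensor_swap_linear[OF V D]
          tensor_swap_bij[OF V D]])
  have "operad_isomorphic K
      (quot_operad (free_operad K ?W) (generated_ideal K (free_operad K ?W) 3 ?G))
      (quot_operad (free_operad K ?U) (generated_ideal K (free_operad K ?U) 3 ?H))"
  proof (rule operad_isomorphic_quot_generated[OF iso])
    show "?G \<subseteq> carrier (arity (free_operad K ?W) 3)"
      unfolding G by (auto intro!: linear_map_closed[OF bsu_map_linear[OF V]] R_sub)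
    show "?H \<subseteq> carrier ?T"
      unfolding H by (auto intro!: linear_map_closed[OF Psi] subsetD[OF S])
    \<comment> \<open>A bisuccessor relator corresponds to \<open>Psi\<close> of one pure tensor, a
      dendriform relator with an element of \<open>rels P\<close>.\<close>
    show "?F 3 ` ?G \<subseteq> ?H"
    proof
      fix y assume "y \<in> ?F 3 ` ?G"
      then obtain r x where r: "r \<in> rels P" and x: "x \<in> {1, 2, 3}" and y: "y = ?F 3 (bsu_map K ?V 3 x r)"
        unfolding G by blast
      have "pure_tensor K ?A ?B (dend_relator K x) r \<in> ?S"
        unfolding tensor_subspace_def
        by (intro subsetD[OF linear_span_superset] CollectI exI[of _ "dend_relator K x"] exI[of _ r]
            conjI refl d_rels x r)
      then show "y \<in> ?H"
        unfolding H y Psi_dend_relator[OF assms(1) V x R_sub[OF r], symmetric] by (rule imageI)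
    qed
    \<comment> \<open>A general element of the right-hand relators involves two nested spans: the
      tensor subspace is spanned by pure tensors, and their first factors run through the span of
      the dendriform relators. The two are removed by taking preimages of \<open>N\<close>, the
      inner one first.\<close>
    fix N assume N: "submodule N K ?T" and GN: "?F 3 ` ?G \<subseteq> N"
    have "pure_tensor K ?A ?B s r \<in> {z \<in> carrier (tensor_module K ?A ?B). Psi K ?D ?V z \<in> N}"
      if s: "s \<in> rels (Dend K)" and r: "r \<in> rels P" for s r
    proof -
      let ?L = "\<lambda>s. Psi K ?D ?V (pure_tensor K ?A ?B s r)"
      have L: "linear_map K ?A ?T ?L"
        by (rule linear_map_compose[OF pure_tensor_linear_left[OF A B R_sub[OF r]] Psi])
      \<comment> \<open>With \<open>r\<close> fixed, the first factors that \<open>Psi\<close> sends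
        into \<open>N\<close> form a submodule, so it suffices that this submodule contains the
        three dendriform relators.\<close>
      have "rels (Dend K) \<subseteq> {s \<in> carrier ?A. ?L s \<in> N}"
        unfolding Dend_simps
      proof (intro linear_span_minimal submodule_preimage[OF A T L N] subsetI)
        fix s assume "s \<in> dend_relator K ` {1, 2, 3}"
        then obtain x where x: "x \<in> {1, 2, 3}" and s: "s = dend_relator K x" by blast
        have "bsu_map K ?V 3 x r \<in> ?G" unfolding G using r x by blast
        then have "?L s \<in> N"
          unfolding s Psi_dend_relator[OF assms(1) V x R_sub[OF r]]
          by (intro subsetD[OF GN] imageI)
        then show "s \<in> {s \<in> carrier ?A. ?L s \<in> N}" using s d by simp
      qed
      then have "s \<in> carrier ?A" and "?L s \<in> N" using s by auto
      then show ?thesis by (simp add: pure_tensor_closed[OF A _ R_sub[OF r]])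
    qed
    then have "{pure_tensor K ?A ?B s r | s r. s \<in> rels (Dend K) \<and> r \<in> rels P}
        \<subseteq> {z \<in> carrier (tensor_module K ?A ?B). Psi K ?D ?V z \<in> N}"
      by (intro subsetI, elim CollectE exE conjE) simp
    \<comment> \<open>The same argument on the tensor product passes from pure tensors to their
      span.\<close>
    then have "?S \<subseteq> {z \<in> carrier (tensor_module K ?A ?B). Psi K ?D ?V z \<in> N}"
      unfolding tensor_subspace_def
      by (intro linear_span_minimal submodule_preimage[OF AB T Psi N])
    then show "?H \<subseteq> N" unfolding H by auto
  qed
  then show ?thesis
    by (simp add: presented_operad_def Let_def BSu_def black_square_def Dend_simps)
qed

end
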